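(* Assume $H\in(\tfrac12,1)$, $\alpha>0$ and $\alpha+2H>2$, and let $\phi$, $\psi$, $\mathrm{Tr}^m$ and the multiple Stratonovich integrals $\mathbb I_m$ be as in the context. Then for all $m,k\in\mathbb N_0$, $$\mathbb E[\mathbb I_m(\phi_m)^2]\le2^m(m+1)!\,\mathrm{Tr}^m\phi_{2m}\qquad\text{and}\qquad\mathbb E[\mathbb I_m(\psi_{m,k})^2]\le2^m(m+1)!\,\mathrm{Tr}^m\psi_{2m,2k}.$$
   Context: $\mathbb N_0=\{0,1,2,\dots\}$. $\tau_1$ is an $\mathbb N$-valued random variable ($\mathbb N=\{1,2,\dots\}$) with $\mathbb P(\tau_1=n)=L(n)/n^{1+\alpha}$, $n\ge1$, where $L:(0,\infty)\to(0,\infty)$ is slowly varying ($\lim_{t\to\infty}L(at)/L(t)=1$ for every $a>0$). $\phi_k$ is the symmetric function on $(0,1)^k$ that equals $0$ if two coordinates coincide, and for $0<t_1<\dots<t_k<1$ (with $t_0:=0$): $\phi_k=C_\alpha^k\prod_{i=1}^k(t_i-t_{i-1})^{\alpha-1}$ with $C_\alpha=\alpha\sin(\pi\alpha)/\pi$ if $1-H<\alpha<1$; $\phi_k=(1/\mathbb E[\tau_1])^k$ if $\mathbb E[\tau_1]<\infty$; $\phi_k=1$ if $\alpha=1$ and $\mathbb E[\tau_1]=\infty$; $\phi_0:=1$. $\psi_{m,k}(t_1,\dots,t_m):=\int_{[0,1]^k}\phi_{m+k}(t_1,\dots,t_{m+k})\,\mathrm dt_{m+1}\cdots\mathrm dt_{m+k}$.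 For $f$ on $[0,1]^n$ and $0\le j\le\lfloor n/2\rfloor$, the $j$-th order trace is $$\mathrm{Tr}^jf(t_1,\dots,t_{n-2j}):=\int_{[0,1]^{2j}}f(s_1,\dots,s_{2j},t_1,\dots,t_{n-2j})\prod_{i=1}^j|s_{2i}-s_{2i-1}|^{2H-2}\,\mathrm d\boldsymbol s;$$ in particular, for $n=2m$, $\mathrm{Tr}^mf$ is a number. $\{W(f):f\in\mathcal H\}$ is an isonormal Gaussian process over the Hilbert space $\mathcal H$, the completion of smooth compactly supported functions under $\langle f,g\rangle_{\mathcal H}=\int_0^1\int_0^1f(s)g(t)|s-t|^{2H-2}\,\mathrm ds\,\mathrm dt$. $\mathbf I_m$ is the $m$-th multiple Wiener integral: $\mathbf I_m(g^{\otimes m})=H_m(W(g))$ for $\|g\|_{\mathcal H}=1$, with $H_m(x)=(-1)^me^{x^2/2}\frac{\mathrm d^m}{\mathrm dx^m}e^{-x^2/2}$, extended linearly and continuously to symmetric elements of $\mathcal H^{\otimes m}$ so that $\mathbb E[\mathbf I_m(f)\mathbf I_n(g)]=\mathbf 1_{\{m=n\}}m!\langle f,g\rangle_{\mathcal H^{\otimes m}}$; $\mathbf I_0(c)=c$. The multiple Stratonovich integral $\mathbb I_n$ is determined by $\mathbb I_n(g^{\otimes n})=W(g)^n$, linearity and limits; for symmetric $f$ it is given by the Hu--Meyer formula $\mathbb I_n(f)=\sum_{j=0}^{\lfloor n/2\rfloor}\frac{n!}{j!(n-2j)!2^j}\mathbf I_{n-2j}(\mathrm{Tr}^jf)$, whenever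 the right-hand side is well defined in $L^2$. *)

theory Defs
  imports "HOL-Probability.Probability"
begin

section \<open>Functions on the unit cube\<close>

definition unit_leb :: "real measure" where
  "unit_leb = restrict_space lborel {0..1}"

text \<open>A point of the n-dimensional unit cube is a function on \<open>{..<n}\<close>, so coordinates are
  numbered from 0. The only point of \<open>cube 0\<close> is \<open>\<lambda>_. undefined\<close>, and it has mass 1.\<close>

definition cube :: "nat \<Rightarrow> (nat \<Rightarrow> real) measure" where
  "cube n = Pi\<^sub>M {..<n} (\<lambda>_. unit_leb)"

definition join :: "nat \<Rightarrow> (nat \<Rightarrow> real) \<Rightarrow> (nat \<Rightarrow> real) \<Rightarrow> nat \<Rightarrow> real" where
  "join k s t = (\<lambda>i. if i < k then s i else t (i - k))"

definition trace_integrand ::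
  "real \<Rightarrow> nat \<Rightarrow> ((nat \<Rightarrow> real) \<Rightarrow> real) \<Rightarrow> (nat \<Rightarrow> real) \<Rightarrow> (nat \<Rightarrow> real) \<Rightarrow> real" where
  "trace_integrand H j f t s =
     f (join (2 * j) s t) * (\<Prod>i<j. \<bar>s (2 * i + 1) - s (2 * i)\<bar> powr (2 * H - 2))"

definition frac_trace ::
  "real \<Rightarrow> nat \<Rightarrow> ((nat \<Rightarrow> real) \<Rightarrow> real) \<Rightarrow> (nat \<Rightarrow> real) \<Rightarrow> real" where
  "frac_trace H j f t = (LINT s|cube (2 * j). trace_integrand H j f t s)"

text \<open>The trace of order m of a function of \<open>2 * m\<close> variables, as a number.\<close>

definition full_trace :: "real \<Rightarrow> nat \<Rightarrow> ((nat \<Rightarrow> real) \<Rightarrow> real) \<Rightarrow> real" where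
  "full_trace H m f = frac_trace H m f (\<lambda>_. undefined)"


section \<open>The kernels\<close>

definition slowly_varying :: "(real \<Rightarrow> real) \<Rightarrow> bool" where
  "slowly_varying L \<longleftrightarrow>
     (\<forall>t>0. L t > 0) \<and> (\<forall>a>0. ((\<lambda>t. L (a * t) / L t) \<longlongrightarrow> 1) at_top)"

definition C_const :: "real \<Rightarrow> real" where
  "C_const \<alpha> = \<alpha> * sin (pi * \<alpha>) / pi"

text \<open>The value at \<open>0 < t\<^sub>1 < \<dots> < t\<^sub>k < 1\<close>, the coordinates being given as an increasing list; \<open>0 # ts\<close>
  supplies \<open>t\<^sub>0 = 0\<close>. The last branch is the case \<open>\<alpha> = 1\<close> with infinite mean.\<close>

definition phi_sorted ::
  "real \<Rightarrow> real \<Rightarrow> 'q measure \<Rightarrow> ('q \<Rightarrow> nat) \<Rightarrow> real list \<Rightarrow> real" where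
  "phi_sorted H \<alpha> N \<tau> ts =
     (if 1 - H < \<alpha> \<and> \<alpha> < 1
      then C_const \<alpha> ^ length ts * (\<Prod>i<length ts. (ts ! i - (0 # ts) ! i) powr (\<alpha> - 1))
      else if integrable N (\<lambda>\<omega>. real (\<tau> \<omega>))
      then (1 / (LINT \<omega>|N. real (\<tau> \<omega>))) ^ length ts
      else 1)"

definition phi ::
  "real \<Rightarrow> real \<Rightarrow> 'q measure \<Rightarrow> ('q \<Rightarrow> nat) \<Rightarrow> nat \<Rightarrow> (nat \<Rightarrow> real) \<Rightarrow> real" where
  "phi H \<alpha> N \<tau> k t =
     (if (\<forall>i<k. 0 < t i \<and> t i < 1) \<and> inj_on t {..<k}
      then phi_sorted H \<alpha> N \<tau> (sort (map t [0..<k])) else 0)"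

definition psi ::
  "real \<Rightarrow> real \<Rightarrow> 'q measure \<Rightarrow> ('q \<Rightarrow> nat) \<Rightarrow> nat \<Rightarrow> nat \<Rightarrow> (nat \<Rightarrow> real) \<Rightarrow> real" where
  "psi H \<alpha> N \<tau> m k t = (LINT u|cube k. phi H \<alpha> N \<tau> (m + k) (join m t u))"


section \<open>The Hilbert space and its tensor powers\<close>

definition test_function :: "(real \<Rightarrow> real) \<Rightarrow> bool" where
  "test_function g \<longleftrightarrow>
     (\<forall>n x. ((deriv ^^ n) g) field_differentiable (at x)) \<and> closure {x. g x \<noteq> 0} \<subseteq> {0<..<1}"

text \<open>\<open>emb\<close> exhibits the Hilbert space \<open>'h\<close> as the completion of the test functions. Linearity of
  \<open>emb\<close> on test functions follows from the preservation of inner products.\<close>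

definition is_completion ::
  "real \<Rightarrow> ((real \<Rightarrow> real) \<Rightarrow> 'h::{real_inner,complete_space}) \<Rightarrow> bool" where
  "is_completion H emb \<longleftrightarrow>
     (\<forall>f g. test_function f \<longrightarrow> test_function g \<longrightarrow>
        inner (emb f) (emb g) =
          (LINT s|unit_leb. LINT t|unit_leb. f s * g t * \<bar>s - t\<bar> powr (2 * H - 2))) \<and>
     closure (emb ` Collect test_function) = UNIV"

text \<open>The Hilbert space \<open>'k\<close> holds a copy of every tensor power of \<open>'h\<close>:
  \<open>tens [h\<^sub>1, \<dots>, h\<^sub>m]\<close> is the elementary tensor of its arguments, and \<open>tensor_power tens m\<close> is the
  m-th power. Multilinearity of \<open>tens\<close> follows from the formula for the inner product.\<close>

definition is_tensor ::
  "('h::{real_inner,complete_space} list \<Rightarrow> 'k::{real_inner,complete_space}) \<Rightarrow> bool" where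
  "is_tensor tens \<longleftrightarrow>
     (\<forall>xs ys. length xs = length ys \<longrightarrow>
        inner (tens xs) (tens ys) = (\<Prod>i<length xs. inner (xs ! i) (ys ! i)))"

definition tensor_power ::
  "('h::{real_inner,complete_space} list \<Rightarrow> 'k::{real_inner,complete_space}) \<Rightarrow> nat \<Rightarrow> 'k set"
  where
  "tensor_power tens m = closure (span (tens ` {xs. length xs = m}))"

definition frac_kernel :: "real \<Rightarrow> nat \<Rightarrow> (nat \<Rightarrow> real) \<Rightarrow> (nat \<Rightarrow> real) \<Rightarrow> real" where
  "frac_kernel H m s t = (\<Prod>i<m. \<bar>s i - t i\<bar> powr (2 * H - 2))"

text \<open>The element of the m-th tensor power given by a function \<open>f\<close> on the cube for which the double
  integral defining its squared norm converges absolutely. It is pinned down by its inner products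
  with tensors of test functions, which are total.\<close>

definition represents ::
  "real \<Rightarrow> ((real \<Rightarrow> real) \<Rightarrow> 'h::{real_inner,complete_space}) \<Rightarrow>
   ('h list \<Rightarrow> 'k::{real_inner,complete_space}) \<Rightarrow> nat \<Rightarrow> ((nat \<Rightarrow> real) \<Rightarrow> real) \<Rightarrow> 'k \<Rightarrow> bool" where
  "represents H emb tens m f x \<longleftrightarrow>
     f \<in> borel_measurable (cube m) \<and>
     integrable (cube m \<Otimes>\<^sub>M cube m) (\<lambda>(s, t). \<bar>f s\<bar> * \<bar>f t\<bar> * frac_kernel H m s t) \<and>
     x \<in> tensor_power tens m \<and>
     (\<forall>gs. length gs = m \<longrightarrow> (\<forall>g\<in>set gs. test_function g) \<longrightarrow>
        inner x (tens (map emb gs)) =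
          (LINT s|cube m. LINT t|cube m. f s * (\<Prod>i<m. (gs ! i) (t i)) * frac_kernel H m s t))"

definition tensor_of ::
  "real \<Rightarrow> ((real \<Rightarrow> real) \<Rightarrow> 'h::{real_inner,complete_space}) \<Rightarrow>
   ('h list \<Rightarrow> 'k::{real_inner,complete_space}) \<Rightarrow> nat \<Rightarrow> ((nat \<Rightarrow> real) \<Rightarrow> real) \<Rightarrow> 'k" where
  "tensor_of H emb tens m f = (THE x. represents H emb tens m f x)"


section \<open>Isonormal processes and multiple integrals\<close>

definition centered_gaussian :: "'p measure \<Rightarrow> ('p \<Rightarrow> real) \<Rightarrow> bool" where
  "centered_gaussian M X \<longleftrightarrow>
     X \<in> borel_measurable M \<and>
     ((AE \<omega> in M. X \<omega> = 0) \<or> (\<exists>\<sigma>>0. distributed M lborel X (normal_density 0 \<sigma>)))"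

definition isonormal ::
  "'p measure \<Rightarrow> ('h::{real_inner,complete_space} \<Rightarrow> 'p \<Rightarrow> real) \<Rightarrow> bool" where
  "isonormal M W \<longleftrightarrow>
     prob_space M \<and>
     (\<forall>(n::nat) c h. centered_gaussian M (\<lambda>\<omega>. \<Sum>i<n. c i * W (h i) \<omega>)) \<and>
     (\<forall>f g. (LINT \<omega>|M. W f \<omega> * W g \<omega>) = inner f g)"

definition hermite :: "nat \<Rightarrow> real \<Rightarrow> real" where
  "hermite m x = (-1) ^ m * exp (x\<^sup>2 / 2) * (deriv ^^ m) (\<lambda>y. exp (- y\<^sup>2 / 2)) x"

text \<open>\<open>X\<close> is a version of the m-th Wiener integral of \<open>x\<close>: the values on \<open>g\<close>-powers, \<open>norm g = 1\<close>,
  are extended linearly and then by limits in the tensor power and in mean square.\<close>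

definition is_wiener_int ::
  "'p measure \<Rightarrow> ('h::{real_inner,complete_space} \<Rightarrow> 'p \<Rightarrow> real) \<Rightarrow>
   ('h list \<Rightarrow> 'k::{real_inner,complete_space}) \<Rightarrow> nat \<Rightarrow> 'k \<Rightarrow> ('p \<Rightarrow> real) \<Rightarrow> bool" where
  "is_wiener_int M W tens m x X \<longleftrightarrow>
     X \<in> borel_measurable M \<and>
     (\<exists>(N :: nat \<Rightarrow> nat) (c :: nat \<Rightarrow> nat \<Rightarrow> real) (g :: nat \<Rightarrow> nat \<Rightarrow> 'h).
        (\<forall>n. \<forall>i<N n. norm (g n i) = 1) \<and>
        (\<lambda>n. \<Sum>i<N n. c n i *\<^sub>R tens (replicate m (g n i))) \<longlonglongrightarrow> x \<and>
        (\<lambda>n. \<integral>\<^sup>+\<omega>. ennreal (((\<Sum>i<N n. c n i * hermite m (W (g n i) \<omega>)) - X \<omega>)\<^sup>2) \<partial>M)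
          \<longlonglongrightarrow> 0)"

definition wiener_int ::
  "'p measure \<Rightarrow> ('h::{real_inner,complete_space} \<Rightarrow> 'p \<Rightarrow> real) \<Rightarrow>
   ('h list \<Rightarrow> 'k::{real_inner,complete_space}) \<Rightarrow> nat \<Rightarrow> 'k \<Rightarrow> 'p \<Rightarrow> real" where
  "wiener_int M W tens m x = (SOME X. is_wiener_int M W tens m x X)"

definition symmetric_fun :: "nat \<Rightarrow> ((nat \<Rightarrow> real) \<Rightarrow> real) \<Rightarrow> bool" where
  "symmetric_fun n f \<longleftrightarrow>
     (\<forall>p t. p permutes {..<n} \<longrightarrow> t \<in> space (cube n) \<longrightarrow> f (t \<circ> p) = f t)"

text \<open>Well-definedness of the right-hand side of the Hu--Meyer formula: every trace converges
  absolutely almost everywhere and has a Wiener integral.\<close>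

definition stratonovich_defined ::
  "real \<Rightarrow> ((real \<Rightarrow> real) \<Rightarrow> 'h::{real_inner,complete_space}) \<Rightarrow>
   ('h list \<Rightarrow> 'k::{real_inner,complete_space}) \<Rightarrow> 'p measure \<Rightarrow> ('h \<Rightarrow> 'p \<Rightarrow> real) \<Rightarrow>
   nat \<Rightarrow> ((nat \<Rightarrow> real) \<Rightarrow> real) \<Rightarrow> bool" where
  "stratonovich_defined H emb tens M W n f \<longleftrightarrow>
     symmetric_fun n f \<and>
     (\<forall>j\<le>n div 2.
        (AE t in cube (n - 2 * j). integrable (cube (2 * j)) (trace_integrand H j f t)) \<and>
        (\<exists>x X. represents H emb tens (n - 2 * j) (frac_trace H j f) x \<and>
               is_wiener_int M W tens (n - 2 * j) x X))"

text \<open>Nothing is known about \<open>stratonovich\<close> where \<open>stratonovich_defined\<close> fails, so a bound on it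
  includes the well-definedness of the integral.\<close>

definition stratonovich ::
  "real \<Rightarrow> ((real \<Rightarrow> real) \<Rightarrow> 'h::{real_inner,complete_space}) \<Rightarrow>
   ('h list \<Rightarrow> 'k::{real_inner,complete_space}) \<Rightarrow> 'p measure \<Rightarrow> ('h \<Rightarrow> 'p \<Rightarrow> real) \<Rightarrow>
   nat \<Rightarrow> ((nat \<Rightarrow> real) \<Rightarrow> real) \<Rightarrow> 'p \<Rightarrow> real" where
  "stratonovich H emb tens M W n f =
     (if stratonovich_defined H emb tens M W n f
      then (\<lambda>\<omega>. \<Sum>j\<le>n div 2. fact n / (fact j * fact (n - 2 * j) * 2 ^ j) *
              wiener_int M W tens (n - 2 * j)
                (tensor_of H emb tens (n - 2 * j) (frac_trace H j f)) \<omega>)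
      else undefined)"

end

(*
All cases of phi have the form D^n * prod_i (t_i - t_{i-1})^e on increasing arguments, with e in (1 - 2 H, 0].
Inserting further points only shrinks the gaps, hence
  phi_p(s) * phi_q(t) <= phi_{p+q}(s, t),
and |t_i - t_j|^(2 H - 2) is at most the product of the (2 H - 2)-th powers of the gaps below t_i and t_j,
which makes all traces finite because e + 2 H - 2 > -1.  By the Hu--Meyer formula and the isometry of the Wiener
integrals, E[I_m(psi)^2] is the sum over j of (m! / (j! (m - 2 j)! 2^j))^2 (m - 2 j)! |Tr^j psi|^2.  The squared
norm of Tr^j psi is an integral of psi(s) * psi(t) against a product of m kernels along a perfect matching of the
2 m variables; by the inequality above and symmetry it is at most Tr^m psi_{2m,2k}.  The numerical factor is
m! * sum_j C(m, 2 j) C(2 j, j) / 4^j <= m! * 2^m.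
The elements of the tensor powers come from the Riesz representation theorem, for which the kernel must be
positive semidefinite: up to a constant, |s - t|^(2 H - 2) is the integral of (s - u)_+^(H - 3/2) (t - u)_+^(H - 3/2).
*)
theory Submission
  imports Defs "HOL-Combinatorics.Permutations"
begin

section \<open>Riesz representation on a subspace\<close>

text \<open>Both bounds are one statement, because \<open>phi\<close> is the case k = 0 of
  \<open>psi\<close>. Three obstacles shape the rest. The isometry rests on E H_i(X) H_j(Y) = i! r^i
  for a Gaussian pair with correlation r. Only the laws of linear combinations of the pair are
  given, and r may be 1 or -1, so there is no joint density to integrate. Mixed moments are read off
  as coefficients of E (X + b Y)^n in b; they give Stein's identity, and that gives orthogonality.
  Traces are unbounded and may diverge on null sets. Estimates are therefore made for majorants with
  values in \<open>ennreal\<close>, where positivity of the kernel is used as 2 <F, G> <= <F, F> +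
  <G, G>, free of subtraction. The Riesz argument then delivers the representing element together
  with the bound on its norm. Wiener integrals are approximated through powers of unit vectors only,
  whereas \<open>represents\<close> prescribes the inner products with all tensors of test
  functions. Riesz is applied on the span of powers, which puts the element into the closure of that
  span; Ryser's formula and the symmetry of the trace supply the other inner products.\<close>

lemma quad_nonneg_imp:
  fixes a b :: real
  assumes "\<And>t. 0 \<le> a * t\<^sup>2 + b * t"
  shows "b = 0"
proof (rule ccontr)
  assume b: "b \<noteq> 0"
  show False
  proof (cases "a > 0")
    case True
    have "0 \<le> a * (- b / (2 * a))\<^sup>2 + b * (- b / (2 * a))" by (rule assms)
    also have "\<dots> = - b\<^sup>2 / (4 * a)" using True by (simp add: field_simps power2_eq_square)
    finally have "b\<^sup>2 / (4 * a) \<le> 0" by simp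
    moreover have "b\<^sup>2 / (4 * a) > 0" using True b by simp
    ultimately show False by linarith
  next
    case False
    have "0 \<le> a * (- b)\<^sup>2 + b * (- b)" by (rule assms)
    also have "\<dots> = (a - 1) * b\<^sup>2" by (simp add: algebra_simps power2_eq_square)
    finally show False using False b by (simp add: zero_le_mult_iff)
  qed
qed

text \<open>\<open>P\<close> is the graph of a functional, which the bound shows to be well defined and continuous; \<open>x\<close>
  minimizes \<open>(norm v)\<^sup>2 - 2 * b\<close>.\<close>

lemma riesz_on_subspace:
  fixes P :: "('k::{real_inner,complete_space} \<times> real) set"
  assumes P: "subspace P" and bound: "\<And>v b. (v, b) \<in> P \<Longrightarrow> - C \<le> (norm v)\<^sup>2 - 2 * b"
  obtains x where "x \<in> closure (fst ` P)" "\<And>v b. (v, b) \<in> P \<Longrightarrow> inner x v = b" "(norm x)\<^sup>2 \<le> C"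
proof -
  define J where "J = (\<lambda>(v::'k, b::real). inner v v - 2 * b)"
  define I where "I = Inf (J ` P)"
  have ne: "J ` P \<noteq> {}" using subspace_0[OF P] by auto
  have bdd: "bdd_below (J ` P)"
    by (rule bdd_belowI[of _ "- C"]) (use bound in \<open>auto simp: J_def power2_norm_eq_inner\<close>)
  have I_le: "I \<le> J p" if "p \<in> P" for p unfolding I_def using that bdd by (auto intro: cInf_lower)
  have IC: "- C \<le> I" unfolding I_def using ne by (rule cInf_greatest) (use bound in \<open>auto simp: J_def power2_norm_eq_inner\<close>)
  have "\<exists>p\<in>P. J p < I + 1 / real (Suc n)" for n
  proof -
    have "I < I + 1 / real (Suc n)" by simp
    then show ?thesis unfolding I_def using cInf_lessD[OF ne] by (metis imageE)
  qed
  then obtain p where p: "\<And>n. p n \<in> P" "\<And>n. J (p n) < I + 1 / real (Suc n)" by metis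
  define v where "v n = fst (p n)" for n
  \<comment> \<open>Parallelogram law: the midpoint lies in \<open>P\<close>, where \<open>J\<close>
    is at least \<open>I\<close>, so two near-minimizers have close first components.\<close>
  have cau: "(norm (v n - v l))\<^sup>2 \<le> 2 / real (Suc n) + 2 / real (Suc l)" for n l
  proof -
    have mid: "(1/2) *\<^sub>R (p n + p l) \<in> P" using P p by (simp add: subspace_add subspace_scale)
    have par: "J (p n) + J (p l) - 2 * J ((1/2) *\<^sub>R (p n + p l)) = (norm (v n - v l))\<^sup>2 / 2"
      unfolding J_def v_def
      by (simp add: split_beta power2_norm_eq_inner inner_add inner_diff inner_commute algebra_simps)
    show ?thesis using I_le[OF mid] p(2)[of n] p(2)[of l] par by (simp add: algebra_simps)
  qed
  have "Cauchy v"
  proof (rule metric_CauchyI)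
    fix e :: real assume e: "e > 0"
    obtain n0 where n0: "real n0 > 4 / e\<^sup>2" using reals_Archimedean2 by blast
    show "\<exists>M. \<forall>m\<ge>M. \<forall>n\<ge>M. dist (v m) (v n) < e"
    proof (intro exI allI impI)
      fix m n assume mn: "m \<ge> n0" "n \<ge> n0"
      have n0p: "real n0 > 0" using n0 e by (meson divide_pos_pos less_trans zero_less_numeral zero_less_power)
      have "2 / real (Suc m) \<le> 2 / real (Suc n0)" "2 / real (Suc n) \<le> 2 / real (Suc n0)"
        using mn by (auto intro!: divide_left_mono)
      then have "(norm (v m - v n))\<^sup>2 \<le> 4 / real (Suc n0)" using cau[of m n] by linarith
      also have "\<dots> < e\<^sup>2" using n0 e n0p by (simp add: field_simps) (use e in \<open>smt (verit) zero_less_power\<close>)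
      finally show "dist (v m) (v n) < e" using e by (simp add: dist_norm power_less_imp_less_base)
    qed
  qed
  then obtain x where x: "v \<longlonglongrightarrow> x" by (auto simp: Cauchy_convergent_iff convergent_def)
  have clos: "x \<in> closure (fst ` P)"
    using x p(1) unfolding closure_sequential by (intro exI[of _ v]) (auto simp: v_def)
  have b0: "(\<lambda>n. 1 / real (Suc n)) \<longlonglongrightarrow> 0"
    using LIMSEQ_inverse_real_of_nat by (simp add: inverse_eq_divide)
  \<comment> \<open>Moving \<open>p n\<close> by t times (w, b) cannot bring \<open>J\<close> below
    \<open>I\<close>, and \<open>J (p n)\<close> exceeds \<open>I\<close> by less than 1 / Suc n.
    Only the first components converge, but the second ones cancel in the difference. The limit is a
    nonnegative quadratic in t without constant term.\<close>
  have inn: "inner x w = b" if wb: "(w, b) \<in> P" for w b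
  proof -
    have *: "0 \<le> inner w w * t\<^sup>2 + 2 * (inner x w - b) * t" for t
    proof -
      have "0 \<le> inner w w * t\<^sup>2 + 2 * (inner (v n) w - b) * t + 1 / real (Suc n)" for n
      proof -
        have "p n + t *\<^sub>R (w, b) \<in> P" using P p wb by (intro subspace_add subspace_scale) auto
        from I_le[OF this] p(2)[of n] show ?thesis
          unfolding J_def v_def
          by (simp add: split_beta inner_add inner_commute power2_eq_square algebra_simps)
      qed
      moreover have "(\<lambda>n. inner w w * t\<^sup>2 + 2 * (inner (v n) w - b) * t + 1 / real (Suc n))
          \<longlonglongrightarrow> inner w w * t\<^sup>2 + 2 * (inner x w - b) * t + 0"
        by (intro tendsto_intros x b0)
      ultimately show ?thesis using LIMSEQ_le_const[of _ _ 0] by (smt (verit))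
    qed
    show ?thesis using quad_nonneg_imp[OF *] by simp
  qed
  have "(norm x)\<^sup>2 \<le> C"
  proof -
    have "- C \<le> (norm (v n))\<^sup>2 - 2 * inner x (v n)" for n
    proof -
      have "(v n, snd (p n)) \<in> P" using p(1)[of n] by (simp add: v_def)
      from bound[OF this] inn[OF this] show ?thesis by simp
    qed
    moreover have "(\<lambda>n. (norm (v n))\<^sup>2 - 2 * inner x (v n)) \<longlonglongrightarrow> (norm x)\<^sup>2 - 2 * inner x x"
      by (intro tendsto_intros x)
    ultimately have "- C \<le> (norm x)\<^sup>2 - 2 * inner x x" using LIMSEQ_le_const by blast
    then show ?thesis by (simp add: power2_norm_eq_inner)
  qed
  with clos inn that show ?thesis by blast
qed

section \<open>Test functions\<close>

lemma power_le_fact_exp: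
  fixes y :: real assumes "y \<ge> 0" shows "y ^ n \<le> fact n * exp y"
proof -
  have "(\<Sum>k\<in>{n}. y ^ k /\<^sub>R fact k) \<le> (\<Sum>k. y ^ k /\<^sub>R fact k)"
    by (rule sum_le_suminf[OF summable_exp_generic]) (use assms in auto)
  then show ?thesis by (simp add: exp_def divide_simps mult.commute)
qed

text \<open>The polynomial in the denominator is q(x) = (x - 1/4) (3/4 - x). The numerator p and the
  power k are parameters so that the family is closed under differentiation.\<close>

definition bump :: "real poly \<Rightarrow> nat \<Rightarrow> real \<Rightarrow> real" where
  "bump p k x = (if 1/4 < x \<and> x < 3/4
     then poly p x / poly [:-3/16, 1, -1:] x ^ k * exp (- 1 / poly [:-3/16, 1, -1:] x) else 0)"

text \<open>The derivative is again a \<open>bump\<close>, with k + 2 in place of k, so smoothness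
  of all orders becomes an induction. Inside the interval this is the product and quotient rule; at
  1/4 and 3/4 the factor exp(-1/q) beats every power of 1/q.\<close>

lemma bump_has_derivative:
  defines "q \<equiv> [:-3/16, 1, -1:] :: real poly"
  shows "(bump p k has_field_derivative
    bump (pderiv p * q\<^sup>2 - smult (real k) (p * pderiv q * q) + p * pderiv q) (k + 2) x) (at x)"
proof -
  have q: "poly q y = (y - 1/4) * (3/4 - y)" for y by (simp add: q_def field_simps)
  define r where "r = pderiv p * q\<^sup>2 - smult (real k) (p * pderiv q * q) + p * pderiv q"
  consider "1/4 < x" "x < 3/4" | "x < 1/4 \<or> x > 3/4" | "x = 1/4 \<or> x = 3/4" by linarith
  then have "(bump p k has_field_derivative bump r (k + 2) x) (at x)"
  proof cases
    case 1
    then have pos: "poly q x > 0" by (simp add: q)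
    have "((\<lambda>x. poly p x / poly q x ^ k * exp (- 1 / poly q x)) has_field_derivative
        poly r x / poly q x ^ (k + 2) * exp (- 1 / poly q x)) (at x)"
    proof -
      have "((\<lambda>x. poly p x * inverse (poly q x ^ k) * exp (- inverse (poly q x))) has_field_derivative
          (poly (pderiv p) x * inverse (poly q x ^ k)
           + poly p x * (- (inverse (poly q x ^ k) * (real k * poly q x ^ (k - 1) * poly (pderiv q) x) * inverse (poly q x ^ k))))
            * exp (- inverse (poly q x))
          + poly p x * inverse (poly q x ^ k) * (exp (- inverse (poly q x)) *
              (inverse (poly q x) * poly (pderiv q) x * inverse (poly q x)))) (at x)"
        using pos by (auto intro!: derivative_eq_intros poly_DERIV simp: algebra_simps)
      moreover have "(poly (pderiv p) x * inverse (poly q x ^ k)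
           + poly p x * (- (inverse (poly q x ^ k) * (real k * poly q x ^ (k - 1) * poly (pderiv q) x) * inverse (poly q x ^ k))))
            * exp (- inverse (poly q x))
          + poly p x * inverse (poly q x ^ k) * (exp (- inverse (poly q x)) *
              (inverse (poly q x) * poly (pderiv q) x * inverse (poly q x)))
        = poly r x / poly q x ^ (k + 2) * exp (- 1 / poly q x)"
        using pos unfolding r_def
        by (cases k) (auto simp: field_simps power2_eq_square)
      ultimately show ?thesis by (simp add: field_simps)
    qed
    moreover have "bump r (k + 2) x = poly r x / poly q x ^ (k + 2) * exp (- 1 / poly q x)"
      using 1 by (simp add: bump_def q_def)
    ultimately have "((\<lambda>x. poly p x / poly q x ^ k * exp (- 1 / poly q x)) has_field_derivative
        bump r (k + 2) x) (at x)" by simp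
    then show ?thesis
      by (rule has_field_derivative_transform_within_open[of _ _ _ "{1/4<..<3/4}"])
         (use 1 in \<open>auto simp: bump_def q_def\<close>)
  next
    case 2
    have "((\<lambda>_. 0) has_field_derivative bump r (k + 2) x) (at x)"
      using 2 by (auto simp: bump_def)
    then show ?thesis
      by (rule has_field_derivative_transform_within_open[of _ _ _ "{..<1/4} \<union> {3/4<..}"])
         (use 2 in \<open>auto simp: bump_def\<close>)
  next
    case 3
    have "bounded (poly p ` {1/4..3/4})"
      by (intro compact_imp_bounded compact_continuous_image continuous_intros) auto
    then obtain B where B: "\<And>y. y \<in> {1/4..3/4} \<Longrightarrow> \<bar>poly p y\<bar> \<le> B" "B > 0"
      unfolding bounded_pos by (metis imageI real_norm_def)
    \<comment> \<open>By \<open>power_le_fact_exp\<close>, exp(-1/q) is at most (k + 2)! q^(k + 2).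
      After division by q^k two powers of q survive, and q is at most the distance to either end
      point. The difference quotient is thus O(|y - x|).\<close>
    have bnd: "\<bar>bump p k y\<bar> \<le> B * fact (k + 2) * (y - x)\<^sup>2" for y
    proof (cases "1/4 < y \<and> y < 3/4")
      case True
      then have pos: "poly q y > 0" by (simp add: q)
      have "(1 / poly q y) ^ (k + 2) \<le> fact (k + 2) * exp (1 / poly q y)"
        using pos by (intro power_le_fact_exp) simp
      then have "(1 / poly q y) ^ (k + 2) * exp (- 1 / poly q y) \<le> fact (k + 2)"
        using mult_right_mono[of "(1 / poly q y) ^ (k + 2)" "fact (k + 2) * exp (1 / poly q y)" "exp (- 1 / poly q y)"]
        by (simp add: mult.assoc del: fact_Suc power_Suc add_2_eq_Suc' flip: exp_add)
      then have "(1 / poly q y) ^ (k + 2) * exp (- 1 / poly q y) * (poly q y)\<^sup>2 \<le> fact (k + 2) * (poly q y)\<^sup>2"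
        by (rule mult_right_mono) simp
      moreover have "(1 / poly q y) ^ (k + 2) * exp (- 1 / poly q y) * (poly q y)\<^sup>2 = (1 / poly q y) ^ k * exp (- 1 / poly q y)"
        using pos by (simp add: power_add power_divide power2_eq_square)
      ultimately have "(1 / poly q y) ^ k * exp (- 1 / poly q y) \<le> fact (k + 2) * (poly q y)\<^sup>2"
        by simp
      from mult_mono[OF B(1)[of y] this]
      have "\<bar>poly p y\<bar> * ((1 / poly q y) ^ k * exp (- 1 / poly q y)) \<le> B * (fact (k + 2) * (poly q y)\<^sup>2)"
        using pos True B(2) by (simp del: fact_Suc add_2_eq_Suc')
      moreover have "\<bar>bump p k y\<bar> = \<bar>poly p y\<bar> * ((1 / poly q y) ^ k * exp (- 1 / poly q y))"
      proof -
        have "bump p k y = poly p y / poly q y ^ k * exp (- 1 / poly q y)"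
          using True by (simp add: bump_def q_def)
        then show ?thesis using pos by (simp add: abs_mult power_divide)
      qed
      moreover have "\<bar>poly q y\<bar> \<le> \<bar>y - x\<bar>"
      proof -
        have "(y - 1/4) * (3/4 - y) \<le> (y - 1/4) * 1" "(y - 1/4) * (3/4 - y) \<le> 1 * (3/4 - y)"
          using True by (intro mult_mono; simp)+
        then have "poly q y \<le> y - 1/4" "poly q y \<le> 3/4 - y" unfolding q by simp_all
        then show ?thesis using 3 pos True by (elim disjE) simp_all
      qed
      then have "(poly q y)\<^sup>2 \<le> (y - x)\<^sup>2" by (simp add: abs_le_square_iff)
      then have "B * (fact (k + 2) * (poly q y)\<^sup>2) \<le> B * (fact (k + 2) * (y - x)\<^sup>2)"
        using B by (intro mult_left_mono) auto
      ultimately show ?thesis by (simp only: mult.assoc)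
    qed (use B in \<open>auto simp: bump_def\<close>)
    have zero: "bump s l x = 0" for s l using 3 by (auto simp: bump_def)
    have "((\<lambda>y. (bump p k y - bump p k x) / (y - x)) \<longlongrightarrow> 0) (at x)"
    proof (rule Lim_null_comparison)
      show "\<forall>\<^sub>F y in at x. norm ((bump p k y - bump p k x) / (y - x)) \<le> B * fact (k + 2) * \<bar>y - x\<bar>"
      proof (rule always_eventually, rule allI)
        fix y
        show "norm ((bump p k y - bump p k x) / (y - x)) \<le> B * fact (k + 2) * \<bar>y - x\<bar>"
          using bnd[of y] unfolding zero
          by (cases "y = x") (simp_all add: divide_simps power2_eq_square mult.assoc flip: abs_mult)
      qed
      have "((\<lambda>y. B * fact (k + 2) * \<bar>y - x\<bar>) \<longlongrightarrow> B * fact (k + 2) * \<bar>x - x\<bar>) (at x)"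
        by (intro tendsto_intros)
      then show "((\<lambda>y. B * fact (k + 2) * \<bar>y - x\<bar>) \<longlongrightarrow> 0) (at x)" by simp
    qed
    then show ?thesis by (simp add: has_field_derivative_iff zero)
  qed
  then show ?thesis unfolding r_def .
qed

lemma test_function_bump: "test_function (bump p k)"
proof -
  have "\<exists>p' k'. (deriv ^^ n) (bump p k) = bump p' k'" for n
  proof (induction n)
    case (Suc n)
    then obtain p' k' where "(deriv ^^ n) (bump p k) = bump p' k'" by blast
    moreover obtain p'' k'' where "deriv (bump p' k') = bump p'' k''"
      using DERIV_imp_deriv[OF bump_has_derivative[of p' k']] by (metis ext)
    ultimately show ?case by auto
  qed auto
  then have "(deriv ^^ n) (bump p k) field_differentiable at x" for n x
    using bump_has_derivative by (metis field_differentiable_def)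
  moreover have "closure {x. bump p k x \<noteq> 0} \<subseteq> {1/4..3/4}"
    by (rule closure_minimal) (auto simp: bump_def split: if_splits)
  ultimately show ?thesis unfolding test_function_def by (auto simp: subset_iff)
qed

lemma test_function_add:
  assumes "test_function f" "test_function g"
  shows "test_function (\<lambda>x. f x + g x)"
proof -
  have diff: "(deriv ^^ n) f field_differentiable at x" "(deriv ^^ n) g field_differentiable at x" for n x
    using assms by (auto simp: test_function_def)
  have eq: "(deriv ^^ n) (\<lambda>x. f x + g x) = (\<lambda>x. (deriv ^^ n) f x + (deriv ^^ n) g x)" for n
  proof (induction n)
    case (Suc n)
    then show ?case using diff by (auto intro!: ext deriv_add)
  qed simp
  have "{x. f x + g x \<noteq> 0} \<subseteq> {x. f x \<noteq> 0} \<union> {x. g x \<noteq> 0}" by auto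
  then have "closure {x. f x + g x \<noteq> 0} \<subseteq> closure {x. f x \<noteq> 0} \<union> closure {x. g x \<noteq> 0}"
    by (metis closure_Un closure_mono)
  then have "closure {x. f x + g x \<noteq> 0} \<subseteq> {0<..<1}" using assms by (auto simp: test_function_def)
  moreover have "(deriv ^^ n) (\<lambda>x. f x + g x) field_differentiable at x" for n x
    unfolding eq by (intro field_differentiable_add diff)
  ultimately show ?thesis by (auto simp: test_function_def)
qed

lemma test_function_zero: "test_function (\<lambda>_. 0)"
proof -
  have "(deriv ^^ n) (\<lambda>_. 0 :: real) = (\<lambda>_. 0)" for n by (induction n) auto
  then show ?thesis by (simp add: test_function_def)
qed

lemma test_function_sum:
  assumes "finite A" "\<And>a. a \<in> A \<Longrightarrow> test_function (g a)"
  shows "test_function (\<lambda>x. \<Sum>a\<in>A. g a x)"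
  using assms by (induction A rule: finite_induct) (auto intro: test_function_add test_function_zero)

lemma test_function_continuous:
  assumes "test_function g" shows "continuous_on UNIV g"
proof -
  have "g field_differentiable at x" for x
    using assms unfolding test_function_def by (metis funpow_0)
  then show ?thesis
    by (simp add: continuous_on_eq_continuous_at field_differentiable_imp_continuous_at)
qed

lemma test_function_bounded:
  assumes "test_function g" obtains B where "B > 0" "\<And>x. \<bar>g x\<bar> \<le> B"
proof -
  have "bounded (g ` {0..1})"
    using test_function_continuous[OF assms]
    by (intro compact_imp_bounded compact_continuous_image) (auto intro: continuous_on_subset)
  then obtain B where B: "B > 0" "\<And>x. x \<in> {0..1} \<Longrightarrow> \<bar>g x\<bar> \<le> B" by (auto simp: bounded_pos)
  have "\<bar>g x\<bar> \<le> B" for x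
  proof (cases "g x = 0")
    case False
    then have "x \<in> closure {x. g x \<noteq> 0}" using closure_subset[of "{x. g x \<noteq> 0}"] by auto
    then have "x \<in> {0<..<1}" using assms unfolding test_function_def by blast
    then show ?thesis using B by auto
  qed (use B in auto)
  then show ?thesis using B that by blast
qed

section \<open>Hermite polynomials of a Gaussian pair\<close>

text \<open>Written with the second moment instead of a standard deviation, one formula covers both
  alternatives of \<open>centered_gaussian\<close>. The degenerate one does occur: if X and Y have
  correlation 1 or -1, some nontrivial combination of them vanishes.\<close>

lemma centered_gaussian_moment:
  assumes M: "prob_space M" and Z: "centered_gaussian M Z"
  shows "integrable M (\<lambda>\<omega>. Z \<omega> ^ n)" (is ?A)
    and "(LINT \<omega>|M. Z \<omega> ^ n) =
      (if even n then fact n / (2 ^ (n div 2) * fact (n div 2)) * (LINT \<omega>|M. (Z \<omega>)\<^sup>2) ^ (n div 2) else 0)"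
      (is ?B)
proof -
  interpret prob_space M by fact
  have meas [measurable]: "Z \<in> borel_measurable M" using Z by (simp add: centered_gaussian_def)
  have "?A \<and> ?B"
  proof (cases "AE \<omega> in M. Z \<omega> = 0")
    case True
    have ae: "AE \<omega> in M. Z \<omega> ^ k = 0 ^ k" for k using True by eventually_elim simp
    have int: "integrable M (\<lambda>\<omega>. Z \<omega> ^ k)" for k
      by (rule integrable_cong_AE_imp[of _ "\<lambda>_. 0 ^ k"]) (use ae[of k] in \<open>auto simp: eq_commute\<close>)
    have "(LINT \<omega>|M. Z \<omega> ^ k) = 0 ^ k" for k
    proof -
      have "(LINT \<omega>|M. Z \<omega> ^ k) = (LINT \<omega>|M. 0 ^ k)" by (intro integral_cong_AE ae) auto
      then show ?thesis using prob_space by simp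
    qed
    note z = this
    have "(LINT \<omega>|M. (Z \<omega>)\<^sup>2) = 0" using z[of 2] by simp
    \<comment> \<open>For even n > 0 the factor in the formula is a positive power of 0. The case n
      = 0 is separate, where 0 ^ 0 = 1 is the correct moment.\<close>
    moreover have "n div 2 > 0" if "n > 0" "even n" using that by (auto elim!: evenE)
    ultimately show ?thesis using int z[of n] by (cases "n = 0") (auto simp: power_0_left)
  next
    case False
    then obtain \<sigma> where s: "\<sigma> > 0" "distributed M lborel Z (normal_density 0 \<sigma>)"
      using Z by (auto simp: centered_gaussian_def)
    have int: "integrable M (\<lambda>\<omega>. Z \<omega> ^ k)" for k
      using distributed_integrable[OF s(2), of "\<lambda>x. x ^ k"] integrable_normal_moment[OF s(1), of 0 k]
      by simp
    have eq: "(LINT \<omega>|M. Z \<omega> ^ k) = (LINT x|lborel. normal_density 0 \<sigma> x * x ^ k)" for k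
      by (rule distributed_integral[OF s(2), symmetric]) auto
    have ev: "(LINT \<omega>|M. Z \<omega> ^ (2 * k)) = fact (2 * k) / (2 ^ k * fact k) * (\<sigma>\<^sup>2) ^ k" for k
      using integral_normal_moment_even[OF s(1), of 0 k] by (simp add: eq power_divide)
    have od: "(LINT \<omega>|M. Z \<omega> ^ (2 * k + 1)) = 0" for k
      using integral_normal_moment_odd[OF s(1), of 0 k] unfolding eq by simp
    have "(LINT \<omega>|M. (Z \<omega>)\<^sup>2) = \<sigma>\<^sup>2" using ev[of 1] by (simp add: fact_numeral)
    then have ?B using ev od by (auto elim!: evenE oddE)
    then show ?thesis using int by simp
  qed
  then show ?A ?B by auto
qed

section \<open>Hermite polynomials as formal polynomials\<close>

fun hermite_poly :: "nat \<Rightarrow> real poly" where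
  "hermite_poly 0 = 1"
| "hermite_poly (Suc n) = [:0, 1:] * hermite_poly n - pderiv (hermite_poly n)"

text \<open>Differentiating the recurrence and inserting the induction hypothesis leaves (n + 1) (x
  He_n - He_n') beside He_(n+1), and the bracket is He_(n+1) again. The rule lowers the index of the
  second factor in \<open>hermite_orthogonal\<close>.\<close>

lemma pderiv_hermite_poly: "pderiv (hermite_poly (Suc n)) = smult (real (Suc n)) (hermite_poly n)"
proof (induction n)
  case 0
  show ?case by (simp add: pderiv_pCons)
next
  case (Suc n)
  have "pderiv (hermite_poly (Suc (Suc n))) =
      hermite_poly (Suc n) + [:0, 1:] * pderiv (hermite_poly (Suc n)) - pderiv (pderiv (hermite_poly (Suc n)))"
    by (subst hermite_poly.simps(2)) (simp only: pderiv_diff pderiv_mult pderiv_pCons, simp)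
  also have "\<dots> = hermite_poly (Suc n) + smult (real (Suc n)) (hermite_poly (Suc n))"
    unfolding Suc.IH by (simp add: pderiv_smult smult_diff_right)
  finally show ?case by (simp only: of_nat_Suc smult_add_left) simp
qed

lemma deriv_gauss_eq_hermite_poly:
  "(deriv ^^ n) (\<lambda>y. exp (- y\<^sup>2 / 2)) = (\<lambda>x. (-1) ^ n * poly (hermite_poly n) x * exp (- x\<^sup>2 / 2))"
proof (induction n)
  case (Suc n)
  have "((\<lambda>x. (-1) ^ n * poly (hermite_poly n) x * exp (- x\<^sup>2 / 2)) has_field_derivative
      (-1) ^ Suc n * poly (hermite_poly (Suc n)) x * exp (- x\<^sup>2 / 2)) (at x)" for x :: real
    by (auto intro!: derivative_eq_intros poly_DERIV simp: algebra_simps)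
  then show ?case using Suc by (auto intro!: ext DERIV_imp_deriv)
qed simp

lemma hermite_eq_poly: "hermite n x = poly (hermite_poly n) x"
proof -
  have "hermite n x = ((-1) ^ n * (-1) ^ n) * (exp (x\<^sup>2 / 2) * exp (- x\<^sup>2 / 2)) * poly (hermite_poly n) x"
    unfolding hermite_def deriv_gauss_eq_hermite_poly by (simp only: ac_simps)
  also have "\<dots> = poly (hermite_poly n) x" by (simp flip: exp_add power_mult_distrib)
  finally show ?thesis .
qed

lemma poly_monom_induct:
  assumes "\<And>c n. P (monom c n)" "\<And>p q. P p \<Longrightarrow> P q \<Longrightarrow> P (p + q)"
  shows "P p"
proof -
  have "P 0" using assms(1)[of 0 0] by simp
  have "P (\<Sum>i\<in>A. monom (coeff p i) i)" if "finite A" for A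
    using that by (induction A rule: finite_induct) (simp_all add: \<open>P 0\<close> assms)
  then have "P (\<Sum>i\<le>degree p. monom (coeff p i) i)" by simp
  then show ?thesis by (simp add: poly_as_sum_of_monoms)
qed

text \<open>Only the laws of linear combinations are assumed, which is what \<open>isonormal\<close>
  provides. Correlation 1 and -1 are included.\<close>

locale gaussian_pair = prob_space M for M :: "'p measure" +
  fixes X Y :: "'p \<Rightarrow> real" and \<rho> :: real
  assumes gauss: "centered_gaussian M (\<lambda>\<omega>. a * X \<omega> + b * Y \<omega>)"
    and varX: "(LINT \<omega>|M. (X \<omega>)\<^sup>2) = 1" and varY: "(LINT \<omega>|M. (Y \<omega>)\<^sup>2) = 1"
    and cov: "(LINT \<omega>|M. X \<omega> * Y \<omega>) = \<rho>"
begin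

lemma swap: "gaussian_pair M Y X \<rho>"
proof
  show "centered_gaussian M (\<lambda>\<omega>. a * Y \<omega> + b * X \<omega>)" for a b
    using gauss[of b a] by (simp only: add.commute)
qed (use varX varY cov in \<open>simp_all only: mult.commute\<close>)

lemma gaussX: "centered_gaussian M X" and gaussY: "centered_gaussian M Y"
  using gauss[of 1 0] gauss[of 0 1] by simp_all

lemma measX [measurable]: "X \<in> borel_measurable M" and measY [measurable]: "Y \<in> borel_measurable M"
  using gaussX gaussY by (simp_all add: centered_gaussian_def)

lemma integrable_monomial: "integrable M (\<lambda>\<omega>. X \<omega> ^ i * Y \<omega> ^ j)"
proof (rule Bochner_Integration.integrable_bound)
  show "integrable M (\<lambda>\<omega>. X \<omega> ^ (2 * i) + Y \<omega> ^ (2 * j))"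
    using centered_gaussian_moment(1)[OF prob_space_axioms] gaussX gaussY by simp
  show "AE \<omega> in M. norm (X \<omega> ^ i * Y \<omega> ^ j) \<le> norm (X \<omega> ^ (2 * i) + Y \<omega> ^ (2 * j))"
  proof (rule AE_I2)
    fix \<omega>
    have "\<bar>x * y\<bar> \<le> x\<^sup>2 + y\<^sup>2" for x y :: real
    proof -
      have "2 * \<bar>x\<bar> * \<bar>y\<bar> \<le> \<bar>x\<bar>\<^sup>2 + \<bar>y\<bar>\<^sup>2" by (rule sum_squares_bound)
      moreover have "0 \<le> \<bar>x\<bar> * \<bar>y\<bar>" by simp
      ultimately show ?thesis unfolding abs_mult power2_abs by linarith
    qed
    from this[of "X \<omega> ^ i" "Y \<omega> ^ j"]
    show "norm (X \<omega> ^ i * Y \<omega> ^ j) \<le> norm (X \<omega> ^ (2 * i) + Y \<omega> ^ (2 * j))"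
      by (simp add: power_even_eq)
  qed
qed simp

definition mom :: "nat \<Rightarrow> nat \<Rightarrow> real" where
  "mom i j = (LINT \<omega>|M. X \<omega> ^ i * Y \<omega> ^ j)"

text \<open>This is E (X + b Y)^n as a polynomial in b. The left side is a univariate Gaussian
  moment for every b, and the coefficients carry all mixed moments of total degree n.\<close>

definition mom_poly :: "nat \<Rightarrow> real poly" where
  "mom_poly n = (\<Sum>j\<le>n. monom (real (n choose j) * mom (n - j) j) j)"

lemma coeff_mom_poly: "coeff (mom_poly n) j = real (n choose j) * mom (n - j) j"
  by (auto simp: mom_poly_def coeff_sum if_distrib sum.delta cong: if_cong)

lemma poly_mom_poly: "poly (mom_poly n) b = (LINT \<omega>|M. (b * Y \<omega> + X \<omega>) ^ n)"
proof -
  have "(LINT \<omega>|M. (b * Y \<omega> + X \<omega>) ^ n) =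
      (LINT \<omega>|M. (\<Sum>j\<le>n. (real (n choose j) * b ^ j) * (X \<omega> ^ (n - j) * Y \<omega> ^ j)))"
    by (subst binomial_ring) (simp add: power_mult_distrib ac_simps)
  also have "\<dots> = (\<Sum>j\<le>n. (real (n choose j) * b ^ j) * mom (n - j) j)"
    unfolding mom_def by (subst Bochner_Integration.integral_sum) (auto intro: integrable_monomial)
  finally show ?thesis by (simp add: mom_poly_def poly_sum poly_monom algebra_simps)
qed

lemma variance_pencil: "(LINT \<omega>|M. (b * Y \<omega> + X \<omega>)\<^sup>2) = 1 + 2 * \<rho> * b + b\<^sup>2"
proof -
  have "(LINT \<omega>|M. (b * Y \<omega> + X \<omega>)\<^sup>2) = poly (mom_poly 2) b" by (simp add: poly_mom_poly)
  also have "\<dots> = 1 + 2 * \<rho> * b + b\<^sup>2"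
    using varX varY cov by (simp add: mom_poly_def numeral_2_eq_2 poly_monom mom_def)
  finally show ?thesis .
qed

lemma poly_mom_poly_eq:
  "poly (mom_poly n) b =
    (if even n then fact n / (2 ^ (n div 2) * fact (n div 2)) * (1 + 2 * \<rho> * b + b\<^sup>2) ^ (n div 2) else 0)"
  unfolding poly_mom_poly
  using centered_gaussian_moment(2)[OF prob_space_axioms gauss[of 1 b], of n] variance_pencil[of b]
  by (simp add: add.commute)

text \<open>Euler's relation for the homogeneous polynomial \<open>E (a * X + b * Y) ^ n\<close>, read at \<open>a = 1\<close>.\<close>

lemma mom_poly_euler:
  "smult (real (Suc (Suc n))) (mom_poly (Suc (Suc n))) - pCons 0 (pderiv (mom_poly (Suc (Suc n)))) =
   smult (real (Suc (Suc n)) * real (Suc n)) ([:1, \<rho>:] * mom_poly n)"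
proof (cases "even n")
  case False
  have "mom_poly n = 0" "mom_poly (Suc (Suc n)) = 0"
    using False poly_mom_poly_eq by (auto simp: poly_eq_poly_eq_iff[symmetric] fun_eq_iff)
  then show ?thesis by simp
next
  case True
  then obtain N where N: "n = 2 * N" by (elim evenE)
  \<comment> \<open>\<mu> N is the double factorial (2 N - 1)!!, the moment of order 2 N of a
    standard Gaussian variable.\<close>
  define \<mu> :: "nat \<Rightarrow> real" where "\<mu> N = fact (2 * N) / (2 ^ N * fact N)" for N
  have \<mu>_Suc: "\<mu> (Suc N) = (2 * real N + 1) * \<mu> N"
  proof -
    have "fact (2 * Suc N) = (2 * (real N + 1)) * ((2 * real N + 1) * fact (2 * N) :: real)"
      by (simp add: algebra_simps)
    moreover have "2 ^ Suc N * fact (Suc N) = (2 * (real N + 1)) * (2 ^ N * fact N)" by simp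
    ultimately show ?thesis unfolding \<mu>_def by (simp del: fact_Suc power_Suc add: mult_divide_mult_cancel_left)
  qed
  have eq: "mom_poly (2 * K) = smult (\<mu> K) ([:1, 2 * \<rho>, 1:] ^ K)" for K
    by (simp add: poly_eq_poly_eq_iff[symmetric] fun_eq_iff poly_mom_poly_eq \<mu>_def poly_power
        power2_eq_square algebra_simps)
  show ?thesis
    unfolding poly_eq_poly_eq_iff[symmetric]
  proof
    fix b
    define q where "q = 1 + 2 * \<rho> * b + b * b"
    have e1: "poly (mom_poly (Suc (Suc n))) b = \<mu> (Suc N) * q ^ Suc N"
      using eq[of "Suc N"] by (simp add: N q_def poly_power algebra_simps)
    have e2: "poly (pderiv (mom_poly (Suc (Suc n)))) b = \<mu> (Suc N) * (real (Suc N) * q ^ N * (2 * \<rho> + 2 * b))"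
      using eq[of "Suc N"]
      by (simp add: N q_def poly_power pderiv_smult pderiv_power_Suc pderiv_pCons algebra_simps del: power_Suc)
    have e3: "poly (mom_poly n) b = \<mu> N * q ^ N"
      using eq[of N] by (simp add: N q_def poly_power algebra_simps)
    have "real (Suc (Suc n)) * (\<mu> (Suc N) * q ^ Suc N) - b * (\<mu> (Suc N) * (real (Suc N) * q ^ N * (2 * \<rho> + 2 * b)))
      = \<mu> (Suc N) * q ^ N * (real (Suc (Suc n)) * q - b * real (Suc N) * (2 * \<rho> + 2 * b))"
      by (simp add: algebra_simps)
    also have "real (Suc (Suc n)) * q - b * real (Suc N) * (2 * \<rho> + 2 * b) = real (Suc (Suc n)) * (1 + \<rho> * b)"
      by (simp add: N q_def algebra_simps)
    also have "\<mu> (Suc N) * q ^ N * (real (Suc (Suc n)) * (1 + \<rho> * b)) =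
        real (Suc (Suc n)) * real (Suc n) * ((1 + \<rho> * b) * (\<mu> N * q ^ N))"
      by (simp add: \<mu>_Suc N algebra_simps)
    finally show "poly (smult (real (Suc (Suc n))) (mom_poly (Suc (Suc n))) - pCons 0 (pderiv (mom_poly (Suc (Suc n))))) b =
        poly (smult (real (Suc (Suc n)) * real (Suc n)) ([:1, \<rho>:] * mom_poly n)) b"
      by (simp only: poly_diff poly_smult poly_pCons poly_mult e1 e2 e3) (simp add: algebra_simps)
  qed
qed

text \<open>Stein's identity E[X f] = E[f_x] + \<rho> E[f_y] for f = x^i y^j: it is the coefficient
  of b^j in \<open>mom_poly_euler\<close> with n = i + j - 1. The truncated subtractions are
  harmless, since \<open>mom (i - 1) j\<close> carries the factor i and \<open>mom i (j - 1)\<close>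
  the factor j.\<close>

lemma stein_monomial: "mom (Suc i) j = real i * mom (i - 1) j + \<rho> * real j * mom i (j - 1)"
proof (cases "i + j = 0")
  case True
  have "mom 1 0 = coeff (mom_poly 1) 0" by (simp add: coeff_mom_poly)
  also have "mom_poly 1 = 0" using poly_mom_poly_eq[of 1] by (auto simp: poly_eq_poly_eq_iff[symmetric] fun_eq_iff)
  finally show ?thesis using True by simp
next
  case False
  then obtain n where n: "i + j = Suc n" by (cases "i + j") auto
  have idx: "Suc (Suc n) - j = Suc i" "n - j = i - 1" "Suc n - j = i" using n by auto
  have co: "coeff (smult r p - pCons 0 (pderiv p)) j = (r - real j) * coeff p j" for r and p :: "real poly"
    by (cases j) (auto simp: coeff_pderiv algebra_simps)
  have "(real (Suc (Suc n)) - real j) * (real (Suc (Suc n) choose j) * mom (Suc i) j) =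
      real (Suc (Suc n)) * real (Suc n) * (real (n choose j) * mom (i - 1) j +
        (if j = 0 then 0 else \<rho> * (real (n choose (j - 1)) * mom i (j - 1))))"
    using arg_cong[OF mom_poly_euler[of n], of "\<lambda>p. coeff p j"] unfolding co coeff_smult coeff_mom_poly idx
    apply (cases j)
     apply (auto simp: coeff_mom_poly coeff_pCons idx)
    using idx n by auto
  \<comment> \<open>This and the next two absorption identities bring all three terms to the common
    factor (n + 2) times (n + 1 choose j). It is positive because j <= n + 1, and cancels at the
    end.\<close>
  moreover have "(real (Suc (Suc n)) - real j) * real (Suc (Suc n) choose j) = real (Suc (Suc n)) * real (Suc n choose j)"
  proof -
    have "(Suc (Suc n) - j) * (Suc (Suc n) choose j) = Suc (Suc n) * (Suc n choose j)"
      using binomial_absorb_comp[of "Suc (Suc n)" j] by simp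
    from arg_cong[OF this, of real] show ?thesis using n by (simp only: of_nat_mult) (simp add: of_nat_diff)
  qed
  moreover have "real i * real (Suc n choose j) = real (Suc n) * real (n choose j)"
  proof -
    have "(Suc n - j) * (Suc n choose j) = Suc n * (n choose j)"
      using binomial_absorb_comp[of "Suc n" j] by simp
    from arg_cong[OF this, of real] show ?thesis unfolding idx by (simp only: of_nat_mult)
  qed
  moreover have "real j * real (Suc n choose j) = real (Suc n) * (if j = 0 then 0 else real (n choose (j - 1)))"
  proof (cases j)
    case (Suc l)
    from arg_cong[OF Suc_times_binomial_eq[of n l], of real] show ?thesis
      by (simp only: Suc of_nat_mult) (simp add: algebra_simps)
  qed simp
  ultimately have *: "real (Suc (Suc n)) * real (Suc n choose j) * mom (Suc i) j =
      real (Suc (Suc n)) * real (Suc n choose j) * (real i * mom (i - 1) j + \<rho> * real j * mom i (j - 1))"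
    (is "?a = ?b")
  proof -
    assume A: "(real (Suc (Suc n)) - real j) * (real (Suc (Suc n) choose j) * mom (Suc i) j) =
      real (Suc (Suc n)) * real (Suc n) * (real (n choose j) * mom (i - 1) j +
        (if j = 0 then 0 else \<rho> * (real (n choose (j - 1)) * mom i (j - 1))))"
    and B: "(real (Suc (Suc n)) - real j) * real (Suc (Suc n) choose j) = real (Suc (Suc n)) * real (Suc n choose j)"
    and C: "real i * real (Suc n choose j) = real (Suc n) * real (n choose j)"
    and D: "real j * real (Suc n choose j) = real (Suc n) * (if j = 0 then 0 else real (n choose (j - 1)))"
    have "?a = ((real (Suc (Suc n)) - real j) * real (Suc (Suc n) choose j)) * mom (Suc i) j" unfolding B ..
    also have "\<dots> = real (Suc (Suc n)) * ((real (Suc n) * real (n choose j)) * mom (i - 1) j +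
        (real (Suc n) * (if j = 0 then 0 else real (n choose (j - 1)))) * (\<rho> * mom i (j - 1)))"
      using A by (simp only: mult.assoc) (simp add: algebra_simps)
    also have "\<dots> = ?b" unfolding C[symmetric] D[symmetric] by (simp only: algebra_simps)
    finally show ?thesis .
  qed
  have "Suc n choose j > 0" using n by simp
  then show ?thesis using * by simp
qed

lemma integrable_poly_pair: "integrable M (\<lambda>\<omega>. poly p (X \<omega>) * poly q (Y \<omega>))"
proof -
  have "integrable M (\<lambda>\<omega>. \<Sum>i\<le>degree p. \<Sum>j\<le>degree q. (coeff p i * coeff q j) * (X \<omega> ^ i * Y \<omega> ^ j))"
    by (intro Bochner_Integration.integrable_sum integrable_mult_right integrable_monomial)
  then show ?thesis by (simp add: poly_altdef sum_product algebra_simps)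
qed

text \<open>Both sides are bilinear in p and q, so monomials suffice.\<close>

lemma stein_poly:
  "(LINT \<omega>|M. X \<omega> * poly p (X \<omega>) * poly q (Y \<omega>)) =
   (LINT \<omega>|M. poly (pderiv p) (X \<omega>) * poly q (Y \<omega>)) + \<rho> * (LINT \<omega>|M. poly p (X \<omega>) * poly (pderiv q) (Y \<omega>))"
proof -
  define \<Lambda> where "\<Lambda> p q = (LINT \<omega>|M. poly p (X \<omega>) * poly q (Y \<omega>))" for p q
  have add: "\<Lambda> (p + p') q = \<Lambda> p q + \<Lambda> p' q" "\<Lambda> q (p + p') = \<Lambda> q p + \<Lambda> q p'" for p p' q
    unfolding \<Lambda>_def poly_add distrib_left distrib_right
    by (intro Bochner_Integration.integral_add integrable_poly_pair)+
  have mon: "\<Lambda> (monom c i) (monom d j) = c * d * mom i j" for c d i j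
    unfolding \<Lambda>_def mom_def by (simp add: poly_monom algebra_simps flip: integral_mult_right_zero)
  have "\<Lambda> ([:0, 1:] * p) q = \<Lambda> (pderiv p) q + \<rho> * \<Lambda> p (pderiv q)"
  proof (induction p rule: poly_monom_induct)
    case (1 c i)
    show ?case
    proof (induction q rule: poly_monom_induct)
      case (1 d j)
      have "[:0, 1:] * monom c i = monom c (Suc i)" by (simp add: monom_Suc)
      then show ?case by (simp add: pderiv_monom mon stein_monomial algebra_simps)
    next
      case (2 q q')
      then show ?case by (simp add: add pderiv_add algebra_simps)
    qed
  next
    case (2 p p')
    then show ?case by (simp only: add pderiv_add distrib_left)
  qed
  then show ?thesis by (simp add: \<Lambda>_def algebra_simps)
qed

lemma hermite_mean: "(LINT \<omega>|M. hermite n (Y \<omega>)) = (if n = 0 then 1 else 0)"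
proof (cases n)
  case (Suc l)
  interpret s: gaussian_pair M Y X \<rho> by (rule swap)
  have "integrable M (\<lambda>\<omega>. Y \<omega> * poly (hermite_poly l) (Y \<omega>))"
    using s.integrable_poly_pair[of "[:0,1:] * hermite_poly l" 1] by simp
  moreover have "integrable M (\<lambda>\<omega>. poly (pderiv (hermite_poly l)) (Y \<omega>))"
    using s.integrable_poly_pair[of "pderiv (hermite_poly l)" 1] by simp
  ultimately show ?thesis
    using s.stein_poly[of "hermite_poly l" 1] by (simp add: Suc hermite_eq_poly)
qed (simp add: hermite_eq_poly prob_space)

lemma hermite_pair_integrable: "integrable M (\<lambda>\<omega>. hermite i (X \<omega>) * hermite j (Y \<omega>))"
  using integrable_poly_pair[of "hermite_poly i" "hermite_poly j"] by (simp add: hermite_eq_poly)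

text \<open>In the recurrence for index i + 1, Stein's identity cancels the term with the derivative
  of He_i and leaves \<rho> E[He_i(X) He_j'(Y)]. As He_j' is j times He_(j-1), both indices drop by
  one.\<close>

lemma hermite_orthogonal:
  "(LINT \<omega>|M. hermite i (X \<omega>) * hermite j (Y \<omega>)) = (if i = j then fact i * \<rho> ^ i else 0)"
proof (induction i arbitrary: j)
  case 0
  then show ?case using hermite_mean[of j] by (cases "j = 0") (auto simp: hermite_eq_poly[of 0])
next
  case (Suc i)
  have "(LINT \<omega>|M. hermite (Suc i) (X \<omega>) * hermite j (Y \<omega>)) =
    (LINT \<omega>|M. X \<omega> * poly (hermite_poly i) (X \<omega>) * poly (hermite_poly j) (Y \<omega>)
      - poly (pderiv (hermite_poly i)) (X \<omega>) * poly (hermite_poly j) (Y \<omega>))"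
    by (simp add: hermite_eq_poly algebra_simps)
  also have "\<dots> = (LINT \<omega>|M. X \<omega> * poly (hermite_poly i) (X \<omega>) * poly (hermite_poly j) (Y \<omega>))
      - (LINT \<omega>|M. poly (pderiv (hermite_poly i)) (X \<omega>) * poly (hermite_poly j) (Y \<omega>))"
    using integrable_poly_pair[of "[:0,1:] * hermite_poly i" "hermite_poly j"]
    by (intro Bochner_Integration.integral_diff integrable_poly_pair) simp
  also have "\<dots> = \<rho> * (LINT \<omega>|M. poly (hermite_poly i) (X \<omega>) * poly (pderiv (hermite_poly j)) (Y \<omega>))"
    by (simp add: stein_poly)
  finally have *: "(LINT \<omega>|M. hermite (Suc i) (X \<omega>) * hermite j (Y \<omega>)) = \<dots>" .
  show ?case
  proof (cases j)
    case 0
    then show ?thesis using * by simp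
  next
    case j: (Suc l)
    have "\<rho> * (LINT \<omega>|M. poly (hermite_poly i) (X \<omega>) * poly (pderiv (hermite_poly j)) (Y \<omega>)) =
        \<rho> * (real (Suc l) * (LINT \<omega>|M. hermite i (X \<omega>) * hermite l (Y \<omega>)))"
      unfolding j pderiv_hermite_poly
      by (simp add: hermite_eq_poly algebra_simps flip: integral_mult_right_zero del: hermite_poly.simps)
    from trans[OF * this] show ?thesis unfolding Suc.IH by (auto simp: j algebra_simps)
  qed
qed

end

section \<open>The fractional kernel\<close>

lemma space_unit_leb: "space unit_leb = {0..1}"
  by (simp add: unit_leb_def space_restrict_space)

lemma prob_space_unit_leb: "prob_space unit_leb"
  by (rule prob_spaceI) (simp add: unit_leb_def space_restrict_space emeasure_restrict_space)

interpretation unit_leb: prob_space unit_leb by (rule prob_space_unit_leb)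

interpretation unit_prod: product_sigma_finite "\<lambda>_. unit_leb"
  by (simp add: product_sigma_finite_def unit_leb.sigma_finite_measure_axioms)

interpretation lborel_prod: product_sigma_finite "\<lambda>_. lborel :: real measure"
  by (simp add: product_sigma_finite_def sigma_finite_lborel)

interpretation cube: prob_space "cube n"
  unfolding cube_def by (intro prob_space_PiM prob_space_unit_leb)

lemma measurable_unit_leb: "(\<lambda>x. x) \<in> unit_leb \<rightarrow>\<^sub>M borel"
  unfolding unit_leb_def by (intro measurable_restrict_space1) simp

lemma measurable_borel_unit_leb: "f \<in> borel \<rightarrow>\<^sub>M N \<Longrightarrow> f \<in> unit_leb \<rightarrow>\<^sub>M N"
  unfolding unit_leb_def by (intro measurable_restrict_space1) simp

lemma measurable_cube_component:
  "f \<in> M \<rightarrow>\<^sub>M cube n \<Longrightarrow> i < n \<Longrightarrow> (\<lambda>x. f x i) \<in> M \<rightarrow>\<^sub>M unit_leb"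
  unfolding cube_def by (rule measurable_compose[OF _ measurable_component_singleton]) auto

lemma borel_measurable_cube_component:
  "f \<in> M \<rightarrow>\<^sub>M cube n \<Longrightarrow> i < n \<Longrightarrow> (\<lambda>x. f x i) \<in> borel_measurable M"
  by (rule measurable_compose[OF measurable_cube_component measurable_unit_leb])

lemma borel_measurable_coord [measurable (raw)]: "i < n \<Longrightarrow> (\<lambda>t. t i) \<in> borel_measurable (cube n)"
  by (rule borel_measurable_cube_component) auto

lemma nn_integral_unit_leb:
  "(\<integral>\<^sup>+x. f x \<partial>unit_leb) = (\<integral>\<^sup>+x. f x * indicator {0..1} x \<partial>lborel)"
  unfolding unit_leb_def by (rule nn_integral_restrict_space) simp

lemma AE_unit_leb_neq: "AE x in unit_leb. x \<noteq> c"
proof -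
  have "AE x in lborel. x \<noteq> c" by (rule AE_lborel_singleton)
  then show ?thesis unfolding unit_leb_def by (subst AE_restrict_space_iff) auto
qed

lemma AE_cube_neq: "AE t in cube n. \<forall>i<n. t i \<noteq> c i"
proof -
  have "AE t in cube n. t i \<noteq> c i" if "i < n" for i
    unfolding cube_def using that by (intro AE_PiM_component prob_space_unit_leb AE_unit_leb_neq) auto
  then have "AE t in cube n. \<forall>i\<in>{..<n}. t i \<noteq> c i" by (intro AE_finite_allI) auto
  then show ?thesis by eventually_elim auto
qed

lemma nn_integral_powr_0:
  fixes b c :: real assumes "b > -1" "c \<ge> 0"
  shows "(\<integral>\<^sup>+x. ennreal (if 0 < x \<and> x \<le> c then x powr b else 0) \<partial>lborel) = ennreal (c powr (b + 1) / (b + 1))"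
proof (rule nn_integral_has_integral_lborel)
  have "((\<lambda>x. if x \<in> {0..c} then x powr b else 0) has_integral (c powr (b + 1) / (b + 1))) UNIV"
    using has_integral_powr_from_0[OF assms] by (subst has_integral_restrict_UNIV)
  \<comment> \<open>The point 0 may be kept or dropped because \<open>0 powr b = 0\<close>.\<close>
  moreover have "(\<lambda>x. if x \<in> {0..c} then x powr b else 0) = (\<lambda>x. if 0 < x \<and> x \<le> c then x powr b else 0)"
    by (auto simp: fun_eq_iff)
  ultimately show "((\<lambda>x. if 0 < x \<and> x \<le> c then x powr b else 0) has_integral (c powr (b + 1) / (b + 1))) UNIV"
    by simp
qed auto

lemma nn_integral_powr_inf:
  fixes b c :: real assumes "b < -1" "c > 0"
  shows "(\<integral>\<^sup>+x. ennreal (if c \<le> x then x powr b else 0) \<partial>lborel) = ennreal (- (c powr (b + 1)) / (b + 1))"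
proof (rule nn_integral_has_integral_lborel)
  show "((\<lambda>x. if c \<le> x then x powr b else 0) has_integral - (c powr (b + 1)) / (b + 1)) UNIV"
    using has_integral_powr_to_inf[OF assms] has_integral_restrict_UNIV[of "{c..}" "\<lambda>x. x powr b"]
    by (simp add: atLeast_def)
qed auto

lemma nn_integral_powr_shift_le:
  fixes b s :: real assumes "b > -1" "0 \<le> s"
  shows "(\<integral>\<^sup>+t. ennreal (if s < t then (t - s) powr b else 0) \<partial>unit_leb) \<le> ennreal (1 / (b + 1))"
proof -
  have "(\<integral>\<^sup>+t. ennreal (if s < t then (t - s) powr b else 0) \<partial>unit_leb)
      = (\<integral>\<^sup>+t. ennreal (if s < t then (t - s) powr b else 0) * indicator {0..1} t \<partial>lborel)"
    by (rule nn_integral_unit_leb)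
  also have "\<dots> \<le> (\<integral>\<^sup>+t. ennreal (if 0 < t - s \<and> t - s \<le> 1 then (t - s) powr b else 0) \<partial>lborel)"
    using assms by (intro nn_integral_mono) (auto simp: indicator_def)
  also have "\<dots> = ennreal \<bar>1\<bar> * (\<integral>\<^sup>+t. ennreal (if 0 < (s + 1 * t) - s \<and> (s + 1 * t) - s \<le> 1 then ((s + 1 * t) - s) powr b else 0) \<partial>lborel)"
    by (rule nn_integral_real_affine) auto
  also have "\<dots> = ennreal (1 / (b + 1))"
    using nn_integral_powr_0[OF assms(1), of 1] by (simp cong: if_cong)
  finally show ?thesis .
qed

lemma nn_integral_powr_reflect_le:
  fixes b s :: real assumes "b > -1" "s \<le> 1"
  shows "(\<integral>\<^sup>+t. ennreal (if t < s then (s - t) powr b else 0) \<partial>unit_leb) \<le> ennreal (1 / (b + 1))"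
proof -
  have "(\<integral>\<^sup>+t. ennreal (if t < s then (s - t) powr b else 0) \<partial>unit_leb)
      = (\<integral>\<^sup>+t. ennreal (if t < s then (s - t) powr b else 0) * indicator {0..1} t \<partial>lborel)"
    by (rule nn_integral_unit_leb)
  also have "\<dots> \<le> (\<integral>\<^sup>+t. ennreal (if 0 < s - t \<and> s - t \<le> 1 then (s - t) powr b else 0) \<partial>lborel)"
    using assms by (intro nn_integral_mono) (auto simp: indicator_def)
  also have "\<dots> = ennreal \<bar>-1\<bar> * (\<integral>\<^sup>+t. ennreal (if 0 < s - (s + (-1) * t) \<and> s - (s + (-1) * t) \<le> 1 then (s - (s + (-1) * t)) powr b else 0) \<partial>lborel)"
    by (rule nn_integral_real_affine) auto
  also have "\<dots> = ennreal (1 / (b + 1))"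
    using nn_integral_powr_0[OF assms(1), of 1] by (simp cong: if_cong)
  finally show ?thesis .
qed

lemma prod_mono_ennreal:
  fixes f g :: "'i \<Rightarrow> ennreal"
  shows "(\<And>i. i \<in> A \<Longrightarrow> f i \<le> g i) \<Longrightarrow> prod f A \<le> prod g A"
  by (induction A rule: infinite_finite_induct) (auto intro!: mult_mono)

section \<open>The kernel and its factorization through half-kernels\<close>

locale hurst =
  fixes H :: real
  assumes H: "1 / 2 < H" "H < 1"
begin

text \<open>On the diagonal the value is 0 instead of infinity, because \<open>0 powr x = 0\<close>.
  Lower bounds and the convolution identity therefore ask for distinct arguments and are applied
  almost everywhere.\<close>

definition \<kappa> :: "real \<Rightarrow> real \<Rightarrow> real" where "\<kappa> s t = \<bar>s - t\<bar> powr (2 * H - 2)"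

lemma \<kappa>_nonneg [simp]: "0 \<le> \<kappa> s t" by (simp add: \<kappa>_def)

lemma \<kappa>_commute: "\<kappa> s t = \<kappa> t s" by (simp add: \<kappa>_def abs_minus_commute)

lemma measurable_\<kappa> [measurable (raw)]:
  "f \<in> borel_measurable M \<Longrightarrow> g \<in> borel_measurable M \<Longrightarrow> (\<lambda>x. \<kappa> (f x) (g x)) \<in> borel_measurable M"
  unfolding \<kappa>_def by measurable

lemma \<kappa>_ge_1: "s \<in> {0..1} \<Longrightarrow> t \<in> {0..1} \<Longrightarrow> s \<noteq> t \<Longrightarrow> 1 \<le> \<kappa> s t"
  unfolding \<kappa>_def using H powr_mono2'[of "2 * H - 2" "\<bar>s - t\<bar>" 1] by auto

lemma nn_integral_\<kappa>_le:
  assumes "s \<in> {0..1}"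
  shows "(\<integral>\<^sup>+t. ennreal (\<kappa> s t) \<partial>unit_leb) \<le> ennreal (2 / (2 * H - 1))"
proof -
  have "(\<integral>\<^sup>+t. ennreal (\<kappa> s t) \<partial>unit_leb) \<le> (\<integral>\<^sup>+t. ennreal (if s < t then (t - s) powr (2 * H - 2) else 0) +
      ennreal (if t < s then (s - t) powr (2 * H - 2) else 0) \<partial>unit_leb)"
    by (intro nn_integral_mono) (auto simp: \<kappa>_def abs_if)
  also have "\<dots> = (\<integral>\<^sup>+t. ennreal (if s < t then (t - s) powr (2 * H - 2) else 0) \<partial>unit_leb) +
      (\<integral>\<^sup>+t. ennreal (if t < s then (s - t) powr (2 * H - 2) else 0) \<partial>unit_leb)"
    by (rule nn_integral_add; rule measurable_borel_unit_leb) measurable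
  also have "\<dots> \<le> ennreal (1 / (2 * H - 2 + 1)) + ennreal (1 / (2 * H - 2 + 1))"
    using H assms by (intro add_mono nn_integral_powr_shift_le nn_integral_powr_reflect_le) auto
  also have "\<dots> = ennreal (2 / (2 * H - 1))"
    using H by (simp flip: ennreal_plus)
  finally show ?thesis .
qed

text \<open>The Beta integral B(H - 1/2, 2 - 2 H). It enters only as a factor to be cancelled, so
  what matters is that it is positive and finite.\<close>

definition half_kernel_mass :: ennreal where
  "half_kernel_mass = (\<integral>\<^sup>+v. ennreal (if 0 < v then v powr (H - 3/2) * (1 + v) powr (H - 3/2) else 0) \<partial>lborel)"

text \<open>Near 0 the integrand behaves like the power H - 3/2, which exceeds -1 because H > 1/2;
  at infinity like the power 2 H - 3, which is below -1 because H < 1.\<close>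

lemma half_kernel_mass_finite: "half_kernel_mass < \<infinity>"
proof -
  let ?a = "H - 3/2"
  have "half_kernel_mass \<le> (\<integral>\<^sup>+v. ennreal (if 0 < v \<and> v \<le> 1 then v powr ?a else 0) + ennreal (if 1 \<le> v then v powr (2 * ?a) else 0) \<partial>lborel)"
    unfolding half_kernel_mass_def
  proof (intro nn_integral_mono)
    fix v :: real
    have "v powr ?a * (1 + v) powr ?a \<le> v powr ?a * 1" if "0 < v"
      using H that powr_mono2'[of ?a 1 "1 + v"] by (intro mult_left_mono) auto
    moreover have "v powr ?a * (1 + v) powr ?a \<le> v powr ?a * v powr ?a" if "0 < v"
      using H that powr_mono2'[of ?a v "1 + v"] by (intro mult_left_mono) auto
    ultimately show "ennreal (if 0 < v then v powr ?a * (1 + v) powr ?a else 0) \<le>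
       ennreal (if 0 < v \<and> v \<le> 1 then v powr ?a else 0) + ennreal (if 1 \<le> v then v powr (2 * ?a) else 0)"
      by (auto simp: ennreal_leI algebra_simps simp flip: ennreal_plus powr_add intro: add_increasing2)
  qed
  also have "\<dots> = (\<integral>\<^sup>+v. ennreal (if 0 < v \<and> v \<le> 1 then v powr ?a else 0) \<partial>lborel) + (\<integral>\<^sup>+v. ennreal (if 1 \<le> v then v powr (2 * ?a) else 0) \<partial>lborel)"
    by (rule nn_integral_add) measurable
  also have "\<dots> < \<infinity>"
    using nn_integral_powr_0[of ?a 1] nn_integral_powr_inf[of "2 * ?a" 1] H by simp
  finally show ?thesis .
qed

lemma half_kernel_mass_pos: "half_kernel_mass > 0"
proof -
  let ?a = "H - 3/2"
  have "0 < ennreal (2 powr ?a)" by simp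
  also have "\<dots> = (\<integral>\<^sup>+(v::real). ennreal (2 powr ?a) * indicator {0<..1} v \<partial>lborel)"
    by (subst nn_integral_cmult_indicator) auto
  also have "\<dots> \<le> half_kernel_mass"
    unfolding half_kernel_mass_def
  proof (intro nn_integral_mono)
    fix v :: real
    have "1 * 2 powr ?a \<le> v powr ?a * (1 + v) powr ?a" if "0 < v" "v \<le> 1"
      using H that powr_mono2'[of ?a v 1] powr_mono2'[of ?a "1 + v" 2] by (intro mult_mono) auto
    then show "ennreal (2 powr ?a) * indicator {0<..1} v \<le> ennreal (if 0 < v then v powr ?a * (1 + v) powr ?a else 0)"
      by (auto simp: indicator_def ennreal_leI)
  qed
  finally show ?thesis .
qed

definition half_kernel :: "real \<Rightarrow> real \<Rightarrow> real" where
  "half_kernel s u = (if u < s then (s - u) powr (H - 3/2) else 0)"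

lemma half_kernel_nonneg [simp]: "0 \<le> half_kernel s u" by (simp add: half_kernel_def)

lemma measurable_half_kernel [measurable (raw)]:
  assumes [measurable]: "f \<in> borel_measurable M" "g \<in> borel_measurable M"
  shows "(\<lambda>x. half_kernel (f x) (g x)) \<in> borel_measurable M"
  unfolding half_kernel_def by measurable

text \<open>For s < t the substitution u = s - (t - s) v gives s - u = (t - s) v and t - u = (t - s)
  (1 + v). What remains is \<open>half_kernel_mass\<close> times t - s to the power 1 + 2 (H - 3/2)
  = 2 H - 2.\<close>

lemma \<kappa>_eq_convolution:
  assumes "s \<noteq> t"
  shows "(\<integral>\<^sup>+u. ennreal (half_kernel s u) * ennreal (half_kernel t u) \<partial>lborel) = half_kernel_mass * ennreal (\<kappa> s t)"
proof -
  have *: "(\<integral>\<^sup>+u. ennreal (half_kernel s u) * ennreal (half_kernel t u) \<partial>lborel) = half_kernel_mass * ennreal (\<kappa> s t)" if st: "s < t" for s t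
  proof -
    let ?a = "H - 3/2" and ?d = "t - s"
    have "(\<integral>\<^sup>+u. ennreal (half_kernel s u) * ennreal (half_kernel t u) \<partial>lborel) =
        ennreal \<bar>- ?d\<bar> * (\<integral>\<^sup>+v. ennreal (half_kernel s (s + (- ?d) * v)) * ennreal (half_kernel t (s + (- ?d) * v)) \<partial>lborel)"
      using st by (intro nn_integral_real_affine) auto
    also have "(\<integral>\<^sup>+v. ennreal (half_kernel s (s + (- ?d) * v)) * ennreal (half_kernel t (s + (- ?d) * v)) \<partial>lborel) =
       (\<integral>\<^sup>+v. ennreal (?d powr (2 * ?a)) * ennreal (if 0 < v then v powr ?a * (1 + v) powr ?a else 0) \<partial>lborel)"
    proof (intro nn_integral_cong)
      fix v :: real
      have e: "s - (s + (- ?d) * v) = ?d * v" "t - (s + (- ?d) * v) = ?d * (1 + v)" by (auto simp: algebra_simps)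
      have c: "s + (- ?d) * v < s \<longleftrightarrow> 0 < v" using st by (auto simp: mult_less_0_iff)
      have c2: "s + (- ?d) * v < t" if "0 < v"
      proof -
        have "0 < ?d * v" using st that by (intro mult_pos_pos) auto
        then show ?thesis using st unfolding mult_minus_left by linarith
      qed
      show "ennreal (half_kernel s (s + (- ?d) * v)) * ennreal (half_kernel t (s + (- ?d) * v)) =
         ennreal (?d powr (2 * ?a)) * ennreal (if 0 < v then v powr ?a * (1 + v) powr ?a else 0)"
      proof (cases "0 < v")
        case True
        have "(?d * v) powr ?a * (?d * (1 + v)) powr ?a = ?d powr (2 * ?a) * (v powr ?a * (1 + v) powr ?a)"
          using st True by (simp add: powr_mult flip: powr_add)
        then show ?thesis unfolding half_kernel_def e c using True c2[OF True] by (simp flip: ennreal_mult)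
      next
        case False
        have "half_kernel s (s + (- ?d) * v) = 0" unfolding half_kernel_def c using False by (simp only: if_False)
        then show ?thesis using False by (simp only: if_False) simp
      qed
    qed
    also have "\<dots> = ennreal (?d powr (2 * ?a)) * half_kernel_mass"
      unfolding half_kernel_mass_def by (rule nn_integral_cmult) measurable
    also have "ennreal \<bar>- ?d\<bar> * (ennreal (?d powr (2 * ?a)) * half_kernel_mass) = half_kernel_mass * ennreal (\<kappa> s t)"
    proof -
      have "?d * ?d powr (2 * ?a) = ?d powr (1 + 2 * ?a)" using st by (simp only: powr_add) simp
      also have "\<dots> = \<kappa> s t" using st by (simp add: \<kappa>_def abs_if)
      finally show ?thesis using st by (simp add: ac_simps flip: ennreal_mult mult.assoc)
    qed
    finally show ?thesis .
  qed
  show ?thesis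
    using *[of s t] *[of t s] assms by (cases "s < t") (simp_all add: mult.commute \<kappa>_commute)
qed

lemma frac_kernel_eq: "frac_kernel H n s t = (\<Prod>i<n. \<kappa> (s i) (t i))"
  by (simp add: frac_kernel_def \<kappa>_def)

lemma frac_kernel_nonneg [simp]: "0 \<le> frac_kernel H n s t"
  by (simp add: frac_kernel_eq prod_nonneg)

lemma frac_kernel_commute: "frac_kernel H n s t = frac_kernel H n t s"
  by (simp add: frac_kernel_eq \<kappa>_commute)

lemma measurable_frac_kernel [measurable (raw)]:
  assumes "f \<in> M \<rightarrow>\<^sub>M cube n" "g \<in> M \<rightarrow>\<^sub>M cube n"
  shows "(\<lambda>x. frac_kernel H n (f x) (g x)) \<in> borel_measurable M"
  unfolding frac_kernel_eq
  by (intro borel_measurable_prod measurable_\<kappa> borel_measurable_cube_component) (use assms in auto)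

section \<open>Energies of functions on the cube\<close>

definition \<Lambda> :: real where "\<Lambda> = 2 / (2 * H - 1)"

lemma \<Lambda>_pos: "\<Lambda> > 0" using H by (simp add: \<Lambda>_def)

lemma space_cubeD: "s \<in> space (cube n) \<Longrightarrow> i < n \<Longrightarrow> s i \<in> {0..1}"
  by (auto simp: cube_def space_PiM space_unit_leb PiE_iff)

lemma nn_integral_frac_kernel_le:
  assumes "s \<in> space (cube n)"
  shows "(\<integral>\<^sup>+t. ennreal (frac_kernel H n s t) \<partial>cube n) \<le> ennreal (\<Lambda> ^ n)"
proof -
  have "(\<integral>\<^sup>+t. ennreal (frac_kernel H n s t) \<partial>cube n) = (\<integral>\<^sup>+t. (\<Prod>i<n. ennreal (\<kappa> (s i) (t i))) \<partial>cube n)"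
    by (simp add: frac_kernel_eq prod_ennreal)
  also have "\<dots> = (\<Prod>i<n. \<integral>\<^sup>+t. ennreal (\<kappa> (s i) t) \<partial>unit_leb)"
    unfolding cube_def by (rule unit_prod.product_nn_integral_prod) (auto intro!: measurable_borel_unit_leb)
  also have "\<dots> \<le> (\<Prod>i<n. ennreal \<Lambda>)"
    using nn_integral_\<kappa>_le space_cubeD[OF assms] by (intro prod_mono_ennreal) (auto simp: \<Lambda>_def)
  also have "\<dots> = ennreal (\<Lambda> ^ n)" using \<Lambda>_pos by (simp add: ennreal_power)
  finally show ?thesis .
qed

text \<open>The bilinear form behind the norm of the tensor power. Values in \<open>ennreal\<close>
  make it meaningful for unbounded traces before any integrability is known.\<close>

definition energy_form :: "nat \<Rightarrow> ((nat \<Rightarrow> real) \<Rightarrow> ennreal) \<Rightarrow> ((nat \<Rightarrow> real) \<Rightarrow> ennreal) \<Rightarrow> ennreal" where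
  "energy_form n F G = (\<integral>\<^sup>+s. \<integral>\<^sup>+t. F s * G t * ennreal (frac_kernel H n s t) \<partial>cube n \<partial>cube n)"

lemma pair_sigma_finite_cube: "pair_sigma_finite (cube m) (cube n)"
  by (simp add: pair_sigma_finite_def cube.sigma_finite_measure_axioms)

lemma energy_form_commute:
  assumes [measurable]: "F \<in> borel_measurable (cube n)" "G \<in> borel_measurable (cube n)"
  shows "energy_form n F G = energy_form n G F"
proof -
  interpret pair_sigma_finite "cube n" "cube n" by (rule pair_sigma_finite_cube)
  have "energy_form n F G = (\<integral>\<^sup>+t. \<integral>\<^sup>+s. F s * G t * ennreal (frac_kernel H n s t) \<partial>cube n \<partial>cube n)"
    unfolding energy_form_def by (rule Fubini') measurable
  then show ?thesis unfolding energy_form_def by (simp add: frac_kernel_commute mult.commute)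
qed

lemma energy_form_add_right:
  assumes [measurable]: "F \<in> borel_measurable (cube n)" "G \<in> borel_measurable (cube n)" "G' \<in> borel_measurable (cube n)"
  shows "energy_form n F (\<lambda>t. G t + G' t) = energy_form n F G + energy_form n F G'"
proof -
  have "(\<integral>\<^sup>+s. \<integral>\<^sup>+t. F s * (G t + G' t) * ennreal (frac_kernel H n s t) \<partial>cube n \<partial>cube n) =
      (\<integral>\<^sup>+s. (\<integral>\<^sup>+t. F s * G t * ennreal (frac_kernel H n s t) \<partial>cube n) + (\<integral>\<^sup>+t. F s * G' t * ennreal (frac_kernel H n s t) \<partial>cube n) \<partial>cube n)"
    unfolding distrib_left distrib_right by (intro nn_integral_cong nn_integral_add) measurable
  also have "\<dots> = (\<integral>\<^sup>+s. (\<integral>\<^sup>+t. F s * G t * ennreal (frac_kernel H n s t) \<partial>cube n) \<partial>cube n) + (\<integral>\<^sup>+s. (\<integral>\<^sup>+t. F s * G' t * ennreal (frac_kernel H n s t) \<partial>cube n) \<partial>cube n)"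
    by (rule nn_integral_add) measurable
  finally show ?thesis unfolding energy_form_def .
qed

lemma energy_form_add_left:
  assumes [measurable]: "F \<in> borel_measurable (cube n)" "G \<in> borel_measurable (cube n)" "G' \<in> borel_measurable (cube n)"
  shows "energy_form n (\<lambda>t. G t + G' t) F = energy_form n G F + energy_form n G' F"
proof -
  have "(\<integral>\<^sup>+s. \<integral>\<^sup>+t. (G s + G' s) * F t * ennreal (frac_kernel H n s t) \<partial>cube n \<partial>cube n) =
      (\<integral>\<^sup>+s. (\<integral>\<^sup>+t. G s * F t * ennreal (frac_kernel H n s t) \<partial>cube n) + (\<integral>\<^sup>+t. G' s * F t * ennreal (frac_kernel H n s t) \<partial>cube n) \<partial>cube n)"
    unfolding distrib_left distrib_right by (intro nn_integral_cong nn_integral_add) measurable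
  also have "\<dots> = (\<integral>\<^sup>+s. (\<integral>\<^sup>+t. G s * F t * ennreal (frac_kernel H n s t) \<partial>cube n) \<partial>cube n) + (\<integral>\<^sup>+s. (\<integral>\<^sup>+t. G' s * F t * ennreal (frac_kernel H n s t) \<partial>cube n) \<partial>cube n)"
    by (rule nn_integral_add) measurable
  finally show ?thesis unfolding energy_form_def .
qed

text \<open>Writing each factor of the kernel as a convolution of half-kernels and exchanging
  integrals turns the form into an L2 product of T F and T G. This is the source of
  positivity.\<close>

lemma energy_form_eq_square:
  assumes [measurable]: "F \<in> borel_measurable (cube n)" "G \<in> borel_measurable (cube n)"
  defines "T \<equiv> \<lambda>F u. \<integral>\<^sup>+s. F s * (\<Prod>i<n. ennreal (half_kernel (s i) (u i))) \<partial>cube n"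
  shows "half_kernel_mass ^ n * energy_form n F G = (\<integral>\<^sup>+u. T F u * T G u \<partial>Pi\<^sub>M {..<n} (\<lambda>_. lborel))"
proof -
  let ?L = "Pi\<^sub>M {..<n} (\<lambda>_. lborel :: real measure)"
  let ?k = "\<lambda>s u. \<Prod>i<n. ennreal (half_kernel (s i) (u i))"
  have sf: "sigma_finite_measure ?L" by (rule lborel_prod.sigma_finite) simp
  interpret L: pair_sigma_finite ?L "cube n"
    using sf by (simp add: pair_sigma_finite_def cube.sigma_finite_measure_axioms)
  interpret Lm: sigma_finite_measure ?L by (rule sf)
  have meas: "(\<lambda>x. ?k (f x) (g x)) \<in> borel_measurable N"
    if f: "f \<in> N \<rightarrow>\<^sub>M cube n" and g: "g \<in> N \<rightarrow>\<^sub>M ?L" for f g and N :: "'x measure"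
  proof (rule borel_measurable_prod_ennreal)
    fix i assume i: "i \<in> {..<n}"
    have [measurable]: "(\<lambda>x. g x i) \<in> borel_measurable N"
      using measurable_compose[OF g measurable_component_singleton[OF i]] by simp
    have [measurable]: "(\<lambda>x. f x i) \<in> borel_measurable N"
      using i by (intro borel_measurable_cube_component[OF f]) auto
    show "(\<lambda>x. ennreal (half_kernel (f x i) (g x i))) \<in> borel_measurable N" by measurable
  qed
  note [measurable] = meas
  have "(\<integral>\<^sup>+u. T F u * T G u \<partial>?L) = (\<integral>\<^sup>+u. \<integral>\<^sup>+s. \<integral>\<^sup>+t. F s * G t * (?k s u * ?k t u) \<partial>cube n \<partial>cube n \<partial>?L)"
  proof (intro nn_integral_cong)
    fix u assume u: "u \<in> space ?L"
    have [measurable]: "(\<lambda>s. ?k s u) \<in> borel_measurable (cube n)" by (rule meas) (use u in auto)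
    have "T F u * T G u = (\<integral>\<^sup>+s. F s * ?k s u * T G u \<partial>cube n)"
      unfolding T_def by (rule nn_integral_multc[symmetric]) measurable
    also have "\<dots> = (\<integral>\<^sup>+s. \<integral>\<^sup>+t. F s * ?k s u * (G t * ?k t u) \<partial>cube n \<partial>cube n)"
      unfolding T_def by (intro nn_integral_cong nn_integral_cmult[symmetric]) measurable
    finally show "T F u * T G u = (\<integral>\<^sup>+s. \<integral>\<^sup>+t. F s * G t * (?k s u * ?k t u) \<partial>cube n \<partial>cube n)"
      by (simp add: ac_simps)
  qed
  also have "\<dots> = (\<integral>\<^sup>+s. \<integral>\<^sup>+u. \<integral>\<^sup>+t. F s * G t * (?k s u * ?k t u) \<partial>cube n \<partial>?L \<partial>cube n)"
    by (rule L.Fubini'[symmetric]) measurable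
  also have "\<dots> = (\<integral>\<^sup>+s. \<integral>\<^sup>+t. \<integral>\<^sup>+u. F s * G t * (?k s u * ?k t u) \<partial>?L \<partial>cube n \<partial>cube n)"
    by (intro nn_integral_cong L.Fubini'[symmetric]) measurable
  also have "\<dots> = (\<integral>\<^sup>+s. \<integral>\<^sup>+t. half_kernel_mass ^ n * (F s * G t * ennreal (frac_kernel H n s t)) \<partial>cube n \<partial>cube n)"
  proof (rule nn_integral_cong)
    fix s assume s: "s \<in> space (cube n)"
    \<comment> \<open>The convolution identity fails where some coordinates of s and t agree. For
      fixed s this is a null set of t.\<close>
    have "AE t in cube n. (\<integral>\<^sup>+u. F s * G t * (?k s u * ?k t u) \<partial>?L) = half_kernel_mass ^ n * (F s * G t * ennreal (frac_kernel H n s t))"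
      using AE_cube_neq[of n s] AE_space
    proof eventually_elim
      case (elim t)
      have m: "(\<lambda>u. ?k v u) \<in> borel_measurable ?L" if "v \<in> space (cube n)" for v by (rule meas) (use that in auto)
      have "(\<integral>\<^sup>+u. F s * G t * (?k s u * ?k t u) \<partial>?L) = F s * G t * (\<integral>\<^sup>+u. ?k s u * ?k t u \<partial>?L)"
        using m[OF s] m[OF elim(2)] by (intro nn_integral_cmult borel_measurable_times_ennreal)
      also have "(\<integral>\<^sup>+u. ?k s u * ?k t u \<partial>?L) = (\<integral>\<^sup>+u. (\<Prod>i<n. ennreal (half_kernel (s i) (u i)) * ennreal (half_kernel (t i) (u i))) \<partial>?L)"
        by (simp add: prod.distrib)
      also have "\<dots> = (\<Prod>i<n. \<integral>\<^sup>+u. ennreal (half_kernel (s i) u) * ennreal (half_kernel (t i) u) \<partial>lborel)"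
        by (rule lborel_prod.product_nn_integral_prod) auto
      also have "\<dots> = (\<Prod>i<n. half_kernel_mass * ennreal (\<kappa> (s i) (t i)))"
        using elim(1) by (intro prod.cong refl \<kappa>_eq_convolution) (metis lessThan_iff)
      also have "\<dots> = half_kernel_mass ^ n * ennreal (frac_kernel H n s t)"
        by (simp add: prod.distrib frac_kernel_eq prod_ennreal)
      finally show ?case by (simp add: ac_simps)
    qed
    then show "(\<integral>\<^sup>+t. \<integral>\<^sup>+u. F s * G t * (?k s u * ?k t u) \<partial>?L \<partial>cube n) =
        (\<integral>\<^sup>+t. half_kernel_mass ^ n * (F s * G t * ennreal (frac_kernel H n s t)) \<partial>cube n)"
      by (rule nn_integral_cong_AE)
  qed
  also have "\<dots> = half_kernel_mass ^ n * energy_form n F G"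
  proof -
    have "(\<integral>\<^sup>+s. \<integral>\<^sup>+t. half_kernel_mass ^ n * (F s * G t * ennreal (frac_kernel H n s t)) \<partial>cube n \<partial>cube n) =
      (\<integral>\<^sup>+s. half_kernel_mass ^ n * (\<integral>\<^sup>+t. F s * G t * ennreal (frac_kernel H n s t) \<partial>cube n) \<partial>cube n)"
      by (intro nn_integral_cong nn_integral_cmult) measurable
    also have "\<dots> = half_kernel_mass ^ n * energy_form n F G"
      unfolding energy_form_def by (rule nn_integral_cmult) measurable
    finally show ?thesis .
  qed
  finally show ?thesis ..
qed

text \<open>Nonnegativity of the energy of F - G, put without subtraction so that it makes sense in
  \<open>ennreal\<close>: apply 2 x y <= x^2 + y^2 under the integral over u and cancel the power of
  \<open>half_kernel_mass\<close>.\<close>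

lemma energy_form_amgm:
  assumes [measurable]: "F \<in> borel_measurable (cube n)" "G \<in> borel_measurable (cube n)"
  shows "2 * energy_form n F G \<le> energy_form n F F + energy_form n G G"
proof -
  let ?L = "Pi\<^sub>M {..<n} (\<lambda>_. lborel :: real measure)"
  let ?T = "\<lambda>F u. \<integral>\<^sup>+s. F s * (\<Prod>i<n. ennreal (half_kernel (s i) (u i))) \<partial>cube n"
  have amgm: "2 * (x * y) \<le> x * x + y * y" for x y :: ennreal
  proof (cases x; cases y)
    fix a b assume "x = ennreal a" "y = ennreal b" "0 \<le> a" "0 \<le> b"
    moreover have "2 * (a * b) \<le> a * a + b * b" using sum_squares_bound[of a b] by (simp add: power2_eq_square)
    ultimately show ?thesis by (simp flip: ennreal_mult ennreal_plus ennreal_numeral)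
  qed (auto simp: ennreal_top_mult ennreal_mult_top)
  have meas: "(\<lambda>x. \<Prod>i<n. ennreal (half_kernel (snd x i) (fst x i))) \<in> borel_measurable (?L \<Otimes>\<^sub>M cube n)"
  proof (rule borel_measurable_prod_ennreal)
    fix i assume i: "i \<in> {..<n}"
    have [measurable]: "(\<lambda>x. fst x i) \<in> borel_measurable (?L \<Otimes>\<^sub>M cube n)"
      using measurable_compose[OF measurable_fst measurable_component_singleton[OF i, of "\<lambda>_. lborel"]] by simp
    have [measurable]: "(\<lambda>x. snd x i) \<in> borel_measurable (?L \<Otimes>\<^sub>M cube n)"
      using i by (intro borel_measurable_cube_component) auto
    show "(\<lambda>x. ennreal (half_kernel (snd x i) (fst x i))) \<in> borel_measurable (?L \<Otimes>\<^sub>M cube n)" by measurable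
  qed
  have T [measurable]: "?T F \<in> borel_measurable ?L" if [measurable]: "F \<in> borel_measurable (cube n)" for F
  proof (rule cube.borel_measurable_nn_integral)
    have "(\<lambda>x. F (snd x) * (\<Prod>i<n. ennreal (half_kernel (snd x i) (fst x i)))) \<in> borel_measurable (?L \<Otimes>\<^sub>M cube n)"
      using meas by measurable
    then show "(\<lambda>(u, s). F s * (\<Prod>i<n. ennreal (half_kernel (s i) (u i)))) \<in> borel_measurable (?L \<Otimes>\<^sub>M cube n)"
      by (simp add: split_beta')
  qed
  have "half_kernel_mass ^ n * (2 * energy_form n F G) = (\<integral>\<^sup>+u. 2 * (?T F u * ?T G u) \<partial>?L)"
    using energy_form_eq_square[of F n G] by (subst nn_integral_cmult) (auto simp: ac_simps)
  also have "\<dots> \<le> (\<integral>\<^sup>+u. ?T F u * ?T F u + ?T G u * ?T G u \<partial>?L)"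
    by (intro nn_integral_mono amgm)
  also have "\<dots> = (\<integral>\<^sup>+u. ?T F u * ?T F u \<partial>?L) + (\<integral>\<^sup>+u. ?T G u * ?T G u \<partial>?L)"
    by (rule nn_integral_add) measurable
  also have "\<dots> = half_kernel_mass ^ n * (energy_form n F F + energy_form n G G)"
    using energy_form_eq_square[of F n F] energy_form_eq_square[of G n G] by (simp add: distrib_left)
  finally have "half_kernel_mass ^ n * (2 * energy_form n F G) \<le> half_kernel_mass ^ n * (energy_form n F F + energy_form n G G)" .
  moreover have "half_kernel_mass ^ n \<noteq> 0" "half_kernel_mass ^ n \<noteq> top" using half_kernel_mass_pos half_kernel_mass_finite by (auto simp: power_eq_top_ennreal)
  ultimately show ?thesis by (simp add: ennreal_mult_le_mult_iff)
qed

section \<open>Pairing with bounded functions, in real numbers\<close>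

lemma integrable_bounded_mult:
  fixes f g :: "'x \<Rightarrow> real"
  assumes f: "integrable N f" and [measurable]: "g \<in> borel_measurable N" and b: "\<And>x. x \<in> space N \<Longrightarrow> \<bar>g x\<bar> \<le> B"
  shows "integrable N (\<lambda>x. f x * g x)"
proof (rule Bochner_Integration.integrable_bound)
  show "integrable N (\<lambda>x. B * f x)" using f by simp
  have [measurable]: "f \<in> borel_measurable N" using f by auto
  show "(\<lambda>x. f x * g x) \<in> borel_measurable N" by measurable
  show "AE x in N. norm (f x * g x) \<le> norm (B * f x)"
  proof (rule AE_I2)
    fix x assume "x \<in> space N"
    from b[OF this] have "\<bar>g x\<bar> \<le> \<bar>B\<bar>" by linarith
    then show "norm (f x * g x) \<le> norm (B * f x)" using mult_right_mono[of "\<bar>g x\<bar>" "\<bar>B\<bar>" "\<bar>f x\<bar>"] by (simp add: abs_mult mult.commute)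
  qed
qed

definition kern :: "nat \<Rightarrow> ((nat \<Rightarrow> real) \<Rightarrow> real) \<Rightarrow> (nat \<Rightarrow> real) \<Rightarrow> real" where
  "kern n G s = (LINT t|cube n. G t * frac_kernel H n s t)"

lemma measurable_kern [measurable]:
  assumes [measurable]: "G \<in> borel_measurable (cube n)"
  shows "kern n G \<in> borel_measurable (cube n)"
  unfolding kern_def by measurable

lemma integrable_frac_kernel:
  assumes s: "s \<in> space (cube n)"
  shows "integrable (cube n) (frac_kernel H n s)"
proof (rule integrableI_nonneg)
  show "(\<integral>\<^sup>+t. ennreal (frac_kernel H n s t) \<partial>cube n) < \<infinity>"
    using nn_integral_frac_kernel_le[OF s] by (simp add: le_less_trans)
qed (use s in \<open>auto intro!: measurable_frac_kernel\<close>)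

lemma integral_frac_kernel_le:
  assumes s: "s \<in> space (cube n)"
  shows "(LINT t|cube n. frac_kernel H n s t) \<le> \<Lambda> ^ n"
  using nn_integral_frac_kernel_le[OF s] nn_integral_eq_integral[OF integrable_frac_kernel[OF s]] \<Lambda>_pos
  by simp

lemma integrable_kern:
  assumes [measurable]: "G \<in> borel_measurable (cube n)"
    and B: "\<And>t. t \<in> space (cube n) \<Longrightarrow> \<bar>G t\<bar> \<le> B" and s: "s \<in> space (cube n)"
  shows "integrable (cube n) (\<lambda>t. G t * frac_kernel H n s t)"
  using integrable_bounded_mult[OF integrable_frac_kernel[OF s], of G B] B by (simp add: mult.commute)

lemma kern_bound:
  assumes [measurable]: "G \<in> borel_measurable (cube n)"
    and B: "\<And>t. t \<in> space (cube n) \<Longrightarrow> \<bar>G t\<bar> \<le> B" and s: "s \<in> space (cube n)"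
  shows "\<bar>kern n G s\<bar> \<le> B * \<Lambda> ^ n"
proof -
  have "B \<ge> 0" using B[OF s] by linarith
  have "\<bar>kern n G s\<bar> \<le> (LINT t|cube n. \<bar>G t * frac_kernel H n s t\<bar>)"
    unfolding kern_def by (rule integral_abs_bound)
  also have "\<dots> \<le> (LINT t|cube n. B * frac_kernel H n s t)"
    by (intro Bochner_Integration.integral_mono integrable_abs integrable_kern[OF assms] integrable_mult_right integrable_frac_kernel[OF s])
       (auto simp: abs_mult mult_right_mono B)
  also have "\<dots> \<le> B * \<Lambda> ^ n"
    using integral_frac_kernel_le[OF s] \<open>B \<ge> 0\<close> by (simp add: mult_left_mono)
  finally show ?thesis .
qed

text \<open>For bounded G the function \<open>kern n G\<close> is bounded by
  \<open>kern_bound\<close>, so its product with an integrable f is integrable, however unbounded f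
  is. This is the passage from \<open>ennreal\<close> back to the reals.\<close>

lemma energy_form_eq_integral:
  assumes f: "integrable (cube n) f" "\<And>s. 0 \<le> f s"
    and [measurable]: "G \<in> borel_measurable (cube n)" and G: "\<And>t. 0 \<le> G t" "\<And>t. t \<in> space (cube n) \<Longrightarrow> G t \<le> B"
  shows "energy_form n f G = ennreal (LINT s|cube n. f s * kern n G s)"
    and "integrable (cube n) (\<lambda>s. f s * kern n G s)"
proof -
  have [measurable]: "f \<in> borel_measurable (cube n)" using f by auto
  have B: "\<bar>G t\<bar> \<le> B" if "t \<in> space (cube n)" for t using G that by simp
  have kn: "0 \<le> kern n G s" for s unfolding kern_def using G by (intro Bochner_Integration.integral_nonneg) simp
  show int: "integrable (cube n) (\<lambda>s. f s * kern n G s)"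
    by (rule integrable_bounded_mult[OF f(1), of _ "B * \<Lambda> ^ n"]) (use kern_bound[of G n B] B in auto)
  have "energy_form n f G = (\<integral>\<^sup>+s. ennreal (f s) * (\<integral>\<^sup>+t. ennreal (G t * frac_kernel H n s t) \<partial>cube n) \<partial>cube n)"
    unfolding energy_form_def
  proof (intro nn_integral_cong)
    fix s assume s: "s \<in> space (cube n)"
    have "(\<integral>\<^sup>+t. ennreal (f s) * ennreal (G t) * ennreal (frac_kernel H n s t) \<partial>cube n) =
        (\<integral>\<^sup>+t. ennreal (f s) * ennreal (G t * frac_kernel H n s t) \<partial>cube n)"
      using f(2) G(1) by (simp add: ennreal_mult mult.assoc)
    also have "\<dots> = ennreal (f s) * (\<integral>\<^sup>+t. ennreal (G t * frac_kernel H n s t) \<partial>cube n)"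
      using s by (intro nn_integral_cmult) measurable
    finally show "(\<integral>\<^sup>+t. ennreal (f s) * ennreal (G t) * ennreal (frac_kernel H n s t) \<partial>cube n) = \<dots>" .
  qed
  also have "\<dots> = (\<integral>\<^sup>+s. ennreal (f s * kern n G s) \<partial>cube n)"
  proof (intro nn_integral_cong)
    fix s assume s: "s \<in> space (cube n)"
    have "(\<integral>\<^sup>+t. ennreal (G t * frac_kernel H n s t) \<partial>cube n) = ennreal (kern n G s)"
      unfolding kern_def using integrable_kern[of G n B s] B s G by (intro nn_integral_eq_integral) auto
    then show "ennreal (f s) * (\<integral>\<^sup>+t. ennreal (G t * frac_kernel H n s t) \<partial>cube n) = ennreal (f s * kern n G s)"
      using f(2) kn by (simp add: ennreal_mult)
  qed
  also have "\<dots> = ennreal (LINT s|cube n. f s * kern n G s)"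
    using int f(2) kn by (intro nn_integral_eq_integral) auto
  finally show "energy_form n f G = ennreal (LINT s|cube n. f s * kern n G s)" .
qed

text \<open>This is 0 <= <f - G, f - G> for nonnegative, possibly unbounded f and signed, bounded G.
  It becomes the lower bound that \<open>riesz_on_subspace\<close> asks for.\<close>

lemma energy_quadratic_bound:
  fixes f G :: "(nat \<Rightarrow> real) \<Rightarrow> real"
  assumes f: "integrable (cube n) f" "\<And>s. 0 \<le> f s" and C: "energy_form n f f \<le> ennreal C" "0 \<le> C"
    and [measurable]: "G \<in> borel_measurable (cube n)" and B: "\<And>t. t \<in> space (cube n) \<Longrightarrow> \<bar>G t\<bar> \<le> B"
  shows "2 * (LINT s|cube n. f s * kern n G s) \<le> C + (LINT s|cube n. G s * kern n G s)"
proof -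
  have [measurable]: "f \<in> borel_measurable (cube n)" using f by auto
  define P Q where "P t = max 0 (G t)" and "Q t = max 0 (- G t)" for t
  have [measurable]: "P \<in> borel_measurable (cube n)" "Q \<in> borel_measurable (cube n)"
    unfolding P_def Q_def by measurable
  have PQ: "0 \<le> P t" "0 \<le> Q t" "G t = P t - Q t" for t by (auto simp: P_def Q_def)
  have bnd: "P t \<le> B" "Q t \<le> B" if "t \<in> space (cube n)" for t using B[OF that] by (auto simp: P_def Q_def)
  have intPQ: "integrable (cube n) P" "integrable (cube n) Q"
    by (rule cube.integrable_const_bound[where B = B]; use PQ bnd in auto)+
  have kern_diff: "kern n G s = kern n P s - kern n Q s" if "s \<in> space (cube n)" for s
    unfolding kern_def PQ(3) left_diff_distrib
    using that PQ bnd by (intro Bochner_Integration.integral_diff integrable_kern[of _ _ B]) auto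
  have kn: "0 \<le> kern n P s" "0 \<le> kern n Q s" for s unfolding kern_def using PQ by (intro Bochner_Integration.integral_nonneg; simp)+
  define a b c d d' e where "a = (LINT s|cube n. f s * kern n P s)" and "b = (LINT s|cube n. f s * kern n Q s)"
    and "c = (LINT s|cube n. P s * kern n P s)" and "d = (LINT s|cube n. P s * kern n Q s)"
    and "d' = (LINT s|cube n. Q s * kern n P s)" and "e = (LINT s|cube n. Q s * kern n Q s)"
  have nn: "0 \<le> a" "0 \<le> b" "0 \<le> c" "0 \<le> d" "0 \<le> d'" "0 \<le> e"
    unfolding a_def b_def c_def d_def d'_def e_def using f PQ kn by (auto intro!: Bochner_Integration.integral_nonneg)
  note F = energy_form_eq_integral[OF f, where G = P and B = B] energy_form_eq_integral[OF f, where G = Q and B = B]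
    energy_form_eq_integral[OF intPQ(1), where G = P and B = B] energy_form_eq_integral[OF intPQ(1), where G = Q and B = B]
    energy_form_eq_integral[OF intPQ(2), where G = P and B = B] energy_form_eq_integral[OF intPQ(2), where G = Q and B = B]
  have energy_form: "energy_form n f P = ennreal a" "energy_form n f Q = ennreal b" "energy_form n P P = ennreal c"
      "energy_form n P Q = ennreal d" "energy_form n Q P = ennreal d'" "energy_form n Q Q = ennreal e"
    using F PQ bnd by (auto simp: a_def b_def c_def d_def d'_def e_def)
  have int: "integrable (cube n) (\<lambda>s. f s * kern n P s)" "integrable (cube n) (\<lambda>s. f s * kern n Q s)"
      "integrable (cube n) (\<lambda>s. P s * kern n P s)" "integrable (cube n) (\<lambda>s. P s * kern n Q s)"
      "integrable (cube n) (\<lambda>s. Q s * kern n P s)" "integrable (cube n) (\<lambda>s. Q s * kern n Q s)"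
    using F PQ bnd by auto
  \<comment> \<open>With d = d' the inequality reached below, 2 (a + d) <= C + 2 b + e + c, regroups
    to 2 (a - b) <= C + (c - 2 d + e), and the bracket is the energy of G = P - Q.\<close>
  have dd: "d = d'"
    using energy_form_commute[of P n Q] nn unfolding energy_form by simp
  \<comment> \<open>Moving the negative part of \<open>G\<close> to the side of \<open>f\<close> keeps all terms nonnegative.\<close>
  have "2 * energy_form n (\<lambda>s. ennreal (f s) + ennreal (Q s)) P \<le>
      energy_form n (\<lambda>s. ennreal (f s) + ennreal (Q s)) (\<lambda>s. ennreal (f s) + ennreal (Q s)) + energy_form n P P"
    by (rule energy_form_amgm) measurable
  also have "energy_form n (\<lambda>s. ennreal (f s) + ennreal (Q s)) P = ennreal (a + d')"
    using nn by (subst energy_form_add_left) (auto simp: energy_form)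
  also have "energy_form n (\<lambda>s. ennreal (f s) + ennreal (Q s)) (\<lambda>s. ennreal (f s) + ennreal (Q s)) =
      (energy_form n f f + energy_form n Q f) + (energy_form n f Q + energy_form n Q Q)"
    by (simp add: energy_form_add_left energy_form_add_right)
  also have "energy_form n Q f = energy_form n f Q" by (rule energy_form_commute) measurable
  also have "energy_form n f f + energy_form n f Q + (energy_form n f Q + energy_form n Q Q) + energy_form n P P \<le> ennreal (C + b + (b + e) + c)"
  proof -
    have "energy_form n f f + energy_form n f Q + (energy_form n f Q + energy_form n Q Q) + energy_form n P P \<le>
        ennreal C + ennreal b + (ennreal b + ennreal e) + ennreal c"
      unfolding energy_form by (intro add_mono C order_refl)
    also have "\<dots> = ennreal (C + b + (b + e) + c)"
      using nn C by (simp add: ennreal_plus[symmetric] del: ennreal_plus)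
    finally show ?thesis .
  qed
  finally have "2 * ennreal (a + d') \<le> ennreal (C + b + (b + e) + c)" .
  then have "ennreal (2 * (a + d')) \<le> ennreal (C + b + (b + e) + c)"
    using nn by (simp add: ennreal_mult)
  then have main: "2 * (a + d') \<le> C + b + (b + e) + c" using nn C by (simp del: ennreal_plus)
  have "(LINT s|cube n. f s * kern n G s) = (LINT s|cube n. f s * kern n P s - f s * kern n Q s)"
    by (intro Bochner_Integration.integral_cong refl) (simp add: kern_diff right_diff_distrib)
  also have "\<dots> = a - b" unfolding a_def b_def by (intro Bochner_Integration.integral_diff int)
  finally have 1: "(LINT s|cube n. f s * kern n G s) = a - b" .
  have "(LINT s|cube n. G s * kern n G s) =
      (LINT s|cube n. (P s * kern n P s - P s * kern n Q s) - (Q s * kern n P s - Q s * kern n Q s))"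
    by (intro Bochner_Integration.integral_cong refl) (simp add: kern_diff PQ(3) algebra_simps)
  also have "\<dots> = (c - d) - (d' - e)" unfolding c_def d_def d'_def e_def
    using int by simp
  finally have 2: "(LINT s|cube n. G s * kern n G s) = (c - d) - (d' - e)" .
  have "2 * (a - b) \<le> C + ((c - d) - (d' - e))" using main dd by argo
  then show ?thesis by (simp only: 1 2)
qed

section \<open>One-variable potentials\<close>

definition potential :: "(real \<Rightarrow> real) \<Rightarrow> real \<Rightarrow> real" where
  "potential g x = (LINT t|unit_leb. g t * \<kappa> x t)"

lemma integrable_\<kappa>: "x \<in> {0..1} \<Longrightarrow> integrable unit_leb (\<kappa> x)"
  using nn_integral_\<kappa>_le[of x]
  by (intro integrableI_nonneg) (auto intro!: measurable_borel_unit_leb simp: le_less_trans)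

lemma integral_\<kappa>_le: "x \<in> {0..1} \<Longrightarrow> (LINT t|unit_leb. \<kappa> x t) \<le> \<Lambda>"
  using nn_integral_\<kappa>_le[of x] nn_integral_eq_integral[OF integrable_\<kappa>[of x]] \<Lambda>_pos
  by (simp add: \<Lambda>_def)

lemma integrable_potential:
  assumes "g \<in> borel_measurable borel" "\<And>t. \<bar>g t\<bar> \<le> B" "x \<in> {0..1}"
  shows "integrable unit_leb (\<lambda>t. g t * \<kappa> x t)"
  using integrable_bounded_mult[OF integrable_\<kappa>[OF assms(3)] measurable_borel_unit_leb[OF assms(1)], of B] assms(2)
  by (simp add: mult.commute)

lemma potential_bound:
  assumes "g \<in> borel_measurable borel" "\<And>t. \<bar>g t\<bar> \<le> B" "x \<in> {0..1}"
  shows "\<bar>potential g x\<bar> \<le> B * \<Lambda>"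
proof -
  have "B \<ge> 0" using assms(2)[of 0] by linarith
  have "\<bar>potential g x\<bar> \<le> (LINT t|unit_leb. \<bar>g t * \<kappa> x t\<bar>)"
    unfolding potential_def by (rule integral_abs_bound)
  also have "\<dots> \<le> (LINT t|unit_leb. B * \<kappa> x t)"
    by (intro Bochner_Integration.integral_mono integrable_abs integrable_potential[OF assms] integrable_mult_right integrable_\<kappa>[OF assms(3)])
       (auto simp: abs_mult mult_right_mono assms(2))
  also have "\<dots> \<le> B * \<Lambda>"
    using integral_\<kappa>_le[OF assms(3)] \<open>B \<ge> 0\<close> by (simp add: mult_left_mono)
  finally show ?thesis .
qed

lemma measurable_potential [measurable]:
  assumes [measurable]: "g \<in> borel_measurable borel"
  shows "potential g \<in> borel_measurable borel"
proof -
  have [measurable]: "(\<lambda>t. g t) \<in> borel_measurable unit_leb" "(\<lambda>t. t) \<in> borel_measurable unit_leb"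
    by (auto intro!: measurable_borel_unit_leb)
  have "(\<lambda>x. LINT t|unit_leb. g t * \<kappa> x t) \<in> borel_measurable borel"
  proof (rule unit_leb.borel_measurable_lebesgue_integral)
    have "(\<lambda>p. g (snd p) * \<kappa> (fst p) (snd p)) \<in> borel_measurable (borel \<Otimes>\<^sub>M unit_leb)"
      using measurable_compose[OF measurable_snd[of borel unit_leb] measurable_unit_leb] by measurable
    then show "(\<lambda>(x, t). g t * \<kappa> x t) \<in> borel_measurable (borel \<Otimes>\<^sub>M unit_leb)" by (simp add: split_beta')
  qed
  then show ?thesis unfolding potential_def .
qed

lemma potential_add:
  assumes "g \<in> borel_measurable borel" "\<And>t. \<bar>g t\<bar> \<le> B" "g' \<in> borel_measurable borel" "\<And>t. \<bar>g' t\<bar> \<le> B'" "x \<in> {0..1}"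
  shows "potential (\<lambda>t. g t + g' t) x = potential g x + potential g' x"
  unfolding potential_def distrib_right
  by (intro Bochner_Integration.integral_add integrable_potential[OF assms(1,2,5)] integrable_potential[OF assms(3,4,5)])

text \<open>Kernel and measure factor over the coordinates. Pairings with tensors of test functions
  thereby become integrals against products of one-variable potentials.\<close>

lemma kern_prod:
  assumes g: "\<And>i. i < n \<Longrightarrow> g i \<in> borel_measurable borel" "\<And>i t. i < n \<Longrightarrow> \<bar>g i t\<bar> \<le> B i" and s: "s \<in> space (cube n)"
  shows "kern n (\<lambda>t. \<Prod>i<n. g i (t i)) s = (\<Prod>i<n. potential (g i) (s i))"
proof -
  have "kern n (\<lambda>t. \<Prod>i<n. g i (t i)) s = (LINT t|cube n. (\<Prod>i<n. g i (t i) * \<kappa> (s i) (t i)))"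
    unfolding kern_def frac_kernel_eq by (simp add: prod.distrib)
  also have "\<dots> = (\<Prod>i<n. potential (g i) (s i))"
    unfolding cube_def potential_def
    using integrable_potential[OF g] space_cubeD[OF s] by (intro unit_prod.product_integral_prod) auto
  finally show ?thesis .
qed

end

section \<open>The renewal kernels\<close>

text \<open>The inserted 0 plays the role of t_0. Working with the set of points instead of the
  sorted list makes symmetry automatic and the effect of additional points a matter of
  monotonicity.\<close>

definition predecessor :: "real set \<Rightarrow> real \<Rightarrow> real" where
  "predecessor A v = Max (insert 0 {w \<in> A. w < v})"

definition gap_prod :: "real \<Rightarrow> real set \<Rightarrow> real" where
  "gap_prod e A = (\<Prod>v\<in>A. (v - predecessor A v) powr e)"

lemma predecessor_nonneg: "finite A \<Longrightarrow> 0 \<le> predecessor A v"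
  unfolding predecessor_def by (intro Max_ge) auto

lemma predecessor_less: "finite A \<Longrightarrow> 0 < v \<Longrightarrow> predecessor A v < v"
  unfolding predecessor_def by (subst Max_less_iff) auto

lemma predecessor_mono: "finite B \<Longrightarrow> A \<subseteq> B \<Longrightarrow> predecessor A v \<le> predecessor B v"
  unfolding predecessor_def by (intro Max_mono) (auto intro: finite_subset)

lemma predecessor_ge: "finite A \<Longrightarrow> w \<in> A \<Longrightarrow> w < v \<Longrightarrow> w \<le> predecessor A v"
  unfolding predecessor_def by (intro Max_ge) auto

lemma gap_prod_nonneg [simp]: "0 \<le> gap_prod e A"
  unfolding gap_prod_def by (intro prod_nonneg) auto

lemma gap_prod_Un:
  assumes fin: "finite A" "finite B" and disj: "A \<inter> B = {}" and pos: "\<And>v. v \<in> A \<union> B \<Longrightarrow> 0 < v" and e: "e \<le> 0"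
  shows "gap_prod e A * gap_prod e B \<le> gap_prod e (A \<union> B)"
proof -
  have le: "(v - predecessor C v) powr e \<le> (v - predecessor (A \<union> B) v) powr e" if "C \<subseteq> A \<union> B" "v \<in> A \<union> B" for C v
    using that fin e pos[OF that(2)] predecessor_less[of "A \<union> B" v] predecessor_mono[of "A \<union> B" C v]
    by (intro powr_mono2') auto
  have "gap_prod e A * gap_prod e B \<le> (\<Prod>v\<in>A. (v - predecessor (A \<union> B) v) powr e) * (\<Prod>v\<in>B. (v - predecessor (A \<union> B) v) powr e)"
    unfolding gap_prod_def by (intro mult_mono prod_mono prod_nonneg conjI le) auto
  also have "\<dots> = gap_prod e (A \<union> B)"
    unfolding gap_prod_def using fin disj by (subst prod.union_disjoint) auto
  finally show ?thesis .
qed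

text \<open>A new largest point changes no other predecessor, so it contributes exactly one factor.
  This allows the largest coordinate to be integrated out.\<close>

lemma gap_prod_insert_max:
  assumes "finite A" "\<And>w. w \<in> A \<Longrightarrow> w < v"
  shows "gap_prod e (insert v A) = (v - Max (insert 0 A)) powr e * gap_prod e A"
proof -
  have "v \<notin> A" using assms by auto
  moreover have "predecessor (insert v A) w = predecessor A w" if "w \<in> A" for w
    unfolding predecessor_def using assms(2)[OF that] by (intro arg_cong[of _ _ Max] arg_cong[of _ _ "insert 0"]) auto
  moreover have "predecessor (insert v A) v = Max (insert 0 A)"
    unfolding predecessor_def using assms(2) by (intro arg_cong[of _ _ Max] arg_cong[of _ _ "insert 0"]) auto
  ultimately show ?thesis unfolding gap_prod_def using assms(1) by (simp cong: prod.cong)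
qed

text \<open>In a strictly increasing list of positive numbers the predecessor of entry i is entry i
  - 1, or 0 for the first one; both cases are \<open>(0 # ts) ! i\<close>.\<close>

lemma phi_sorted_prod_eq_gap_prod:
  fixes ts :: "real list"
  assumes "sorted_wrt (<) ts" "\<And>v. v \<in> set ts \<Longrightarrow> 0 < v"
  shows "(\<Prod>i<length ts. (ts ! i - (0 # ts) ! i) powr e) = gap_prod e (set ts)"
proof -
  have "predecessor (set ts) (ts ! i) = (0 # ts) ! i" if i: "i < length ts" for i
  proof -
    have "Max (insert 0 {w \<in> set ts. w < ts ! i}) = (0 # ts) ! i"
    proof (rule Max_eqI)
      fix y assume "y \<in> insert 0 {w \<in> set ts. w < ts ! i}"
      then consider "y = 0" | j where "j < length ts" "y = ts ! j" "ts ! j < ts ! i"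
        by (auto simp: in_set_conv_nth)
      then show "y \<le> (0 # ts) ! i"
      proof cases
        case 1
        then show ?thesis using i assms(2) by (cases i) (auto intro: less_imp_le)
      next
        case 2
        have "j < i"
          using 2 i sorted_wrt_nth_less[OF assms(1), of i j] by (metis less_asym linorder_neqE_nat order_less_irrefl)
        then obtain l where l: "i = Suc l" "j \<le> l" by (cases i) auto
        then show ?thesis using 2 i sorted_wrt_nth_less[OF assms(1), of j l] by (cases "j = l") auto
      qed
    next
      show "(0 # ts) ! i \<in> insert 0 {w \<in> set ts. w < ts ! i}"
        using i sorted_wrt_nth_less[OF assms(1), of "i - 1" i] by (cases i) auto
    qed simp
    then show ?thesis by (simp add: predecessor_def)
  qed
  then have "(\<Prod>i<length ts. (ts ! i - (0 # ts) ! i) powr e) = (\<Prod>i<length ts. (ts ! i - predecessor (set ts) (ts ! i)) powr e)"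
    by simp
  also have "\<dots> = gap_prod e (set ts)"
    unfolding gap_prod_def
  proof (rule prod.reindex_bij_betw)
    show "bij_betw ((!) ts) {..<length ts} (set ts)"
      using assms(1) by (intro bij_betw_nth) (auto simp: strict_sorted_iff)
  qed
  finally show ?thesis .
qed

lemma gap_prod_0: "finite A \<Longrightarrow> (\<And>v. v \<in> A \<Longrightarrow> 0 < v) \<Longrightarrow> gap_prod 0 A = 1"
  unfolding gap_prod_def using predecessor_less[of A] by (intro prod.neutral) force

text \<open>The region where \<open>phi\<close> need not vanish. The index set is arbitrary because
  the integrability proof removes coordinates one by one.\<close>

definition good :: "nat set \<Rightarrow> (nat \<Rightarrow> real) \<Rightarrow> bool" where
  "good I t \<longleftrightarrow> (\<forall>i\<in>I. 0 < t i \<and> t i < 1) \<and> inj_on t I"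

text \<open>All three branches of \<open>phi_sorted\<close> have the shape below, with \<open>e = min \<alpha> 1 - 1\<close>: a positive gap
  raised to the power 0 is 1.\<close>

definition renewal_density :: "real \<Rightarrow> real \<Rightarrow> nat \<Rightarrow> (nat \<Rightarrow> real) \<Rightarrow> real" where
  "renewal_density D e n t = (if good {..<n} t then D ^ n * gap_prod e (t ` {..<n}) else 0)"

text \<open>For \<alpha> < 1 the condition e + 2 H > 1 is \<alpha> + 2 H > 2; otherwise e = 0 and it
  is H > 1/2. Nonnegativity of the constant for \<alpha> < 1 comes from sin (pi \<alpha>) >= 0 on
  (0, 1).\<close>

lemma phi_eq_renewal_density:
  assumes "1 / 2 < H" "H < 1" "\<alpha> > 0" "\<alpha> + 2 * H > 2"
  obtains D e where "D \<ge> 0" "e \<le> 0" "e + 2 * H > 1" "\<And>k. phi H \<alpha> N \<tau> k = renewal_density D e k"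
proof -
  define D where "D = (if \<alpha> < 1 then C_const \<alpha> else if integrable N (\<lambda>\<omega>. real (\<tau> \<omega>))
      then 1 / (LINT \<omega>|N. real (\<tau> \<omega>)) else 1)"
  define e where "e = min \<alpha> 1 - 1"
  have "sin (pi * \<alpha>) \<ge> 0" if "\<alpha> < 1"
    using that assms(3) by (intro sin_ge_zero) auto
  then have D: "D \<ge> 0" using assms(3) by (auto simp: D_def C_const_def)
  have *: "phi H \<alpha> N \<tau> k t = renewal_density D e k t" for k t
  proof (cases "good {..<k} t")
    case True
    define ts where "ts = sort (map t [0..<k])"
    have st: "set ts = t ` {..<k}" "length ts = k" by (auto simp: ts_def lessThan_atLeast0)
    have pos: "0 < v" if "v \<in> set ts" for v using that True unfolding st by (auto simp: good_def)
    have "distinct (map t [0..<k])"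
      using True by (simp add: good_def distinct_map lessThan_atLeast0)
    then have "sorted_wrt (<) ts" by (simp add: ts_def strict_sorted_iff)
    note prod = phi_sorted_prod_eq_gap_prod[OF this pos]
    have "phi H \<alpha> N \<tau> k t = phi_sorted H \<alpha> N \<tau> ts"
      using True by (simp add: phi_def good_def ts_def)
    also have "\<dots> = D ^ k * gap_prod e (set ts)"
    proof (cases "\<alpha> < 1")
      case True
      \<comment> \<open>The first branch of \<open>phi_sorted\<close> applies: \<alpha> > 2 - 2 H
        and H < 1 give 1 - H < \<alpha>.\<close>
      then have "phi_sorted H \<alpha> N \<tau> ts = C_const \<alpha> ^ k * gap_prod (\<alpha> - 1) (set ts)"
        using assms prod[of "\<alpha> - 1"] by (simp add: phi_sorted_def st(2))
      then show ?thesis using True by (simp add: D_def e_def)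
    next
      case False
      then have "e = 0" by (simp add: e_def)
      moreover have "phi_sorted H \<alpha> N \<tau> ts = D ^ k"
        using False by (auto simp: phi_sorted_def D_def st(2))
      ultimately show ?thesis using gap_prod_0[of "set ts"] pos by simp
    qed
    finally show ?thesis using True st by (simp add: renewal_density_def)
  next
    case False
    then show ?thesis by (auto simp: phi_def good_def renewal_density_def)
  qed
  show ?thesis
  proof
    show "D \<ge> 0" "e \<le> 0" "e + 2 * H > 1" using D assms by (auto simp: e_def)
    show "phi H \<alpha> N \<tau> k = renewal_density D e k" for k using * by auto
  qed
qed

lemma renewal_density_nonneg: "D \<ge> 0 \<Longrightarrow> 0 \<le> renewal_density D e n t"
  by (simp add: renewal_density_def)

lemma renewal_density_cong:
  "(\<And>i. i < n \<Longrightarrow> s i = t i) \<Longrightarrow> renewal_density D e n s = renewal_density D e n t"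
proof -
  assume *: "\<And>i. i < n \<Longrightarrow> s i = t i"
  then have "good {..<n} s = good {..<n} t" unfolding good_def inj_on_def by simp
  moreover have "s ` {..<n} = t ` {..<n}" using * by (intro image_cong) auto
  ultimately show ?thesis by (simp add: renewal_density_def)
qed

lemma renewal_density_permute:
  assumes "p permutes {..<n}"
  shows "renewal_density D e n (t \<circ> p) = renewal_density D e n t"
proof -
  have im: "p ` {..<n} = {..<n}" using assms by (rule permutes_image)
  have "good {..<n} (t \<circ> p) = good {..<n} t"
  proof -
    have "inj_on (t \<circ> p) {..<n} \<longleftrightarrow> inj_on t (p ` {..<n})"
      using comp_inj_on_iff[OF permutes_inj_on[OF assms, of "{..<n}"], of t] by simp
    moreover have "(\<forall>i\<in>{..<n}. 0 < t (p i) \<and> t (p i) < 1) \<longleftrightarrow> (\<forall>i\<in>p ` {..<n}. 0 < t i \<and> t i < 1)" by simp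
    ultimately show ?thesis unfolding good_def im by simp
  qed
  moreover have "(t \<circ> p) ` {..<n} = t ` {..<n}" unfolding image_comp[symmetric] im ..
  ultimately show ?thesis by (simp add: renewal_density_def)
qed

text \<open>Injectivity of z on both blocks together is essential: if a point of one block coincided
  with a point of the other, the right side would be 0. Almost every pair of blocks satisfies
  it.\<close>

lemma renewal_density_mult_le:
  assumes D: "D \<ge> 0" and e: "e \<le> 0" and g: "inj_on z {..<p + q}"
  shows "renewal_density D e p z * renewal_density D e q (\<lambda>i. z (p + i)) \<le> renewal_density D e (p + q) z"
proof (cases "good {..<p} z \<and> good {..<q} (\<lambda>i. z (p + i))")
  case True
  have un: "{..<p + q} = {..<p} \<union> (\<lambda>i. p + i) ` {..<q}"
  proof -
    have "x \<in> (\<lambda>i. p + i) ` {..<q}" if "x < p + q" "\<not> x < p" for x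
      using that by (intro image_eqI[of _ _ "x - p"]) auto
    then show ?thesis by auto
  qed
  have G: "good {..<p + q} z" using True g unfolding good_def un by auto
  let ?A = "z ` {..<p}" and ?B = "(\<lambda>i. z (p + i)) ` {..<q}"
  have im: "z ` {..<p + q} = ?A \<union> ?B" unfolding un image_Un by auto
  have disj: "?A \<inter> ?B = {}"
  proof (rule ccontr)
    assume "?A \<inter> ?B \<noteq> {}"
    then obtain i j where "i < p" "j < q" "z i = z (p + j)" by auto
    then show False using inj_onD[OF g, of i "p + j"] by auto
  qed
  have "D ^ p * gap_prod e ?A * (D ^ q * gap_prod e ?B) = D ^ (p + q) * (gap_prod e ?A * gap_prod e ?B)"
    by (simp add: power_add)
  also have "\<dots> \<le> D ^ (p + q) * gap_prod e (?A \<union> ?B)"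
    using True D e disj by (intro mult_left_mono gap_prod_Un) (auto simp: good_def)
  finally show ?thesis using True G by (simp add: renewal_density_def im)
next
  case False
  then show ?thesis using D by (auto simp: renewal_density_def)
qed

section \<open>Measurability and integrability of gap products\<close>

lemma borel_measurable_predecessor:
  assumes "finite I" "\<And>i. i \<in> I \<Longrightarrow> f i \<in> borel_measurable M" "g \<in> borel_measurable M"
  shows "(\<lambda>x. predecessor ((\<lambda>i. f i x) ` I) (g x)) \<in> borel_measurable M"
  using assms
proof (induction I rule: finite_induct)
  case empty
  then show ?case by (simp add: predecessor_def)
next
  case (insert i I)
  then have [measurable]: "f i \<in> borel_measurable M" "g \<in> borel_measurable M"
    "(\<lambda>x. predecessor ((\<lambda>i. f i x) ` I) (g x)) \<in> borel_measurable M" by auto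
  have "predecessor ((\<lambda>i. f i x) ` insert i I) (g x) =
      (if f i x < g x then max (f i x) (predecessor ((\<lambda>i. f i x) ` I) (g x)) else predecessor ((\<lambda>i. f i x) ` I) (g x))" for x
  proof (cases "f i x < g x")
    case True
    have "insert 0 {w \<in> (\<lambda>i. f i x) ` insert i I. w < g x} = insert (f i x) (insert 0 {w \<in> (\<lambda>i. f i x) ` I. w < g x})"
      using True by auto
    then show ?thesis using True insert(1) by (simp add: predecessor_def)
  next
    case False
    have "{w \<in> (\<lambda>i. f i x) ` insert i I. w < g x} = {w \<in> (\<lambda>i. f i x) ` I. w < g x}"
      using False by auto
    then show ?thesis using False by (simp add: predecessor_def)
  qed
  then show ?case by simp
qed

text \<open>It occurs with two exponents: e in the density itself, and e + 2 H - 2 once the kernels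
  have been absorbed into the gaps.\<close>

definition gap_density :: "real \<Rightarrow> nat set \<Rightarrow> (nat \<Rightarrow> real) \<Rightarrow> real" where
  "gap_density e I t = (if good I t then gap_prod e (t ` I) else 0)"

lemma gap_density_alt:
  "gap_density e I t = (if good I t then (\<Prod>i\<in>I. (t i - predecessor (t ` I) (t i)) powr e) else 0)"
  unfolding gap_density_def gap_prod_def by (auto simp: good_def prod.reindex)

lemma good_alt: "good I t \<longleftrightarrow> (\<forall>i\<in>I. 0 < t i \<and> t i < 1) \<and> (\<forall>i\<in>I. \<forall>j\<in>I. t i = t j \<longrightarrow> i = j)"
  by (simp add: good_def inj_on_def)

lemma borel_measurable_gap_density:
  assumes I: "finite I" and f: "\<And>i. i \<in> I \<Longrightarrow> (\<lambda>x. f x i) \<in> borel_measurable M"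
  shows "(\<lambda>x. gap_density e I (f x)) \<in> borel_measurable M"
proof -
  have "Measurable.pred M (\<lambda>x. good I (f x))"
    unfolding good_alt
  proof (intro pred_intros_logic pred_intros_finite I)
    fix i assume i: "i \<in> I"
    note [measurable] = f[OF i]
    show "Measurable.pred M (\<lambda>x. 0 < f x i)" "Measurable.pred M (\<lambda>x. f x i < 1)" by measurable
    fix j assume j: "j \<in> I"
    note [measurable] = f[OF j]
    show "Measurable.pred M (\<lambda>x. f x i = f x j)" by measurable
  qed auto
  moreover have "(\<lambda>x. \<Prod>i\<in>I. (f x i - predecessor (f x ` I) (f x i)) powr e) \<in> borel_measurable M"
    using borel_measurable_predecessor[OF I f f] f by (intro borel_measurable_prod) measurable
  ultimately show ?thesis unfolding gap_density_alt by measurable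
qed

lemma borel_measurable_renewal_density:
  assumes f: "\<And>i. i < n \<Longrightarrow> (\<lambda>x. f x i) \<in> borel_measurable M"
  shows "(\<lambda>x. renewal_density D e n (f x)) \<in> borel_measurable M"
proof -
  have "renewal_density D e n t = D ^ n * gap_density e {..<n} t" for t
    by (simp add: renewal_density_def gap_density_def)
  then show ?thesis using borel_measurable_gap_density[of "{..<n}" f M e] f by simp
qed

text \<open>Induction on the number of coordinates, integrating out the largest one.\<close>

lemma nn_integral_gap_density_finite:
  assumes "finite I" "e > -1"
  shows "(\<integral>\<^sup>+t. ennreal (gap_density e I t) \<partial>Pi\<^sub>M I (\<lambda>_. unit_leb)) < \<infinity>"
  using assms(1)
proof (induction "card I" arbitrary: I)
  case 0
  then have "I = {}" by simp
  then show ?case by (simp add: unit_prod.nn_integral_empty)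
next
  case (Suc n)
  let ?U = "\<lambda>I. Pi\<^sub>M I (\<lambda>_::nat. unit_leb)"
  have meas: "(\<lambda>t. t i) \<in> borel_measurable (?U J)" if "i \<in> J" for i J
    using measurable_compose[OF measurable_component_singleton[OF that] measurable_unit_leb] .
  \<comment> \<open>The domain is covered by pieces according to the index of the largest
    coordinate. At a good point the maximum is strict because the coordinates are distinct.\<close>
  define top where "top i t \<longleftrightarrow> (\<forall>j\<in>I - {i}. t j < t i)" for i and t :: "nat \<Rightarrow> real"
  have top_meas [measurable]: "Measurable.pred (?U I) (top i)" if "i \<in> I" for i
    unfolding top_def
  proof (intro pred_intros_finite)
    fix j assume "j \<in> I - {i}"
    then have [measurable]: "(\<lambda>t. t j) \<in> borel_measurable (?U I)" "(\<lambda>t. t i) \<in> borel_measurable (?U I)"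
      using meas[of j I] meas[of i I] that by simp_all
    show "Measurable.pred (?U I) (\<lambda>t. t j < t i)" by measurable
  qed (use Suc in auto)
  have gd [measurable]: "(\<lambda>t. gap_density e J t) \<in> borel_measurable (?U J)" if "finite J" for J
    by (rule borel_measurable_gap_density) (use that in \<open>auto intro: meas\<close>)
  have ne: "I \<noteq> {}" using Suc by auto
  have ex: "\<exists>i\<in>I. top i t" if "good I t" for t
  proof -
    have "Max (t ` I) \<in> t ` I" using ne Suc(3) by (intro Max_in) auto
    then obtain i where i: "i \<in> I" "Max (t ` I) = t i" by (elim imageE)
    have "t j < t i" if "j \<in> I - {i}" for j
    proof -
      have "t j \<le> t i" using that Suc(3) unfolding i(2)[symmetric] by (intro Max_ge) auto
      moreover have "t j \<noteq> t i" using that i \<open>good I t\<close> inj_onD[of t I j i] by (auto simp: good_def)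
      ultimately show ?thesis by simp
    qed
    then show ?thesis using i by (auto simp: top_def)
  qed
  have "(\<integral>\<^sup>+t. ennreal (gap_density e I t) \<partial>?U I) \<le>
      (\<integral>\<^sup>+t. (\<Sum>i\<in>I. ennreal (gap_density e I t) * indicator {t. top i t} t) \<partial>?U I)"
  proof (intro nn_integral_mono)
    fix t
    show "ennreal (gap_density e I t) \<le> (\<Sum>i\<in>I. ennreal (gap_density e I t) * indicator {t. top i t} t)"
    proof (cases "good I t")
      case True
      then obtain i where i: "i \<in> I" "top i t" using ex by auto
      have "ennreal (gap_density e I t) = ennreal (gap_density e I t) * indicator {t. top i t} t" using i by simp
      also have "\<dots> \<le> (\<Sum>i\<in>I. ennreal (gap_density e I t) * indicator {t. top i t} t)"
        using i Suc(3) by (intro member_le_sum) auto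
      finally show ?thesis .
    qed (simp add: gap_density_def)
  qed
  also have "\<dots> = (\<Sum>i\<in>I. \<integral>\<^sup>+t. ennreal (gap_density e I t) * indicator {t. top i t} t \<partial>?U I)"
  proof (rule nn_integral_sum)
    fix i assume "i \<in> I"
    then have "(\<lambda>t. if top i t then ennreal (gap_density e I t) else 0) \<in> borel_measurable (?U I)"
      using top_meas[of i] gd[of I] Suc(3) by measurable
    then show "(\<lambda>t. ennreal (gap_density e I t) * indicator {t. top i t} t) \<in> borel_measurable (?U I)"
      by (rule measurable_cong[THEN iffD1, rotated]) (simp add: indicator_def)
  qed
  also have "\<dots> < \<infinity>"
  proof -
    have "(\<integral>\<^sup>+t. ennreal (gap_density e I t) * indicator {t. top i t} t \<partial>?U I) < \<infinity>" if i: "i \<in> I" for i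
    proof -
      define J where "J = I - {i}"
      have J: "I = insert i J" "i \<notin> J" "finite J" "card J = n" using i Suc by (auto simp: J_def)
      have m: "(\<lambda>t. ennreal (gap_density e I t) * indicator {t. top i t} t) \<in> borel_measurable (?U I)"
      proof -
        have "(\<lambda>t. if top i t then ennreal (gap_density e I t) else 0) \<in> borel_measurable (?U I)"
          using top_meas[of i] gd[of I] Suc(3) i by measurable
        then show ?thesis
          by (rule measurable_cong[THEN iffD1, rotated]) (simp add: indicator_def)
      qed
      have "(\<integral>\<^sup>+t. ennreal (gap_density e I t) * indicator {t. top i t} t \<partial>?U I) =
         (\<integral>\<^sup>+x. \<integral>\<^sup>+y. ennreal (gap_density e I (x(i := y))) * indicator {t. top i t} (x(i := y)) \<partial>unit_leb \<partial>?U J)"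
        using J m by (subst J(1), subst unit_prod.product_nn_integral_insert) auto
      also have "\<dots> \<le> (\<integral>\<^sup>+x. ennreal (gap_density e J x) * ennreal (1 / (e + 1)) \<partial>?U J)"
      proof (rule nn_integral_mono)
        fix x :: "nat \<Rightarrow> real"
        \<comment> \<open>With the other coordinates fixed, the largest one contributes (y - b) powr
          e on y > b, where b is the largest of the others, or 0 if there are none. Its integral is
          at most 1 / (e + 1), uniformly in b.\<close>
        define b where "b = Max (insert 0 (x ` J))"
        have "b \<ge> 0" unfolding b_def using J by (intro Max_ge) auto
        have "(\<integral>\<^sup>+y. ennreal (gap_density e I (x(i := y))) * indicator {t. top i t} (x(i := y)) \<partial>unit_leb)
           \<le> (\<integral>\<^sup>+y. ennreal (gap_density e J x) * ennreal (if b < y then (y - b) powr e else 0) \<partial>unit_leb)"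
        proof (rule nn_integral_mono)
          fix y
          show "ennreal (gap_density e I (x(i := y))) * indicator {t. top i t} (x(i := y)) \<le>
             ennreal (gap_density e J x) * ennreal (if b < y then (y - b) powr e else 0)"
          proof (cases "good I (x(i := y)) \<and> top i (x(i := y))")
            case True
            have im: "(x(i := y)) ` I = insert y (x ` J)" unfolding J(1) using J(2) by auto
            have lt: "w < y" if "w \<in> x ` J" for w
              using True that J(2) unfolding top_def J_def by auto
            have "0 < y" using True i by (auto simp: good_def)
            then have less: "b < y" unfolding b_def using J lt by (subst Max_less_iff) auto
            have upd: "(x(i := y)) j = x j" if "j \<in> J" for j using that J(2) by auto
            have gJ: "good J x"
            proof -
              have "good J (x(i := y))" using True unfolding J(1) good_def by (auto intro: inj_on_subset)
              moreover have "inj_on (x(i := y)) J = inj_on x J" by (rule inj_on_cong) (rule upd)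
              ultimately show ?thesis using upd unfolding good_def by metis
            qed
            have "gap_prod e ((x(i := y)) ` I) = (y - b) powr e * gap_prod e (x ` J)"
              unfolding im b_def using J lt by (intro gap_prod_insert_max) auto
            then show ?thesis using True gJ less by (simp add: gap_density_def ennreal_mult mult.commute)
          qed (auto simp: gap_density_def)
        qed
        also have "\<dots> = ennreal (gap_density e J x) * (\<integral>\<^sup>+y. ennreal (if b < y then (y - b) powr e else 0) \<partial>unit_leb)"
          by (rule nn_integral_cmult, rule measurable_borel_unit_leb) measurable
        also have "\<dots> \<le> ennreal (gap_density e J x) * ennreal (1 / (e + 1))"
          using assms(2) \<open>b \<ge> 0\<close> by (intro mult_left_mono nn_integral_powr_shift_le) auto
        finally show "(\<integral>\<^sup>+y. ennreal (gap_density e I (x(i := y))) * indicator {t. top i t} (x(i := y)) \<partial>unit_leb)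
           \<le> ennreal (gap_density e J x) * ennreal (1 / (e + 1))" .
      qed
      also have "\<dots> = (\<integral>\<^sup>+x. ennreal (gap_density e J x) \<partial>?U J) * ennreal (1 / (e + 1))"
        using gd[OF J(3)] by (intro nn_integral_multc measurable_compose[OF _ measurable_ennreal])
      also have "\<dots> < \<infinity>"
        using Suc(1)[of J] J by (auto simp: ennreal_mult_less_top)
      finally show ?thesis .
    qed
    then show ?thesis using Suc(3) by simp
  qed
  finally show ?case .
qed

section \<open>Integration over cubes and symmetrization\<close>

text \<open>The complements of S and of its image have the same size, so any bijection between them
  completes the injection. Matchings of selected variables are thus carried to the standard matching
  by a symmetry of the whole cube.\<close>

lemma inj_extends_to_permutation:
  assumes fin: "finite U" and S: "S \<subseteq> U" "inj_on e S" "e ` S \<subseteq> U"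
  obtains p where "p permutes U" "\<And>x. x \<in> S \<Longrightarrow> p x = e x"
proof -
  have "card (U - S) = card (U - e ` S)"
    using fin S by (simp add: card_Diff_subset finite_subset card_image)
  then obtain h where h: "bij_betw h (U - S) (U - e ` S)"
    using fin finite_same_card_bij[of "U - S" "U - e ` S"] by auto
  define p where "p x = (if x \<in> S then e x else if x \<in> U then h x else x)" for x
  have "bij_betw p S (e ` S)" using S(2) by (auto simp: p_def bij_betw_def inj_on_def)
  moreover have "bij_betw p (U - S) (U - e ` S)" using h by (subst bij_betw_cong[of _ _ h]) (auto simp: p_def)
  ultimately have "bij_betw p (S \<union> (U - S)) (e ` S \<union> (U - e ` S))" by (rule bij_betw_combine) auto
  then have "bij_betw p U U" using S by (simp add: Un_absorb1)
  then have "p permutes U" using S by (intro bij_imp_permutes) (auto simp: p_def)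
  then show ?thesis using that by (simp add: p_def)
qed

lemma prod_lessThan_add:
  fixes f :: "nat \<Rightarrow> 'x::comm_monoid_mult"
  shows "(\<Prod>i<a + b. f i) = (\<Prod>i<a. f i) * (\<Prod>i<b. f (a + i))"
  by (induction b) (simp_all add: mult.assoc)

lemma prod_pairs:
  fixes f :: "nat \<Rightarrow> 'x::comm_monoid_mult"
  shows "(\<Prod>i<m. f (2 * i + 1) * f (2 * i)) = (\<Prod>l<2 * m. f l)"
  by (induction m) (simp_all add: ac_simps)

lemma space_cube_iff: "s \<in> space (cube n) \<longleftrightarrow> (\<forall>i<n. s i \<in> {0..1}) \<and> (\<forall>i\<ge>n. s i = undefined)"
  by (auto simp: cube_def space_PiM space_unit_leb PiE_iff extensional_def)

lemma join_in_space: "s \<in> space (cube p) \<Longrightarrow> t \<in> space (cube q) \<Longrightarrow> join p s t \<in> space (cube (p + q))"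
  by (auto simp: space_cube_iff join_def)

lemma measurable_join [measurable (raw)]:
  assumes f: "f \<in> M \<rightarrow>\<^sub>M cube p" and g: "g \<in> M \<rightarrow>\<^sub>M cube q"
  shows "(\<lambda>x. join p (f x) (g x)) \<in> M \<rightarrow>\<^sub>M cube (p + q)"
  unfolding cube_def
proof (rule measurable_PiM_single')
  fix i assume i: "i \<in> {..<p + q}"
  show "(\<lambda>x. join p (f x) (g x) i) \<in> M \<rightarrow>\<^sub>M unit_leb"
  proof (cases "i < p")
    case True
    then show ?thesis using measurable_cube_component[OF f] by (simp add: join_def)
  next
    case False
    then show ?thesis using measurable_cube_component[OF g, of "i - p"] i by (simp add: join_def)
  qed
next
  show "(\<lambda>x. join p (f x) (g x)) \<in> space M \<rightarrow> (\<Pi>\<^sub>E i\<in>{..<p + q}. space unit_leb)"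
    using join_in_space measurable_space[OF f] measurable_space[OF g]
    by (force simp: cube_def space_PiM)
qed

text \<open>Boxes determine the product measure, and the preimage of a box under \<open>join\<close>
  is a product of two boxes. Iterated integrals over blocks of variables become integrals over one
  cube.\<close>

lemma distr_join: "distr (cube p \<Otimes>\<^sub>M cube q) (cube (p + q)) (\<lambda>x. join p (fst x) (snd x)) = cube (p + q)"
  unfolding cube_def[of "p + q"]
proof (rule unit_prod.PiM_eqI)
  fix A :: "nat \<Rightarrow> real set" assume A: "\<And>i. i \<in> {..<p + q} \<Longrightarrow> A i \<in> sets unit_leb"
  have A1: "Pi\<^sub>E {..<p} A \<in> sets (cube p)" "Pi\<^sub>E {..<q} (\<lambda>i. A (p + i)) \<in> sets (cube q)"
    unfolding cube_def using A by (auto intro!: sets_PiM_I_finite)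
  have pre: "(\<lambda>x. join p (fst x) (snd x)) -` Pi\<^sub>E {..<p + q} A \<inter> space (cube p \<Otimes>\<^sub>M cube q) =
      Pi\<^sub>E {..<p} A \<times> Pi\<^sub>E {..<q} (\<lambda>i. A (p + i))" (is "?L = ?R")
  proof (intro set_eqI iffI)
    fix x assume x: "x \<in> ?L"
    then have sp: "fst x \<in> space (cube p)" "snd x \<in> space (cube q)" by (simp_all add: space_pair_measure mem_Times_iff)
    have J: "join p (fst x) (snd x) i \<in> A i" if "i < p + q" for i
      using x that PiE_mem[of "join p (fst x) (snd x)" "{..<p + q}" A i] by simp
    have "fst x i \<in> A i" if "i < p" for i using J[of i] that by (simp add: join_def)
    moreover have "snd x i \<in> A (p + i)" if "i < q" for i using J[of "p + i"] that by (simp add: join_def)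
    ultimately have "fst x \<in> Pi\<^sub>E {..<p} A" "snd x \<in> Pi\<^sub>E {..<q} (\<lambda>i. A (p + i))"
      using sp by (intro PiE_I; simp add: space_cube_iff)+
    then show "x \<in> ?R" by (simp add: mem_Times_iff)
  next
    fix x assume x: "x \<in> ?R"
    then have m: "fst x \<in> Pi\<^sub>E {..<p} A" "snd x \<in> Pi\<^sub>E {..<q} (\<lambda>i. A (p + i))" by (simp_all add: mem_Times_iff)
    have sp: "fst x \<in> space (cube p)" "snd x \<in> space (cube q)"
      using A1[THEN sets.sets_into_space] m by auto
    have "join p (fst x) (snd x) \<in> Pi\<^sub>E {..<p + q} A"
    proof (rule PiE_I)
      fix i assume i: "i \<in> {..<p + q}"
      show "join p (fst x) (snd x) i \<in> A i"
      proof (cases "i < p")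
        case True
        then show ?thesis using PiE_mem[OF m(1), of i] by (simp add: join_def)
      next
        case False
        then show ?thesis using i PiE_mem[OF m(2), of "i - p"] by (simp add: join_def)
      qed
    qed (use sp in \<open>simp add: join_def space_cube_iff\<close>)
    then show "x \<in> ?L" using sp by (simp add: space_pair_measure mem_Times_iff)
  qed
  have "Pi\<^sub>E {..<p + q} A \<in> sets (cube (p + q))"
    unfolding cube_def using A by (auto intro!: sets_PiM_I_finite)
  then have "emeasure (distr (cube p \<Otimes>\<^sub>M cube q) (cube (p + q)) (\<lambda>x. join p (fst x) (snd x))) (Pi\<^sub>E {..<p + q} A) =
      emeasure (cube p \<Otimes>\<^sub>M cube q) (Pi\<^sub>E {..<p} A \<times> Pi\<^sub>E {..<q} (\<lambda>i. A (p + i)))"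
    by (subst emeasure_distr) (simp_all add: pre measurable_join)
  also have "\<dots> = emeasure (cube p) (Pi\<^sub>E {..<p} A) * emeasure (cube q) (Pi\<^sub>E {..<q} (\<lambda>i. A (p + i)))"
    using A1 by (rule cube.emeasure_pair_measure_Times)
  also have "\<dots> = (\<Prod>i<p. emeasure unit_leb (A i)) * (\<Prod>i<q. emeasure unit_leb (A (p + i)))"
    unfolding cube_def using A by (subst (1 2) unit_prod.emeasure_PiM) auto
  finally show "emeasure (distr (cube p \<Otimes>\<^sub>M cube q) (Pi\<^sub>M {..<p + q} (\<lambda>_. unit_leb)) (\<lambda>x. join p (fst x) (snd x))) (Pi\<^sub>E {..<p + q} A)
     = (\<Prod>i\<in>{..<p + q}. emeasure unit_leb (A i))"
    by (simp add: prod_lessThan_add cube_def)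
qed (auto simp: cube_def)

lemma nn_integral_join:
  assumes [measurable]: "F \<in> borel_measurable (cube (p + q))"
  shows "(\<integral>\<^sup>+z. F z \<partial>cube (p + q)) = (\<integral>\<^sup>+s. \<integral>\<^sup>+t. F (join p s t) \<partial>cube q \<partial>cube p)"
proof -
  have "(\<integral>\<^sup>+z. F z \<partial>cube (p + q)) = (\<integral>\<^sup>+x. F (join p (fst x) (snd x)) \<partial>(cube p \<Otimes>\<^sub>M cube q))"
    by (subst distr_join[symmetric], subst nn_integral_distr) measurable
  also have "\<dots> = (\<integral>\<^sup>+s. \<integral>\<^sup>+t. F (join p s t) \<partial>cube q \<partial>cube p)"
    using measurable_compose[OF measurable_join[OF measurable_fst measurable_snd] assms]
    by (subst cube.nn_integral_fst[symmetric]) auto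
  finally show ?thesis .
qed

lemma restrict_permute_eq:
  assumes p: "p permutes {..<n}" and t: "t \<in> space (cube n)"
  shows "(\<lambda>i\<in>{..<n}. t (p i)) = t \<circ> p"
proof
  fix i
  show "(\<lambda>i\<in>{..<n}. t (p i)) i = (t \<circ> p) i"
  proof (cases "i < n")
    case False
    then have "p i = i" by (intro permutes_not_in[OF p]) simp
    then show ?thesis using False t by (simp add: space_cube_iff)
  qed simp
qed

lemma distr_permute:
  assumes p: "p permutes {..<n}"
  shows "distr (cube n) (cube n) (\<lambda>t. t \<circ> p) = cube n"
proof -
  have "distr (cube n) (cube n) (\<lambda>t. \<lambda>i\<in>{..<n}. t (p i)) = cube n"
    unfolding cube_def using p
    by (intro distr_PiM_reindex[where f = p and M = "\<lambda>_. unit_leb"] prob_space_unit_leb)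
       (use permutes_in_image[OF p] in \<open>auto intro: permutes_inj_on\<close>)
  moreover have "distr (cube n) (cube n) (\<lambda>t. \<lambda>i\<in>{..<n}. t (p i)) = distr (cube n) (cube n) (\<lambda>t. t \<circ> p)"
    by (rule distr_cong) (simp_all add: restrict_permute_eq[OF p])
  ultimately show ?thesis by simp
qed

lemma measurable_permute:
  assumes p: "p permutes {..<n}"
  shows "(\<lambda>t. t \<circ> p) \<in> cube n \<rightarrow>\<^sub>M cube n"
proof -
  have "(\<lambda>t. \<lambda>i\<in>{..<n}. t (p i)) \<in> cube n \<rightarrow>\<^sub>M cube n"
    unfolding cube_def using p by (intro measurable_restrict measurable_component_singleton) (simp only: permutes_in_image)
  then show ?thesis by (subst measurable_cong[OF restrict_permute_eq[OF p, symmetric]])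
qed

lemma nn_integral_permute:
  assumes p: "p permutes {..<n}" and F: "F \<in> borel_measurable (cube n)"
  shows "(\<integral>\<^sup>+t. F (t \<circ> p) \<partial>cube n) = (\<integral>\<^sup>+t. F t \<partial>cube n)"
  using nn_integral_distr[OF measurable_permute[OF p], of F] F by (simp add: distr_permute[OF p])

lemma integral_permute:
  assumes p: "p permutes {..<n}" and F: "F \<in> borel_measurable (cube n)"
  shows "(LINT t|cube n. F (t \<circ> p)) = (LINT t|cube n. F t :: real)"
  using integral_distr[OF measurable_permute[OF p] F] by (simp add: distr_permute[OF p])

text \<open>If f is not integrable, the left side is 0 by convention. The inequality thus survives
  at points where a trace or \<open>psi\<close> diverges.\<close>

lemma ennreal_integral_le_nn_integral:
  assumes "\<And>x. 0 \<le> f x"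
  shows "ennreal (LINT x|M. f x) \<le> (\<integral>\<^sup>+x. ennreal (f x) \<partial>M)"
proof (cases "integrable M f")
  case True
  then show ?thesis using assms by (simp add: nn_integral_eq_integral)
qed (simp add: not_integrable_integral_eq)

section \<open>Matchings of the variables and finiteness of their integrals\<close>

locale renewal = hurst +
  fixes D e :: real
  assumes D: "D \<ge> 0" and e: "e \<le> 0" "e + 2 * H > 1"
begin

abbreviation \<rho> :: "nat \<Rightarrow> (nat \<Rightarrow> real) \<Rightarrow> real" where "\<rho> \<equiv> renewal_density D e"

lemma \<rho>_nonneg [simp]: "0 \<le> \<rho> n t" using D by (rule renewal_density_nonneg)

lemma measurable_\<rho> [measurable (raw)]:
  "f \<in> M \<rightarrow>\<^sub>M cube n \<Longrightarrow> (\<lambda>x. \<rho> n (f x)) \<in> borel_measurable M"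
  by (intro borel_measurable_renewal_density borel_measurable_cube_component)

text \<open>\<epsilon> lists the matched positions: pair number i consists of \<epsilon> (2 i) and
  \<epsilon> (2 i + 1).\<close>

definition pair_weight :: "nat \<Rightarrow> (nat \<Rightarrow> nat) \<Rightarrow> (nat \<Rightarrow> real) \<Rightarrow> real" where
  "pair_weight m \<epsilon> z = (\<Prod>i<m. \<kappa> (z (\<epsilon> (2 * i + 1))) (z (\<epsilon> (2 * i))))"

lemma pair_weight_nonneg [simp]: "0 \<le> pair_weight m \<epsilon> z" by (simp add: pair_weight_def prod_nonneg)

lemma measurable_pair_weight:
  assumes "f \<in> M \<rightarrow>\<^sub>M cube n" "\<epsilon> ` {..<2 * m} \<subseteq> {..<n}"
  shows "(\<lambda>x. pair_weight m \<epsilon> (f x)) \<in> borel_measurable M"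
  unfolding pair_weight_def using assms
  by (intro borel_measurable_prod measurable_\<kappa> borel_measurable_cube_component[of f M n]) (auto simp: image_subset_iff)

text \<open>The smaller of the two points is at most the predecessor of the larger one, so the gap
  below the larger point is at most their distance and the exponent 2 H - 2 < 0 reverses this. The
  factor for the smaller point is at least 1, since gaps are at most 1.\<close>

lemma \<kappa>_le_gap:
  assumes z: "good {..<n} z" and ab: "a < n" "b < n" "a \<noteq> b"
  defines "A \<equiv> z ` {..<n}"
  shows "\<kappa> (z a) (z b) \<le> (z a - predecessor A (z a)) powr (2 * H - 2) * (z b - predecessor A (z b)) powr (2 * H - 2)"
proof -
  have fin: "finite A" by (simp add: A_def)
  define g where "g v = (v - predecessor A v) powr (2 * H - 2)" for v
  have pos: "0 < z i" "z i < 1" if "i < n" for i using z that by (auto simp: good_def)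
  have gap: "0 < z i - predecessor A (z i)" "z i - predecessor A (z i) \<le> 1" if "i < n" for i
    using pos[OF that] predecessor_less[OF fin, of "z i"] predecessor_nonneg[OF fin, of "z i"] by auto
  have g1: "1 \<le> g (z i)" if "i < n" for i
    using gap[OF that] H powr_mono2'[of "2 * H - 2" "z i - predecessor A (z i)" 1] by (simp add: g_def)
  have *: "\<kappa> (z a) (z b) \<le> g (z b)" if "a < n" "b < n" "z a < z b" for a b
  proof -
    have "z a \<le> predecessor A (z b)" using that fin by (intro predecessor_ge) (auto simp: A_def)
    then show ?thesis using gap[OF that(2)] H unfolding \<kappa>_def g_def by (intro powr_mono2') auto
  qed
  have "z a \<noteq> z b" using z ab by (auto simp: good_def inj_on_def)
  then consider "z a < z b" | "z b < z a" by linarith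
  then have "\<kappa> (z a) (z b) \<le> g (z a) * g (z b)"
  proof cases
    case 1
    from *[OF ab(1,2) 1] have "1 * \<kappa> (z a) (z b) \<le> g (z a) * g (z b)"
      using g1[OF ab(1)] by (intro mult_mono) auto
    then show ?thesis by simp
  next
    case 2
    from *[OF ab(2,1) 2] have "\<kappa> (z b) (z a) * 1 \<le> g (z a) * g (z b)"
      using g1[OF ab(1)] g1[OF ab(2)] by (intro mult_mono) auto
    then show ?thesis by (simp add: \<kappa>_commute)
  qed
  then show ?thesis by (simp add: g_def)
qed

text \<open>Each variable is in at most one pair, so each gap receives the exponent 2 H - 2 at most
  once. Unmatched variables may be given the same factor, as it is at least 1. The total exponent e
  + 2 H - 2 is still above -1.\<close>

lemma \<rho>_pair_weight_le:
  assumes \<epsilon>: "inj_on \<epsilon> {..<2 * m}" "\<epsilon> ` {..<2 * m} \<subseteq> {..<n}"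
  shows "\<rho> n z * pair_weight m \<epsilon> z \<le> D ^ n * gap_density (e + 2 * H - 2) {..<n} z"
proof (cases "good {..<n} z")
  case True
  let ?A = "z ` {..<n}"
  define g where "g v = (v - predecessor ?A v) powr (2 * H - 2)" for v
  have inj: "inj_on z {..<n}" using True by (simp add: good_def)
  have g1: "1 \<le> g (z i)" if "i < n" for i
  proof -
    have "0 < z i" "z i < 1" using True that by (auto simp: good_def)
    then have "0 < z i - predecessor ?A (z i)" "z i - predecessor ?A (z i) \<le> 1"
      using predecessor_less[of ?A "z i"] predecessor_nonneg[of ?A "z i"] by auto
    then show ?thesis using H powr_mono2'[of "2 * H - 2" "z i - predecessor ?A (z i)" 1] by (simp add: g_def)
  qed
  have lt: "\<epsilon> l < n" if "l < 2 * m" for l using \<epsilon>(2) that by auto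
  have "pair_weight m \<epsilon> z \<le> (\<Prod>i<m. g (z (\<epsilon> (2 * i + 1))) * g (z (\<epsilon> (2 * i))))"
    unfolding pair_weight_def g_def
  proof (intro prod_mono conjI \<kappa>_le_gap[OF True])
    fix i assume "i \<in> {..<m}"
    then show "\<epsilon> (2 * i + 1) < n" "\<epsilon> (2 * i) < n" "\<epsilon> (2 * i + 1) \<noteq> \<epsilon> (2 * i)"
      using lt inj_onD[OF \<epsilon>(1), of "2 * i + 1" "2 * i"] by auto
  qed auto
  also have "\<dots> = (\<Prod>l<2 * m. g (z (\<epsilon> l)))" by (rule prod_pairs)
  also have "\<dots> = (\<Prod>x\<in>\<epsilon> ` {..<2 * m}. g (z x))" using \<epsilon>(1) by (simp add: prod.reindex)
  also have "\<dots> \<le> (\<Prod>x<n. g (z x))"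
    using \<epsilon>(2) g1 by (intro prod_mono2) (auto intro: order_trans[OF zero_le_one])
  also have "\<dots> = gap_prod (2 * H - 2) ?A"
    unfolding gap_prod_def g_def using inj by (simp add: prod.reindex)
  finally have "gap_prod e ?A * pair_weight m \<epsilon> z \<le> gap_prod e ?A * gap_prod (2 * H - 2) ?A"
    by (intro mult_left_mono) auto
  also have "\<dots> = gap_prod (e + (2 * H - 2)) ?A"
    unfolding gap_prod_def by (simp add: powr_add prod.distrib)
  finally have "D ^ n * (gap_prod e ?A * pair_weight m \<epsilon> z) \<le> D ^ n * gap_prod (e + 2 * H - 2) ?A"
    using D by (intro mult_left_mono) (auto simp: add_diff_eq)
  then show ?thesis using True by (simp add: renewal_density_def gap_density_def mult.assoc)
qed (simp add: renewal_density_def gap_density_def)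

definition paired :: "nat \<Rightarrow> nat \<Rightarrow> (nat \<Rightarrow> nat) \<Rightarrow> ennreal" where
  "paired n m \<epsilon> = (\<integral>\<^sup>+z. ennreal (\<rho> n z * pair_weight m \<epsilon> z) \<partial>cube n)"

lemma paired_finite:
  assumes \<epsilon>: "inj_on \<epsilon> {..<2 * m}" "\<epsilon> ` {..<2 * m} \<subseteq> {..<n}"
  shows "paired n m \<epsilon> < \<infinity>"
proof -
  have "paired n m \<epsilon> \<le> (\<integral>\<^sup>+z. ennreal (D ^ n) * ennreal (gap_density (e + 2 * H - 2) {..<n} z) \<partial>cube n)"
    unfolding paired_def using \<rho>_pair_weight_le[OF \<epsilon>] D
    by (intro nn_integral_mono) (auto simp: ennreal_mult'[symmetric] intro!: ennreal_leI)
  also have "\<dots> = ennreal (D ^ n) * (\<integral>\<^sup>+z. ennreal (gap_density (e + 2 * H - 2) {..<n} z) \<partial>cube n)"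
  proof (rule nn_integral_cmult)
    show "(\<lambda>z. ennreal (gap_density (e + 2 * H - 2) {..<n} z)) \<in> borel_measurable (cube n)"
      using borel_measurable_gap_density[of "{..<n}" "\<lambda>z. z" "cube n"] by (auto intro!: measurable_compose[OF _ measurable_ennreal])
  qed
  also have "\<dots> < \<infinity>"
    using nn_integral_gap_density_finite[of "{..<n}" "e + 2 * H - 2"] e
    by (simp add: cube_def ennreal_mult_less_top)
  finally show ?thesis .
qed

text \<open>The density is symmetric and the cube is invariant under permutations, so only the
  number of pairs counts, not which variables they join.\<close>

lemma paired_eq_id:
  assumes \<epsilon>: "inj_on \<epsilon> {..<2 * m}" "\<epsilon> ` {..<2 * m} \<subseteq> {..<n}" and mn: "2 * m \<le> n"
  shows "paired n m \<epsilon> = paired n m (\<lambda>i. i)"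
proof -
  obtain p where p: "p permutes {..<n}" "\<And>x. x \<in> {..<2 * m} \<Longrightarrow> p x = \<epsilon> x"
    using inj_extends_to_permutation[of "{..<n}" "{..<2 * m}" \<epsilon>] \<epsilon> mn by auto
  have "pair_weight m (\<lambda>i. i) (z \<circ> p) = pair_weight m \<epsilon> z" for z
    unfolding pair_weight_def using p(2) by (intro prod.cong) auto
  then have "paired n m \<epsilon> = (\<integral>\<^sup>+z. ennreal (\<rho> n (z \<circ> p) * pair_weight m (\<lambda>i. i) (z \<circ> p)) \<partial>cube n)"
    unfolding paired_def by (simp add: renewal_density_permute[OF p(1)])
  also have "\<dots> = paired n m (\<lambda>i. i)"
  proof -
    have [measurable]: "(\<lambda>z. pair_weight m (\<lambda>i. i) z) \<in> borel_measurable (cube n)"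
      by (rule measurable_pair_weight) (use mn in auto)
    show ?thesis unfolding paired_def
      by (rule nn_integral_permute[OF p(1), of "\<lambda>z. ennreal (\<rho> n z * pair_weight m (\<lambda>i. i) z)"]) measurable
  qed
  finally show ?thesis .
qed

section \<open>The functions psi, their traces and their majorants\<close>

definition psi_kernel :: "nat \<Rightarrow> nat \<Rightarrow> (nat \<Rightarrow> real) \<Rightarrow> real" where
  "psi_kernel m k t = (LINT u|cube k. \<rho> (m + k) (join m t u))"

text \<open>Same integral with values in \<open>ennreal\<close>: infinite where it diverges, whereas
  \<open>psi_kernel\<close> is 0 there. Tonelli applies to it directly, and the two agree almost
  everywhere.\<close>

definition psi_majorant :: "nat \<Rightarrow> nat \<Rightarrow> (nat \<Rightarrow> real) \<Rightarrow> ennreal" where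
  "psi_majorant m k t = (\<integral>\<^sup>+u. ennreal (\<rho> (m + k) (join m t u)) \<partial>cube k)"

lemma psi_kernel_nonneg [simp]: "0 \<le> psi_kernel m k t"
  unfolding psi_kernel_def by (intro Bochner_Integration.integral_nonneg) simp

lemma ennreal_psi_kernel_le: "ennreal (psi_kernel m k t) \<le> psi_majorant m k t"
  unfolding psi_kernel_def psi_majorant_def by (rule ennreal_integral_le_nn_integral) simp

lemma measurable_psi_kernel [measurable]: "psi_kernel m k \<in> borel_measurable (cube m)"
proof -
  have "(\<lambda>(t, u). \<rho> (m + k) (join m t u)) \<in> borel_measurable (cube m \<Otimes>\<^sub>M cube k)"
    unfolding split_beta' by measurable
  then show ?thesis unfolding psi_kernel_def by (rule cube.borel_measurable_lebesgue_integral)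
qed

lemma measurable_psi_majorant [measurable]: "psi_majorant m k \<in> borel_measurable (cube m)"
proof -
  have "(\<lambda>(t, u). ennreal (\<rho> (m + k) (join m t u))) \<in> borel_measurable (cube m \<Otimes>\<^sub>M cube k)"
    unfolding split_beta' by measurable
  then show ?thesis unfolding psi_majorant_def by (rule cube.borel_measurable_nn_integral)
qed

lemma nn_integral_psi_majorant: "(\<integral>\<^sup>+t. psi_majorant m k t \<partial>cube m) = paired (m + k) 0 (\<lambda>i. i)"
  unfolding psi_majorant_def paired_def pair_weight_def by (subst nn_integral_join) auto

lemma psi_kernel_eq_psi_majorant_AE: "AE t in cube m. ennreal (psi_kernel m k t) = psi_majorant m k t"
proof -
  have "(\<integral>\<^sup>+t. psi_majorant m k t \<partial>cube m) \<noteq> \<infinity>"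
    using paired_finite[of "\<lambda>i. i" 0 "m + k"] by (simp add: nn_integral_psi_majorant)
  then have "AE t in cube m. psi_majorant m k t \<noteq> \<infinity>" by (intro nn_integral_PInf_AE) auto
  then show ?thesis using AE_space
  proof eventually_elim
    case (elim t)
    have "integrable (cube k) (\<lambda>u. \<rho> (m + k) (join m t u))"
      using elim by (intro integrableI_nonneg) (auto simp: psi_majorant_def less_top)
    then show ?case unfolding psi_kernel_def psi_majorant_def by (simp add: nn_integral_eq_integral)
  qed
qed

lemma psi_kernel_permute:
  assumes p: "p permutes {..<m}"
  shows "psi_kernel m k (t \<circ> p) = psi_kernel m k t"
proof -
  have p': "p permutes {..<m + k}" using p by (rule permutes_subset) auto
  have "join m (t \<circ> p) u = join m t u \<circ> p" for u
    using permutes_in_image[OF p] permutes_not_in[OF p] by (auto simp: join_def fun_eq_iff)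
  then show ?thesis unfolding psi_kernel_def by (simp add: renewal_density_permute[OF p'])
qed

text \<open>Indexed by the number n of variables that remain after the trace, which avoids the
  truncated difference m - 2 j.\<close>

definition trace_psi :: "nat \<Rightarrow> nat \<Rightarrow> nat \<Rightarrow> (nat \<Rightarrow> real) \<Rightarrow> real" where
  "trace_psi j n k = frac_trace H j (psi_kernel (2 * j + n) k)"

lemma trace_integrand_psi_kernel:
  "trace_integrand H j (psi_kernel m k) t s = psi_kernel m k (join (2 * j) s t) * pair_weight j (\<lambda>i. i) s"
  by (simp add: trace_integrand_def pair_weight_def \<kappa>_def)

lemma trace_psi_eq: "trace_psi j n k t = (LINT s|cube (2 * j). psi_kernel (2 * j + n) k (join (2 * j) s t) * pair_weight j (\<lambda>i. i) s)"
  by (simp add: trace_psi_def frac_trace_def trace_integrand_psi_kernel)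

lemma trace_psi_nonneg [simp]: "0 \<le> trace_psi j n k t"
  unfolding trace_psi_eq by (intro Bochner_Integration.integral_nonneg) simp

lemma measurable_pair_weight_id [measurable (raw)]:
  "f \<in> M \<rightarrow>\<^sub>M cube (2 * j) \<Longrightarrow> (\<lambda>x. pair_weight j (\<lambda>i. i) (f x)) \<in> borel_measurable M"
  by (rule measurable_pair_weight) auto

lemma measurable_trace_psi [measurable]: "trace_psi j n k \<in> borel_measurable (cube n)"
proof -
  have "(\<lambda>(t, s). psi_kernel (2 * j + n) k (join (2 * j) s t) * pair_weight j (\<lambda>i. i) s) \<in> borel_measurable (cube n \<Otimes>\<^sub>M cube (2 * j))"
    unfolding split_beta' by measurable
  then have "(\<lambda>t. LINT s|cube (2 * j). psi_kernel (2 * j + n) k (join (2 * j) s t) * pair_weight j (\<lambda>i. i) s) \<in> borel_measurable (cube n)"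
    by (rule cube.borel_measurable_lebesgue_integral)
  then show ?thesis by (simp add: trace_psi_eq[abs_def])
qed

lemma trace_psi_permute:
  assumes p: "p permutes {..<n}"
  shows "trace_psi j n k (t \<circ> p) = trace_psi j n k t"
proof -
  \<comment> \<open>p acts on the free variables. In the argument of \<open>psi_kernel\<close> these
    come after the 2 j traced ones, so p is shifted and the first block stays fixed.\<close>
  define q where "q i = (if i < 2 * j then i else 2 * j + p (i - 2 * j))" for i
  have pin: "p x < n \<longleftrightarrow> x < n" for x using permutes_in_image[OF p, of x] by simp
  define r where "r i = (if i < 2 * j then i else 2 * j + inv p (i - 2 * j))" for i
  have inv: "inv p x < n \<longleftrightarrow> x < n" for x using permutes_in_image[OF permutes_inv[OF p], of x] by simp
  have "bij_betw q {..<2 * j + n} {..<2 * j + n}"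
  proof (rule bij_betwI[where g = r])
    show "q \<in> {..<2 * j + n} \<rightarrow> {..<2 * j + n}"
    proof
      fix i assume i: "i \<in> {..<2 * j + n}"
      show "q i \<in> {..<2 * j + n}" using pin[of "i - 2 * j"] i by (cases "i < 2 * j") (simp_all add: q_def)
    qed
    show "r \<in> {..<2 * j + n} \<rightarrow> {..<2 * j + n}"
    proof
      fix i assume i: "i \<in> {..<2 * j + n}"
      show "r i \<in> {..<2 * j + n}" using inv[of "i - 2 * j"] i by (cases "i < 2 * j") (simp_all add: r_def)
    qed
    show "r (q i) = i" for i by (cases "i < 2 * j") (simp_all add: q_def r_def permutes_inverses[OF p])
    show "q (r i) = i" for i by (cases "i < 2 * j") (simp_all add: q_def r_def permutes_inverses[OF p])
  qed
  moreover have "q i = i" if "i \<notin> {..<2 * j + n}" for i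
    using permutes_not_in[OF p, of "i - 2 * j"] that by (simp add: q_def)
  ultimately have q: "q permutes {..<2 * j + n}" by (rule bij_imp_permutes)
  have "join (2 * j) s (t \<circ> p) = join (2 * j) s t \<circ> q" for s
    by (auto simp: join_def fun_eq_iff q_def)
  then show ?thesis unfolding trace_psi_eq by (simp add: psi_kernel_permute[OF q])
qed

definition trace_majorant :: "nat \<Rightarrow> nat \<Rightarrow> nat \<Rightarrow> (nat \<Rightarrow> real) \<Rightarrow> ennreal" where
  "trace_majorant j n k t = (\<integral>\<^sup>+s. psi_majorant (2 * j + n) k (join (2 * j) s t) * ennreal (pair_weight j (\<lambda>i. i) s) \<partial>cube (2 * j))"

lemma measurable_trace_majorant [measurable]: "trace_majorant j n k \<in> borel_measurable (cube n)"
proof -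
  have "(\<lambda>(t, s). psi_majorant (2 * j + n) k (join (2 * j) s t) * ennreal (pair_weight j (\<lambda>i. i) s)) \<in> borel_measurable (cube n \<Otimes>\<^sub>M cube (2 * j))"
    unfolding split_beta' by measurable
  then show ?thesis unfolding trace_majorant_def by (rule cube.borel_measurable_nn_integral)
qed

lemma nn_integral_trace_le_trace_majorant:
  "(\<integral>\<^sup>+s. ennreal (psi_kernel (2 * j + n) k (join (2 * j) s t) * pair_weight j (\<lambda>i. i) s) \<partial>cube (2 * j)) \<le> trace_majorant j n k t"
  unfolding trace_majorant_def
proof (rule nn_integral_mono)
  fix s
  show "ennreal (psi_kernel (2 * j + n) k (join (2 * j) s t) * pair_weight j (\<lambda>i. i) s)
     \<le> psi_majorant (2 * j + n) k (join (2 * j) s t) * ennreal (pair_weight j (\<lambda>i. i) s)"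
    by (simp add: ennreal_mult mult_right_mono ennreal_psi_kernel_le)
qed

lemma ennreal_trace_psi_le: "ennreal (trace_psi j n k t) \<le> trace_majorant j n k t"
  unfolding trace_psi_eq by (rule order_trans[OF ennreal_integral_le_nn_integral nn_integral_trace_le_trace_majorant]) simp

text \<open>The free variables of the trace: they lie between the 2 j traced variables and the k
  variables integrated out in \<open>psi\<close>.\<close>

definition mid :: "nat \<Rightarrow> nat \<Rightarrow> (nat \<Rightarrow> real) \<Rightarrow> nat \<Rightarrow> real" where
  "mid j n z = (\<lambda>l\<in>{..<n}. z (2 * j + l))"

lemma measurable_mid [measurable]: "mid j n \<in> cube (2 * j + n + k) \<rightarrow>\<^sub>M cube n"
  unfolding cube_def mid_def by (intro measurable_restrict measurable_component_singleton) auto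

lemma mid_join:
  "x \<in> space (cube n) \<Longrightarrow> mid j n (join (2 * j + n) (join (2 * j) a x) u) = x"
  by (auto simp: mid_def join_def space_cube_iff fun_eq_iff)

text \<open>By Tonelli the traced, free and integrated variables become a single point z, from which
  \<open>mid\<close> recovers the free ones. With h = 1 this gives finiteness of the trace almost
  everywhere; used once in each argument it unfolds the energy.\<close>

lemma trace_majorant_integral:
  assumes [measurable]: "h \<in> borel_measurable (cube n)"
  shows "(\<integral>\<^sup>+x. trace_majorant j n k x * h x \<partial>cube n) =
    (\<integral>\<^sup>+z. ennreal (\<rho> (2 * j + n + k) z * pair_weight j (\<lambda>i. i) z) * h (mid j n z) \<partial>cube (2 * j + n + k))"
proof -
  let ?r = "\<lambda>a x u. ennreal (\<rho> (2 * j + n + k) (join (2 * j + n) (join (2 * j) a x) u))"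
  have [measurable]: "(\<lambda>z. pair_weight j (\<lambda>i. i) z) \<in> borel_measurable (cube (2 * j + n + k))"
    by (rule measurable_pair_weight[where n = "2 * j + n + k"]) auto
  interpret S: pair_sigma_finite "cube (2 * j)" "cube n" by (rule pair_sigma_finite_cube)
  have pair_weight: "pair_weight j (\<lambda>i. i) (join (2 * j + n) (join (2 * j) a x) u) = pair_weight j (\<lambda>i. i) a" for a x u
    unfolding pair_weight_def by (intro prod.cong) (auto simp: join_def)
  have "(\<integral>\<^sup>+z. ennreal (\<rho> (2 * j + n + k) z * pair_weight j (\<lambda>i. i) z) * h (mid j n z) \<partial>cube (2 * j + n + k)) =
      (\<integral>\<^sup>+y. \<integral>\<^sup>+u. ennreal (\<rho> (2 * j + n + k) (join (2 * j + n) y u) * pair_weight j (\<lambda>i. i) (join (2 * j + n) y u)) *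
         h (mid j n (join (2 * j + n) y u)) \<partial>cube k \<partial>cube (2 * j + n))"
    by (rule nn_integral_join) measurable
  also have "\<dots> = (\<integral>\<^sup>+a. \<integral>\<^sup>+x. \<integral>\<^sup>+u. ennreal (\<rho> (2 * j + n + k) (join (2 * j + n) (join (2 * j) a x) u) *
        pair_weight j (\<lambda>i. i) (join (2 * j + n) (join (2 * j) a x) u)) *
         h (mid j n (join (2 * j + n) (join (2 * j) a x) u)) \<partial>cube k \<partial>cube n \<partial>cube (2 * j))"
    by (rule nn_integral_join) measurable
  also have "\<dots> = (\<integral>\<^sup>+a. \<integral>\<^sup>+x. \<integral>\<^sup>+u. ?r a x u * (ennreal (pair_weight j (\<lambda>i. i) a) * h x) \<partial>cube k \<partial>cube n \<partial>cube (2 * j))"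
    by (intro nn_integral_cong) (simp add: pair_weight mid_join ennreal_mult mult.assoc)
  also have "\<dots> = (\<integral>\<^sup>+a. \<integral>\<^sup>+x. psi_majorant (2 * j + n) k (join (2 * j) a x) * (ennreal (pair_weight j (\<lambda>i. i) a) * h x) \<partial>cube n \<partial>cube (2 * j))"
    unfolding psi_majorant_def by (intro nn_integral_cong nn_integral_multc) measurable
  also have "\<dots> = (\<integral>\<^sup>+x. \<integral>\<^sup>+a. psi_majorant (2 * j + n) k (join (2 * j) a x) * (ennreal (pair_weight j (\<lambda>i. i) a) * h x) \<partial>cube (2 * j) \<partial>cube n)"
    by (rule S.Fubini'[symmetric]) measurable
  also have "\<dots> = (\<integral>\<^sup>+x. trace_majorant j n k x * h x \<partial>cube n)"
  proof (rule nn_integral_cong)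
    fix x assume [measurable]: "x \<in> space (cube n)"
    show "(\<integral>\<^sup>+a. psi_majorant (2 * j + n) k (join (2 * j) a x) * (ennreal (pair_weight j (\<lambda>i. i) a) * h x) \<partial>cube (2 * j)) = trace_majorant j n k x * h x"
      unfolding trace_majorant_def mult.assoc[symmetric] by (rule nn_integral_multc) measurable
  qed
  finally show ?thesis ..
qed

lemma trace_majorant_finite: "(\<integral>\<^sup>+x. trace_majorant j n k x \<partial>cube n) < \<infinity>"
proof -
  have "(\<integral>\<^sup>+x. trace_majorant j n k x \<partial>cube n) = paired (2 * j + n + k) j (\<lambda>i. i)"
    using trace_majorant_integral[of "\<lambda>_. 1" n j k] by (simp add: paired_def)
  then show ?thesis using paired_finite[of "\<lambda>i. i" j "2 * j + n + k"] by (auto simp: inj_on_def)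
qed

lemma integrable_trace_AE:
  "AE t in cube n. integrable (cube (2 * j)) (trace_integrand H j (psi_kernel (2 * j + n) k) t)"
proof -
  have "AE t in cube n. trace_majorant j n k t \<noteq> \<infinity>"
    using trace_majorant_finite[of n j k] by (intro nn_integral_PInf_AE) auto
  then show ?thesis using AE_space
  proof eventually_elim
    case (elim t)
    have "integrable (cube (2 * j)) (\<lambda>s. psi_kernel (2 * j + n) k (join (2 * j) s t) * pair_weight j (\<lambda>i. i) s)"
    proof (rule integrableI_nonneg)
      show "(\<integral>\<^sup>+s. ennreal (psi_kernel (2 * j + n) k (join (2 * j) s t) * pair_weight j (\<lambda>i. i) s) \<partial>cube (2 * j)) < \<infinity>"
        using nn_integral_trace_le_trace_majorant[where j = j and n = n and k = k and t = t] elim(1) by (auto simp: less_top[symmetric] top_unique)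
    qed (use elim in measurable)
    then show ?case by (simp add: trace_integrand_psi_kernel[abs_def])
  qed
qed

lemma integrable_trace_psi: "integrable (cube n) (trace_psi j n k)"
proof (rule integrableI_nonneg)
  have "(\<integral>\<^sup>+t. ennreal (trace_psi j n k t) \<partial>cube n) \<le> (\<integral>\<^sup>+t. trace_majorant j n k t \<partial>cube n)"
    by (intro nn_integral_mono ennreal_trace_psi_le)
  then show "(\<integral>\<^sup>+t. ennreal (trace_psi j n k t) \<partial>cube n) < \<infinity>" using trace_majorant_finite[of n j k] by (rule le_less_trans)
qed auto

end

section \<open>The trace inequality\<close>

context renewal
begin

lemma good_join:
  assumes "good {..<p} s" "good {..<q} t" "\<And>i l. i < q \<Longrightarrow> l < p \<Longrightarrow> t i \<noteq> s l"
  shows "inj_on (join p s t) {..<p + q}"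
proof (rule inj_onI)
  fix x y assume xy: "x \<in> {..<p + q}" "y \<in> {..<p + q}" "join p s t x = join p s t y"
  consider "x < p" "y < p" | "x < p" "\<not> y < p" | "\<not> x < p" "y < p" | "\<not> x < p" "\<not> y < p" by blast
  then show "x = y"
  proof cases
    case 1
    then show ?thesis using assms(1) xy inj_onD[of s "{..<p}" x y] by (simp add: join_def good_def)
  next
    case 2
    then have "y - p < q" using xy by auto
    then show ?thesis using assms(3)[of "y - p" x] xy 2 by (simp add: join_def)
  next
    case 3
    then have "x - p < q" using xy by auto
    then show ?thesis using assms(3)[of "x - p" y] xy 3 by (simp add: join_def)
  next
    case 4
    then have "x - p = y - p"
      using assms(2) xy inj_onD[of t "{..<q}" "x - p" "y - p"] by (simp add: join_def good_def)
    then show ?thesis using 4 by simp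
  qed
qed

lemma \<rho>_mult_le_join:
  assumes "\<And>i l. i < q \<Longrightarrow> l < p \<Longrightarrow> t i \<noteq> s l"
  shows "\<rho> p s * \<rho> q t \<le> \<rho> (p + q) (join p s t)"
proof (cases "good {..<p} s \<and> good {..<q} t")
  case True
  have "\<rho> p (join p s t) = \<rho> p s" by (rule renewal_density_cong) (simp add: join_def)
  moreover have "(\<lambda>i. join p s t (p + i)) = t" by (simp add: join_def)
  ultimately show ?thesis
    using renewal_density_mult_le[OF D e(1) good_join[of p s q t]] True assms by simp
qed (use \<rho>_nonneg[of "p + q" "join p s t"] in \<open>auto simp: renewal_density_def\<close>)

lemma AE_cube_cross:
  fixes p :: nat
  shows "AE t in cube q. \<forall>i<q. \<forall>l<p. t i \<noteq> s l"
proof -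
  have "AE t in cube q. \<forall>l\<in>{..<p}. \<forall>i<q. t i \<noteq> s l"
    by (rule AE_finite_allI) (auto intro: AE_cube_neq)
  then show ?thesis by eventually_elim auto
qed

text \<open>A matching of the variables of \<open>join N z1 z2\<close>: \<open>j\<close> pairs inside \<open>z1\<close>, \<open>j\<close> pairs inside \<open>z2\<close>, and
  the remaining traced variables of \<open>z1\<close> with those of \<open>z2\<close>.\<close>

definition cross_pairing :: "nat \<Rightarrow> nat \<Rightarrow> nat \<Rightarrow> nat" where
  "cross_pairing j N r = (if r < 2 * j then r else if r < 4 * j then N + (r - 2 * j)
     else if odd r then 2 * j + (r - 4 * j) div 2 else N + 2 * j + (r - 4 * j) div 2)"

lemma inj_cross_pairing:
  assumes "2 * j + n \<le> N"
  shows "inj_on (cross_pairing j N) {..<2 * (2 * j + n)}"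
    and "cross_pairing j N ` {..<2 * (2 * j + n)} \<subseteq> {..<N + N}"
proof -
  show "inj_on (cross_pairing j N) {..<2 * (2 * j + n)}"
  proof (rule inj_onI)
    fix x y assume "x \<in> {..<2 * (2 * j + n)}" "y \<in> {..<2 * (2 * j + n)}" "cross_pairing j N x = cross_pairing j N y"
    then show "x = y" using assms unfolding cross_pairing_def
      by (auto split: if_splits elim!: oddE evenE)
  qed
  show "cross_pairing j N ` {..<2 * (2 * j + n)} \<subseteq> {..<N + N}"
    using assms by (auto simp: cross_pairing_def elim!: oddE evenE)
qed

lemma pair_weight_cross_pairing:
  assumes "2 * j + n \<le> N"
  shows "pair_weight (2 * j + n) (cross_pairing j N) (join N z1 z2) =
    pair_weight j (\<lambda>i. i) z1 * pair_weight j (\<lambda>i. i) z2 * frac_kernel H n (mid j n z1) (mid j n z2)"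
proof -
  let ?f = "\<lambda>i. \<kappa> (join N z1 z2 (cross_pairing j N (2 * i + 1))) (join N z1 z2 (cross_pairing j N (2 * i)))"
  have "pair_weight (2 * j + n) (cross_pairing j N) (join N z1 z2) = (\<Prod>i<j + j + n. ?f i)"
    by (simp add: pair_weight_def mult_2)
  also have "\<dots> = (\<Prod>i<j. ?f i) * (\<Prod>i<j. ?f (j + i)) * (\<Prod>i<n. ?f (j + j + i))"
    by (simp only: prod_lessThan_add)
  also have "(\<Prod>i<j. ?f i) = pair_weight j (\<lambda>i. i) z1"
    unfolding pair_weight_def using assms by (intro prod.cong) (auto simp: cross_pairing_def join_def)
  also have "(\<Prod>i<j. ?f (j + i)) = pair_weight j (\<lambda>i. i) z2"
    unfolding pair_weight_def
  proof (intro prod.cong refl)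
    fix i assume "i \<in> {..<j}"
    then have "cross_pairing j N (2 * (j + i) + 1) = N + (2 * i + 1)" "cross_pairing j N (2 * (j + i)) = N + 2 * i"
      by (auto simp: cross_pairing_def)
    then show "?f (j + i) = \<kappa> (z2 (2 * i + 1)) (z2 (2 * i))" by (simp add: join_def)
  qed
  also have "(\<Prod>i<n. ?f (j + j + i)) = frac_kernel H n (mid j n z1) (mid j n z2)"
    unfolding frac_kernel_eq
  proof (intro prod.cong refl)
    fix i assume i: "i \<in> {..<n}"
    have "cross_pairing j N (2 * (j + j + i) + 1) = 2 * j + i" "cross_pairing j N (2 * (j + j + i)) = N + (2 * j + i)"
      by (auto simp: cross_pairing_def)
    then show "?f (j + j + i) = \<kappa> (mid j n z1 i) (mid j n z2 i)" using i assms by (simp add: join_def mid_def)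
  qed
  finally show ?thesis .
qed

lemma energy_form_trace_majorant:
  fixes j n k :: nat
  defines "N \<equiv> 2 * j + n + k"
  defines "R \<equiv> \<lambda>z. ennreal (\<rho> N z * pair_weight j (\<lambda>i. i) z)"
  shows "energy_form n (trace_majorant j n k) (trace_majorant j n k) =
    (\<integral>\<^sup>+z1. \<integral>\<^sup>+z2. R z1 * R z2 * ennreal (frac_kernel H n (mid j n z1) (mid j n z2)) \<partial>cube N \<partial>cube N)"
proof -
  let ?K = "\<lambda>x y. ennreal (frac_kernel H n x y)"
  have [measurable]: "(\<lambda>z. pair_weight j (\<lambda>i. i) z) \<in> borel_measurable (cube N)"
    by (rule measurable_pair_weight[where n = N]) (auto simp: N_def)
  have R [measurable]: "R \<in> borel_measurable (cube N)" unfolding R_def by measurable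
  have [measurable]: "mid j n \<in> cube N \<rightarrow>\<^sub>M cube n" unfolding N_def by measurable
  define h where "h x = (\<integral>\<^sup>+y. trace_majorant j n k y * ?K x y \<partial>cube n)" for x
  have h_meas [measurable]: "h \<in> borel_measurable (cube n)"
  proof -
    have "(\<lambda>(x, y). trace_majorant j n k y * ?K x y) \<in> borel_measurable (cube n \<Otimes>\<^sub>M cube n)"
      unfolding split_beta' by measurable
    then show ?thesis unfolding h_def by (rule cube.borel_measurable_nn_integral)
  qed
  have "energy_form n (trace_majorant j n k) (trace_majorant j n k) = (\<integral>\<^sup>+x. trace_majorant j n k x * h x \<partial>cube n)"
    unfolding energy_form_def h_def
  proof (intro nn_integral_cong)
    fix x assume [measurable]: "x \<in> space (cube n)"
    show "(\<integral>\<^sup>+t. trace_majorant j n k x * trace_majorant j n k t * ?K x t \<partial>cube n) = trace_majorant j n k x * (\<integral>\<^sup>+y. trace_majorant j n k y * ?K x y \<partial>cube n)"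
      unfolding mult.assoc by (rule nn_integral_cmult) measurable
  qed
  also have "\<dots> = (\<integral>\<^sup>+z. R z * h (mid j n z) \<partial>cube N)"
    unfolding R_def N_def by (rule trace_majorant_integral) measurable
  also have "\<dots> = (\<integral>\<^sup>+z1. R z1 * (\<integral>\<^sup>+z2. R z2 * ?K (mid j n z1) (mid j n z2) \<partial>cube N) \<partial>cube N)"
  proof (intro nn_integral_cong arg_cong2[where f = times] refl)
    fix z1 assume z1: "z1 \<in> space (cube N)"
    then have [measurable]: "mid j n z1 \<in> space (cube n)" using measurable_space[OF measurable_mid] by (simp add: N_def)
    show "h (mid j n z1) = (\<integral>\<^sup>+z2. R z2 * ?K (mid j n z1) (mid j n z2) \<partial>cube N)"
      unfolding h_def R_def N_def by (rule trace_majorant_integral) measurable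
  qed
  also have "\<dots> = (\<integral>\<^sup>+z1. \<integral>\<^sup>+z2. R z1 * R z2 * ?K (mid j n z1) (mid j n z2) \<partial>cube N \<partial>cube N)"
  proof (intro nn_integral_cong)
    fix z1 assume z1: "z1 \<in> space (cube N)"
    then have [measurable]: "mid j n z1 \<in> space (cube n)" using measurable_space[OF measurable_mid] by (simp add: N_def)
    show "R z1 * (\<integral>\<^sup>+z2. R z2 * ?K (mid j n z1) (mid j n z2) \<partial>cube N) =
        (\<integral>\<^sup>+z2. R z1 * R z2 * ?K (mid j n z1) (mid j n z2) \<partial>cube N)"
      unfolding mult.assoc by (rule nn_integral_cmult[symmetric]) measurable
  qed
  finally show ?thesis .
qed

text \<open>The kernels inside the two traces and those of the energy form are together 2 j + n
  pairs. The bound involves only m = 2 j + n and k, so it serves the traces of every order.\<close>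

lemma energy_form_trace_majorant_le:
  "energy_form n (trace_majorant j n k) (trace_majorant j n k) \<le> paired (2 * (2 * j + n) + 2 * k) (2 * j + n) (\<lambda>i. i)"
proof -
  define N where "N = 2 * j + n + k"
  let ?\<epsilon> = "cross_pairing j N"
  have jN: "2 * j + n \<le> N" by (simp add: N_def)
  have [measurable]: "(\<lambda>z. pair_weight (2 * j + n) ?\<epsilon> z) \<in> borel_measurable (cube (N + N))"
    by (rule measurable_pair_weight[where n = "N + N"]) (use inj_cross_pairing(2)[OF jN] in auto)
  have "energy_form n (trace_majorant j n k) (trace_majorant j n k) \<le>
     (\<integral>\<^sup>+z1. \<integral>\<^sup>+z2. ennreal (\<rho> (N + N) (join N z1 z2) * pair_weight (2 * j + n) ?\<epsilon> (join N z1 z2)) \<partial>cube N \<partial>cube N)"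
    unfolding energy_form_trace_majorant N_def[symmetric]
  proof (rule nn_integral_mono, rule nn_integral_mono_AE)
    fix z1 :: "nat \<Rightarrow> real"
    show "AE z2 in cube N. ennreal (\<rho> N z1 * pair_weight j (\<lambda>i. i) z1) * ennreal (\<rho> N z2 * pair_weight j (\<lambda>i. i) z2) *
        ennreal (frac_kernel H n (mid j n z1) (mid j n z2)) \<le>
        ennreal (\<rho> (N + N) (join N z1 z2) * pair_weight (2 * j + n) ?\<epsilon> (join N z1 z2))"
      \<comment> \<open>Points z2 sharing a coordinate value with z1 must be excluded, since the
        density of the joined point vanishes there. They form a null set.\<close>
      using AE_cube_cross[of N N z1]
    proof eventually_elim
      case (elim z2)
      let ?w = "pair_weight j (\<lambda>i. i) z1 * pair_weight j (\<lambda>i. i) z2 * frac_kernel H n (mid j n z1) (mid j n z2)"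
      have "\<rho> N z1 * pair_weight j (\<lambda>i. i) z1 * (\<rho> N z2 * pair_weight j (\<lambda>i. i) z2) * frac_kernel H n (mid j n z1) (mid j n z2) =
          (\<rho> N z1 * \<rho> N z2) * ?w" by (simp add: ac_simps)
      also have "\<dots> \<le> \<rho> (N + N) (join N z1 z2) * ?w"
        using elim by (intro mult_right_mono \<rho>_mult_le_join) auto
      finally show ?case unfolding pair_weight_cross_pairing[OF jN]
        by (simp add: ennreal_mult[symmetric] ennreal_leI)
    qed
  qed
  also have "\<dots> = paired (N + N) (2 * j + n) ?\<epsilon>"
    unfolding paired_def by (rule nn_integral_join[symmetric]) measurable
  also have "\<dots> = paired (N + N) (2 * j + n) (\<lambda>i. i)"
    using inj_cross_pairing[OF jN] jN by (intro paired_eq_id) auto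
  also have "N + N = 2 * (2 * j + n) + 2 * k" by (simp add: N_def)
  finally show ?thesis .
qed

text \<open>The full trace stands on the larger side of the final bound, so
  \<open>psi_kernel\<close> cannot simply be estimated by its majorant here. Their almost sure
  equality and the finiteness of \<open>paired\<close> give an exact value.\<close>

lemma full_trace_psi_kernel: "ennreal (full_trace H m (psi_kernel (2 * m) (2 * k))) = paired (2 * m + 2 * k) m (\<lambda>i. i)"
proof -
  have J: "join (2 * m) s (\<lambda>_. undefined) = s" if "s \<in> space (cube (2 * m))" for s
    using that by (auto simp: join_def space_cube_iff fun_eq_iff)
  have ft: "full_trace H m (psi_kernel (2 * m) (2 * k)) = (LINT s|cube (2 * m). psi_kernel (2 * m) (2 * k) s * pair_weight m (\<lambda>i. i) s)"
    unfolding full_trace_def frac_trace_def trace_integrand_psi_kernel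
    by (intro Bochner_Integration.integral_cong refl) (simp add: J)
  have [measurable]: "(\<lambda>z. pair_weight m (\<lambda>i. i) z) \<in> borel_measurable (cube (2 * m + 2 * k))"
    by (rule measurable_pair_weight[where n = "2 * m + 2 * k"]) auto
  have pair_weight: "pair_weight m (\<lambda>i. i) (join (2 * m) s u) = pair_weight m (\<lambda>i. i) s" for s u
    unfolding pair_weight_def by (intro prod.cong) (auto simp: join_def)
  have "(\<integral>\<^sup>+s. ennreal (psi_kernel (2 * m) (2 * k) s * pair_weight m (\<lambda>i. i) s) \<partial>cube (2 * m)) =
      (\<integral>\<^sup>+s. psi_majorant (2 * m) (2 * k) s * ennreal (pair_weight m (\<lambda>i. i) s) \<partial>cube (2 * m))"
  proof (rule nn_integral_cong_AE)
    show "AE s in cube (2 * m). ennreal (psi_kernel (2 * m) (2 * k) s * pair_weight m (\<lambda>i. i) s) =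
        psi_majorant (2 * m) (2 * k) s * ennreal (pair_weight m (\<lambda>i. i) s)"
      using psi_kernel_eq_psi_majorant_AE[where m = "2 * m" and k = "2 * k"] by eventually_elim (simp add: ennreal_mult)
  qed
  also have "\<dots> = (\<integral>\<^sup>+s. \<integral>\<^sup>+u. ennreal (\<rho> (2 * m + 2 * k) (join (2 * m) s u) * pair_weight m (\<lambda>i. i) (join (2 * m) s u)) \<partial>cube (2 * k) \<partial>cube (2 * m))"
  proof (rule nn_integral_cong)
    fix s assume [measurable]: "s \<in> space (cube (2 * m))"
    show "psi_majorant (2 * m) (2 * k) s * ennreal (pair_weight m (\<lambda>i. i) s) =
      (\<integral>\<^sup>+u. ennreal (\<rho> (2 * m + 2 * k) (join (2 * m) s u) * pair_weight m (\<lambda>i. i) (join (2 * m) s u)) \<partial>cube (2 * k))"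
      unfolding psi_majorant_def pair_weight by (subst ennreal_mult) (simp_all add: nn_integral_multc)
  qed
  also have "\<dots> = paired (2 * m + 2 * k) m (\<lambda>i. i)"
    unfolding paired_def by (rule nn_integral_join[symmetric]) measurable
  finally have eq: "(\<integral>\<^sup>+s. ennreal (psi_kernel (2 * m) (2 * k) s * pair_weight m (\<lambda>i. i) s) \<partial>cube (2 * m)) = paired (2 * m + 2 * k) m (\<lambda>i. i)" .
  have "paired (2 * m + 2 * k) m (\<lambda>i. i) < \<infinity>" by (rule paired_finite) auto
  then have "integrable (cube (2 * m)) (\<lambda>s. psi_kernel (2 * m) (2 * k) s * pair_weight m (\<lambda>i. i) s)"
    by (intro integrableI_nonneg) (auto simp: eq)
  then show ?thesis unfolding ft eq[symmetric] by (simp add: nn_integral_eq_integral)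
qed

lemma full_trace_nonneg: "0 \<le> full_trace H m (psi_kernel (2 * m) (2 * k))"
  unfolding full_trace_def frac_trace_def trace_integrand_psi_kernel
  by (intro Bochner_Integration.integral_nonneg) simp

lemma energy_form_trace_psi_le:
  "energy_form n (trace_psi j n k) (trace_psi j n k) \<le> ennreal (full_trace H (2 * j + n) (psi_kernel (2 * (2 * j + n)) (2 * k)))"
proof -
  have "energy_form n (trace_psi j n k) (trace_psi j n k) \<le> energy_form n (trace_majorant j n k) (trace_majorant j n k)"
    unfolding energy_form_def by (intro nn_integral_mono mult_mono ennreal_trace_psi_le) auto
  also note energy_form_trace_majorant_le
  finally show ?thesis unfolding full_trace_psi_kernel .
qed

end

section \<open>Tensor powers\<close>

lemma span_image_explicit:
  fixes F :: "'a \<Rightarrow> 'b::real_vector"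
  assumes "v \<in> span (F ` A)"
  shows "\<exists>(N::nat) c g. (\<forall>i<N. g i \<in> A) \<and> v = (\<Sum>i<N. c i *\<^sub>R F (g i))"
  using assms
proof (induction rule: span_induct_alt)
  case base
  show ?case by (rule exI[of _ 0]) auto
next
  case (step r x y)
  then obtain N :: nat and c g a where *: "\<forall>i<N. g i \<in> A" "y = (\<Sum>i<N. c i *\<^sub>R F (g i))" "x = F a" "a \<in> A"
    by (elim imageE exE conjE)
  have "(\<Sum>i<Suc N. (c(N := r)) i *\<^sub>R F ((g(N := a)) i)) = (\<Sum>i<N. c i *\<^sub>R F (g i)) + r *\<^sub>R F a" by simp
  then show ?case using *
    by (intro exI[of _ "Suc N"] exI[of _ "c(N := r)"] exI[of _ "g(N := a)"]) (auto simp: less_Suc_eq)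
qed

lemma subspace_closure:
  fixes S :: "'a::real_normed_vector set"
  assumes S: "subspace S"
  shows "subspace (closure S)"
proof (rule subspaceI)
  show "0 \<in> closure S" using subspace_0[OF S] closure_subset by auto
  fix x y assume "x \<in> closure S" "y \<in> closure S"
  then obtain u v where u: "\<forall>n. u n \<in> S" "u \<longlonglongrightarrow> x" and v: "\<forall>n. v n \<in> S" "v \<longlonglongrightarrow> y"
    unfolding closure_sequential by (elim exE conjE)
  then show "x + y \<in> closure S"
    unfolding closure_sequential using tendsto_add[OF u(2) v(2)] subspace_add[OF S]
    by (intro exI[of _ "\<lambda>n. u n + v n"]) simp
next
  fix c x assume "x \<in> closure S"
  then obtain u where u: "\<forall>n. u n \<in> S" "u \<longlonglongrightarrow> x" unfolding closure_sequential by (elim exE conjE)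
  then show "c *\<^sub>R x \<in> closure S"
    unfolding closure_sequential using tendsto_scaleR[OF tendsto_const u(2)] subspace_scale[OF S]
    by (intro exI[of _ "\<lambda>n. c *\<^sub>R u n"]) simp
qed

section \<open>Ryser's formula for permanents\<close>

lemma sum_Pow_alternating:
  fixes A :: "'a set"
  assumes "finite A"
  shows "(\<Sum>U\<in>Pow A. (-1) ^ card U :: real) = (if A = {} then 1 else 0)"
proof -
  have "(\<Sum>U\<in>Pow A. (-1) ^ card U :: real) = (\<Sum>U\<in>Pow A. (\<Prod>x\<in>U. -1) * (\<Prod>x\<in>A - U. 1))" by simp
  also have "\<dots> = (\<Prod>x\<in>A. (-1) + 1)" by (rule prod_add[OF assms, symmetric])
  also have "\<dots> = (if A = {} then 1 else 0)" using assms by (auto simp: card_gt_0_iff)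
  finally show ?thesis .
qed

lemma bij_betw_permutes_PiE:
  assumes "finite A"
  shows "bij_betw (\<lambda>p. restrict p A) {p. p permutes A} {\<phi> \<in> A \<rightarrow>\<^sub>E A. \<phi> ` A = A}"
proof (rule bij_betwI[where g = "\<lambda>\<phi> x. if x \<in> A then \<phi> x else x"])
  show "(\<lambda>p. restrict p A) \<in> {p. p permutes A} \<rightarrow> {\<phi> \<in> A \<rightarrow>\<^sub>E A. \<phi> ` A = A}"
    by (auto simp: permutes_in_image permutes_image)
  show "(\<lambda>\<phi> x. if x \<in> A then \<phi> x else x) \<in> {\<phi> \<in> A \<rightarrow>\<^sub>E A. \<phi> ` A = A} \<rightarrow> {p. p permutes A}"
  proof
    fix \<phi> assume \<phi>: "\<phi> \<in> {\<phi> \<in> A \<rightarrow>\<^sub>E A. \<phi> ` A = A}"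
    then have "bij_betw \<phi> A A" using assms by (auto simp: bij_betw_def intro: finite_surj_inj)
    then have "bij_betw (\<lambda>x. if x \<in> A then \<phi> x else x) A A" by (subst bij_betw_cong[of _ _ \<phi>]) auto
    then show "(\<lambda>x. if x \<in> A then \<phi> x else x) \<in> {p. p permutes A}" by (auto intro: bij_imp_permutes)
  qed
  show "(\<lambda>x. if x \<in> A then restrict p A x else x) = p" if "p \<in> {p. p permutes A}" for p
    using that by (auto simp: permutes_not_in)
  show "restrict (\<lambda>x. if x \<in> A then \<phi> x else x) A = \<phi>" if "\<phi> \<in> {\<phi> \<in> A \<rightarrow>\<^sub>E A. \<phi> ` A = A}" for \<phi>
    using that by (auto simp: PiE_iff extensional_def restrict_def)
qed

text \<open>Expanding the product turns the left side into a sum over maps \<phi>, each weighted by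
  the alternating sum over all S containing its image. That weight vanishes unless \<phi> is onto,
  and a map of a finite set onto itself is a permutation.\<close>

lemma ryser_formula:
  fixes a :: "nat \<Rightarrow> nat \<Rightarrow> real"
  shows "(\<Sum>S\<in>Pow {..<n}. (-1) ^ card ({..<n} - S) * (\<Prod>i<n. \<Sum>j\<in>S. a i j)) =
    (\<Sum>p | p permutes {..<n}. \<Prod>i<n. a i (p i))"
proof -
  let ?A = "{..<n}" and ?F = "{..<n} \<rightarrow>\<^sub>E {..<n}"
  have fin: "finite ?F" by (intro finite_PiE) auto
  have "(\<Sum>S\<in>Pow ?A. (-1) ^ card (?A - S) * (\<Prod>i<n. \<Sum>j\<in>S. a i j)) =
      (\<Sum>S\<in>Pow ?A. \<Sum>\<phi>\<in>?F. if \<phi> ` ?A \<subseteq> S then (-1) ^ card (?A - S) * (\<Prod>i<n. a i (\<phi> i)) else 0)"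
  proof (rule sum.cong[OF refl])
    fix S assume S: "S \<in> Pow ?A"
    then have finS: "finite S" using finite_subset by blast
    have "(\<Prod>i<n. \<Sum>j\<in>S. a i j) = (\<Sum>\<phi>\<in>?A \<rightarrow>\<^sub>E S. \<Prod>i<n. a i (\<phi> i))"
      using finS by (intro prod_sum_PiE) auto
    also have "?A \<rightarrow>\<^sub>E S = {\<phi> \<in> ?F. \<phi> ` ?A \<subseteq> S}"
    proof (intro set_eqI iffI)
      fix \<phi> assume "\<phi> \<in> ?A \<rightarrow>\<^sub>E S"
      then show "\<phi> \<in> {\<phi> \<in> ?F. \<phi> ` ?A \<subseteq> S}" using S PiE_mono[of ?A "\<lambda>_. S" "\<lambda>_. ?A"] PiE_mem[of \<phi> ?A "\<lambda>_. S"] by blast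
    next
      fix \<phi> assume "\<phi> \<in> {\<phi> \<in> ?F. \<phi> ` ?A \<subseteq> S}"
      then have "\<phi> \<in> ?F" "\<phi> ` ?A \<subseteq> S" by auto
      then show "\<phi> \<in> ?A \<rightarrow>\<^sub>E S" unfolding PiE_def by (simp add: image_subset_iff Pi_iff)
    qed
    also have "(\<Sum>\<phi>\<in>{\<phi> \<in> ?F. \<phi> ` ?A \<subseteq> S}. \<Prod>i<n. a i (\<phi> i)) = (\<Sum>\<phi>\<in>?F. if \<phi> ` ?A \<subseteq> S then \<Prod>i<n. a i (\<phi> i) else 0)"
      by (rule sum.inter_filter[OF fin])
    finally show "(-1) ^ card (?A - S) * (\<Prod>i<n. \<Sum>j\<in>S. a i j) =
        (\<Sum>\<phi>\<in>?F. if \<phi> ` ?A \<subseteq> S then (-1) ^ card (?A - S) * (\<Prod>i<n. a i (\<phi> i)) else 0)"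
      by (simp add: sum_distrib_left if_distrib cong: if_cong)
  qed
  also have "\<dots> = (\<Sum>\<phi>\<in>?F. \<Sum>S\<in>Pow ?A. if \<phi> ` ?A \<subseteq> S then (-1) ^ card (?A - S) * (\<Prod>i<n. a i (\<phi> i)) else 0)"
    by (rule sum.swap)
  also have "\<dots> = (\<Sum>\<phi>\<in>?F. if \<phi> ` ?A = ?A then \<Prod>i<n. a i (\<phi> i) else 0)"
  proof (rule sum.cong[OF refl])
    fix \<phi> assume \<phi>: "\<phi> \<in> ?F"
    then have R: "\<phi> ` ?A \<subseteq> ?A" by (auto simp: PiE_iff)
    have "(\<Sum>S\<in>Pow ?A. if \<phi> ` ?A \<subseteq> S then (-1) ^ card (?A - S) * (\<Prod>i<n. a i (\<phi> i)) else 0) =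
        (\<Sum>S\<in>{S \<in> Pow ?A. \<phi> ` ?A \<subseteq> S}. (-1) ^ card (?A - S) * (\<Prod>i<n. a i (\<phi> i)))"
      by (rule sum.inter_filter[symmetric]) auto
    \<comment> \<open>S is replaced by its complement U, which ranges over the subsets of the
      complement of the image of \<phi>.\<close>
    also have "\<dots> = (\<Sum>U\<in>Pow (?A - \<phi> ` ?A). (-1) ^ card U * (\<Prod>i<n. a i (\<phi> i)))"
      by (rule sum.reindex_bij_witness[of _ "\<lambda>U. ?A - U" "\<lambda>S. ?A - S"]) (use R in auto)
    also have "\<dots> = (\<Sum>U\<in>Pow (?A - \<phi> ` ?A). (-1) ^ card U) * (\<Prod>i<n. a i (\<phi> i))"
      by (simp add: sum_distrib_right)
    also have "\<dots> = (if \<phi> ` ?A = ?A then \<Prod>i<n. a i (\<phi> i) else 0)"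
      using R by (subst sum_Pow_alternating) auto
    finally show "(\<Sum>S\<in>Pow ?A. if \<phi> ` ?A \<subseteq> S then (-1) ^ card (?A - S) * (\<Prod>i<n. a i (\<phi> i)) else 0) =
        (if \<phi> ` ?A = ?A then \<Prod>i<n. a i (\<phi> i) else 0)" .
  qed
  also have "\<dots> = (\<Sum>\<phi>\<in>{\<phi> \<in> ?F. \<phi> ` ?A = ?A}. \<Prod>i<n. a i (\<phi> i))"
    by (rule sum.inter_filter[symmetric, OF fin])
  also have "\<dots> = (\<Sum>p | p permutes ?A. \<Prod>i<n. a i (restrict p ?A i))"
    by (rule sum.reindex_bij_betw[symmetric, OF bij_betw_permutes_PiE]) simp
  finally show ?thesis by simp
qed

section \<open>Test functions and elementary tensors\<close>

lemma test_function_measurable: "test_function g \<Longrightarrow> g \<in> borel_measurable borel"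
  by (intro borel_measurable_continuous_onI test_function_continuous)

locale tensor_setting = hurst H for H :: real +
  fixes emb :: "(real \<Rightarrow> real) \<Rightarrow> 'h::{real_inner,complete_space}"
    and tens :: "'h list \<Rightarrow> 'k::{real_inner,complete_space}"
  assumes compl: "is_completion H emb" and tens: "is_tensor tens"
begin

lemma inner_tens: "length xs = length ys \<Longrightarrow> inner (tens xs) (tens ys) = (\<Prod>i<length xs. inner (xs ! i) (ys ! i))"
  using tens by (simp add: is_tensor_def)

lemma inner_tens_power: "inner (tens (replicate n u)) (tens (replicate n w)) = inner u w ^ n"
  by (subst inner_tens) simp_all

lemma inner_tens_power_left: "length xs = n \<Longrightarrow> inner (tens (replicate n u)) (tens xs) = (\<Prod>i<n. inner u (xs ! i))"
  by (subst inner_tens) simp_all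

lemma inner_emb:
  assumes "test_function f" "test_function g"
  shows "inner (emb f) (emb g) = (LINT s|unit_leb. f s * potential g s)"
proof -
  have "inner (emb f) (emb g) = (LINT s|unit_leb. LINT t|unit_leb. f s * (g t * \<kappa> s t))"
    using compl assms by (simp add: is_completion_def \<kappa>_def mult.assoc)
  then show ?thesis by (simp add: potential_def)
qed

lemma integrable_test_potential:
  assumes "test_function f" "test_function g"
  shows "integrable unit_leb (\<lambda>s. f s * potential g s)"
proof -
  obtain B where B: "\<And>x. \<bar>f x\<bar> \<le> B" using test_function_bounded[OF assms(1)] by blast
  obtain B' where B': "\<And>x. \<bar>g x\<bar> \<le> B'" using test_function_bounded[OF assms(2)] by blast
  have f: "integrable unit_leb f"
    by (rule unit_leb.integrable_const_bound[where B = B])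
       (use B test_function_measurable[OF assms(1)] in \<open>auto intro: measurable_borel_unit_leb\<close>)
  show ?thesis
    by (rule integrable_bounded_mult[OF f, of _ "B' * \<Lambda>"])
       (use potential_bound[OF test_function_measurable[OF assms(2)] B'] measurable_potential[OF test_function_measurable[OF assms(2)]] in
         \<open>auto intro: measurable_borel_unit_leb simp: space_unit_leb\<close>)
qed

text \<open>The inner product formula shows that the defect v is orthogonal to the image of every
  test function. As v is itself a combination of three such images, it is orthogonal to
  itself.\<close>

lemma emb_add:
  assumes f: "test_function f" and g: "test_function g"
  shows "emb (\<lambda>x. f x + g x) = emb f + emb g"
proof -
  define v where "v = emb (\<lambda>x. f x + g x) - emb f - emb g"
  have fg: "test_function (\<lambda>x. f x + g x)" using f g by (rule test_function_add)
  obtain B where B: "\<And>x. \<bar>f x\<bar> \<le> B" using test_function_bounded[OF f] by blast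
  obtain B' where B': "\<And>x. \<bar>g x\<bar> \<le> B'" using test_function_bounded[OF g] by blast
  have "inner (emb u) v = 0" if u: "test_function u" for u
  proof -
    have "(LINT s|unit_leb. u s * potential (\<lambda>x. f x + g x) s) = (LINT s|unit_leb. u s * potential f s + u s * potential g s)"
      using potential_add[OF test_function_measurable[OF f] B test_function_measurable[OF g] B']
      by (intro Bochner_Integration.integral_cong refl) (simp add: space_unit_leb distrib_left)
    also have "\<dots> = (LINT s|unit_leb. u s * potential f s) + (LINT s|unit_leb. u s * potential g s)"
      by (intro Bochner_Integration.integral_add integrable_test_potential u f g)
    finally show ?thesis by (simp add: v_def inner_diff_right inner_emb u f g fg)
  qed
  note orth = this[OF fg] this[OF f] this[OF g]
  have "inner v v = inner (emb (\<lambda>x. f x + g x)) v - inner (emb f) v - inner (emb g) v"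
    by (subst (1) v_def) (simp only: inner_diff_left)
  then have "v = 0" using orth by simp
  then show ?thesis by (simp add: v_def algebra_simps)
qed

lemma emb_zero: "emb (\<lambda>_. 0) = 0"
  using inner_emb[OF test_function_zero test_function_zero] by simp

lemma emb_sum:
  assumes "finite A" "\<And>a. a \<in> A \<Longrightarrow> test_function (g a)"
  shows "emb (\<lambda>x. \<Sum>a\<in>A. g a x) = (\<Sum>a\<in>A. emb (g a))"
  using assms
proof (induction A rule: finite_induct)
  case (insert a A)
  then show ?case by (simp add: emb_add test_function_sum)
qed (simp add: emb_zero)

lemma potential_sum:
  assumes "finite A" "\<And>a. a \<in> A \<Longrightarrow> test_function (g a)" "x \<in> {0..1}"
  shows "potential (\<lambda>x. \<Sum>a\<in>A. g a x) x = (\<Sum>a\<in>A. potential (g a) x)"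
  using assms(1,2)
proof (induction A rule: finite_induct)
  case (insert a A)
  have t: "test_function (\<lambda>x. \<Sum>a\<in>A. g a x)" using insert by (intro test_function_sum) auto
  obtain B where B: "\<And>x. \<bar>g a x\<bar> \<le> B" using test_function_bounded[of "g a"] insert by blast
  obtain B' where B': "\<And>x. \<bar>\<Sum>a\<in>A. g a x\<bar> \<le> B'" using test_function_bounded[OF t] by blast
  have "potential (\<lambda>x. g a x + (\<Sum>a\<in>A. g a x)) x = potential (g a) x + potential (\<lambda>x. \<Sum>a\<in>A. g a x) x"
    using insert by (intro potential_add[OF _ B test_function_measurable[OF t] B' assms(3)] test_function_measurable) auto
  then show ?case using insert by simp
qed (simp add: potential_def)

text \<open>Even in order 0, where the tensor power does not see its argument, \<open>is_wiener_int\<close> asks for unit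
  vectors.\<close>

lemma unit_vector_exists: "\<exists>u::'h. norm u = 1"
proof -
  let ?b = "bump 1 0"
  have tb: "test_function ?b" by (rule test_function_bump)
  obtain B where B: "\<And>x. \<bar>?b x\<bar> \<le> B" using test_function_bounded[OF tb] by blast
  have nn: "0 \<le> ?b x" for x by (simp add: bump_def)
  have intb: "integrable unit_leb ?b"
    by (rule unit_leb.integrable_const_bound[where B = B])
       (use B test_function_measurable[OF tb] in \<open>auto intro: measurable_borel_unit_leb\<close>)
  define \<beta> where "\<beta> = (LINT t|unit_leb. ?b t)"
  have "\<beta> > 0"
  proof (rule ccontr)
    assume "\<not> \<beta> > 0"
    moreover have "0 \<le> \<beta>" unfolding \<beta>_def using nn by (intro Bochner_Integration.integral_nonneg) auto
    ultimately have "\<beta> = 0" by linarith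
    then have "AE t in unit_leb. ?b t = 0"
      using integral_nonneg_eq_0_iff_AE[OF intb] nn by (simp add: \<beta>_def)
    then have "AE t in unit_leb. t \<notin> {1/4<..<3/4}" by eventually_elim (auto simp: bump_def)
    then have "AE t in lborel. t \<in> {0..1} \<longrightarrow> t \<notin> {1/4<..<3/4::real}"
      unfolding unit_leb_def by (subst (asm) AE_restrict_space_iff) auto
    then have "AE t in lborel. t \<notin> {1/4<..<3/4::real}" by eventually_elim auto
    then have "emeasure lborel {1/4<..<3/4::real} = 0"
      by (subst (asm) AE_iff_measurable[of "{1/4<..<3/4}"]) auto
    then show False by simp
  qed
  \<comment> \<open>Off the diagonal the kernel is at least 1 on the unit square, so the potential
    of a nonnegative function is at least its integral. The squared norm of \<open>emb ?b\<close> is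
    then at least \<beta> squared.\<close>
  have potential_ge: "\<beta> \<le> potential ?b s" if s: "s \<in> {0..1}" for s
    unfolding \<beta>_def potential_def
  proof (rule integral_mono_AE[OF intb integrable_potential[OF test_function_measurable[OF tb] B s]])
    show "AE t in unit_leb. ?b t \<le> ?b t * \<kappa> s t"
      using AE_unit_leb_neq[of s] AE_space
    proof eventually_elim
      case (elim t)
      then have "1 \<le> \<kappa> s t" using s by (intro \<kappa>_ge_1) (auto simp: space_unit_leb)
      then show ?case using mult_left_mono[of 1 "\<kappa> s t" "?b t"] nn[of t] by simp
    qed
  qed
  have "0 < \<beta> * \<beta>" using \<open>\<beta> > 0\<close> by simp
  also have "\<beta> * \<beta> = (LINT s|unit_leb. ?b s * \<beta>)" by (simp add: \<beta>_def)
  also have "\<dots> \<le> (LINT s|unit_leb. ?b s * potential ?b s)"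
    using potential_ge nn intb by (intro integral_mono_AE integrable_test_potential tb AE_I2) (auto simp: space_unit_leb intro!: mult_left_mono)
  also have "\<dots> = inner (emb ?b) (emb ?b)" using tb by (simp add: inner_emb)
  finally have "emb ?b \<noteq> 0" by auto
  then show ?thesis by (intro exI[of _ "emb ?b /\<^sub>R norm (emb ?b)"]) simp
qed

text \<open>Expand the squared norm of the difference by the inner product formula: all three
  products tend to the same limit, with weights 1, -2, 1.\<close>

lemma tens_tendsto:
  assumes "\<And>k. length (xs k) = n" "length ys = n" "\<And>i. i < n \<Longrightarrow> (\<lambda>k. xs k ! i) \<longlonglongrightarrow> ys ! i"
  shows "(\<lambda>k. tens (xs k)) \<longlonglongrightarrow> tens ys"
proof -
  have "(\<lambda>k. (norm (tens (xs k) - tens ys))\<^sup>2) \<longlonglongrightarrow> 0"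
  proof -
    have "(norm (tens (xs k) - tens ys))\<^sup>2 = (\<Prod>i<n. inner (xs k ! i) (xs k ! i)) - 2 * (\<Prod>i<n. inner (xs k ! i) (ys ! i)) + (\<Prod>i<n. inner (ys ! i) (ys ! i))" for k
    proof -
      have "(norm (tens (xs k) - tens ys))\<^sup>2 = inner (tens (xs k)) (tens (xs k)) - 2 * inner (tens (xs k)) (tens ys) + inner (tens ys) (tens ys)"
        by (simp add: power2_norm_eq_inner inner_diff inner_commute)
      then show ?thesis using assms(1,2) by (simp add: inner_tens)
    qed
    moreover have "(\<lambda>k. (\<Prod>i<n. inner (xs k ! i) (xs k ! i)) - 2 * (\<Prod>i<n. inner (xs k ! i) (ys ! i)) + (\<Prod>i<n. inner (ys ! i) (ys ! i)))
       \<longlonglongrightarrow> (\<Prod>i<n. inner (ys ! i) (ys ! i)) - 2 * (\<Prod>i<n. inner (ys ! i) (ys ! i)) + (\<Prod>i<n. inner (ys ! i) (ys ! i))"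
      by (intro tendsto_intros tendsto_prod) (use assms(3) in auto)
    ultimately show ?thesis by simp
  qed
  then have "(\<lambda>k. sqrt ((norm (tens (xs k) - tens ys))\<^sup>2)) \<longlonglongrightarrow> sqrt 0" by (rule tendsto_real_sqrt)
  then have "(\<lambda>k. norm (tens (xs k) - tens ys)) \<longlonglongrightarrow> 0" by simp
  then have "(\<lambda>k. tens (xs k) - tens ys) \<longlonglongrightarrow> 0" by (rule tendsto_norm_zero_cancel)
  then show ?thesis by (simp add: LIM_zero_iff)
qed

text \<open>Test functions are dense in the Hilbert space and \<open>tens\<close> is continuous, so
  z is orthogonal to all elementary tensors, hence to the closed span that contains it. This makes
  the \<open>THE\<close> in \<open>tensor_of\<close> legitimate.\<close>

lemma orthogonal_tensor_power_eq_0: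
  assumes z: "z \<in> tensor_power tens n"
    and orth: "\<And>gs. length gs = n \<Longrightarrow> (\<forall>g\<in>set gs. test_function g) \<Longrightarrow> inner z (tens (map emb gs)) = 0"
  shows "z = 0"
proof -
  have dense: "\<exists>g. (\<forall>k. test_function (g k)) \<and> (\<lambda>k::nat. emb (g k)) \<longlonglongrightarrow> h" for h
  proof -
    have "h \<in> closure (emb ` Collect test_function)" using compl by (simp add: is_completion_def)
    then obtain v where v: "\<And>k. v k \<in> emb ` Collect test_function" "v \<longlonglongrightarrow> h"
      unfolding closure_sequential by blast
    then have "\<forall>k. \<exists>g. test_function g \<and> v k = emb g" by auto
    then obtain g where g: "\<And>k. test_function (g k)" "\<And>k. v k = emb (g k)" by metis
    then have "v = (\<lambda>k. emb (g k))" by auto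
    then show ?thesis using v(2) g(1) by auto
  qed
  then obtain G where G: "\<And>h k. test_function (G h k)" "\<And>h. (\<lambda>k. emb (G h k)) \<longlonglongrightarrow> h" by metis
  have "inner z (tens hs) = 0" if "length hs = n" for hs
  proof -
    have "(\<lambda>k. tens (map emb (map (\<lambda>h. G h k) hs))) \<longlonglongrightarrow> tens hs"
      using that G(2) by (intro tens_tendsto[where n = n]) auto
    then have "(\<lambda>k. inner z (tens (map emb (map (\<lambda>h. G h k) hs)))) \<longlonglongrightarrow> inner z (tens hs)"
      by (intro tendsto_intros)
    moreover have "inner z (tens (map emb (map (\<lambda>h. G h k) hs))) = 0" for k
      using that G(1) by (intro orth) auto
    ultimately show ?thesis by (simp add: LIMSEQ_const_iff)
  qed
  then have "span (tens ` {xs. length xs = n}) \<subseteq> {w. inner z w = 0}"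
    by (intro span_minimal subspace_hyperplane) auto
  then have "closure (span (tens ` {xs. length xs = n})) \<subseteq> {w. inner z w = 0}"
    by (intro closure_minimal closed_hyperplane)
  then have "inner z z = 0" using z by (auto simp: tensor_power_def)
  then show ?thesis by simp
qed

lemma represents_unique:
  assumes "represents H emb tens n f x" "represents H emb tens n f y"
  shows "x = y"
proof -
  have "subspace (tensor_power tens n)"
    unfolding tensor_power_def by (intro subspace_closure subspace_span)
  then have "x - y \<in> tensor_power tens n"
    using assms by (intro subspace_diff) (auto simp: represents_def)
  then have "x - y = 0"
    by (rule orthogonal_tensor_power_eq_0) (use assms in \<open>auto simp: represents_def inner_diff_left\<close>)
  then show ?thesis by simp
qed

end

section \<open>Representation of symmetric kernels\<close>

text \<open>Completeness of L2 along a rapidly Cauchy sequence: summable increments give an almost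
  sure limit, and Fatou's lemma makes it a limit in mean square.\<close>

lemma L2_limit_exists:
  fixes Y :: "nat \<Rightarrow> 'p \<Rightarrow> real"
  assumes M: "prob_space M" and [measurable]: "\<And>k. Y k \<in> borel_measurable M" and C: "0 \<le> C"
    and cau: "\<And>k l. k \<le> l \<Longrightarrow> (\<integral>\<^sup>+\<omega>. ennreal ((Y k \<omega> - Y l \<omega>)\<^sup>2) \<partial>M) \<le> ennreal (C * (1/4) ^ k)"
  shows "\<exists>X. X \<in> borel_measurable M \<and> (\<lambda>k. \<integral>\<^sup>+\<omega>. ennreal ((Y k \<omega> - X \<omega>)\<^sup>2) \<partial>M) \<longlonglongrightarrow> 0"
proof -
  interpret prob_space M by fact
  define d where "d k \<omega> = \<bar>Y (Suc k) \<omega> - Y k \<omega>\<bar>" for k \<omega>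
  have [measurable]: "d k \<in> borel_measurable M" for k unfolding d_def by measurable
  have d_le: "(\<integral>\<^sup>+\<omega>. ennreal (d k \<omega>) \<partial>M) \<le> ennreal ((1 + C) * (1/2) ^ k)" for k
  proof -
    \<comment> \<open>Splitting at x = 2^(-k) trades the bound of order 4^(-k) on second moments for
      one of order 2^(-k) on first moments, which is summable.\<close>
    have pt: "x \<le> (1/2) ^ k + 2 ^ k * x\<^sup>2" if "0 \<le> x" for x :: real
    proof (cases "x \<le> (1/2) ^ k")
      case False
      then have "(1/2) ^ k * (2 ^ k * x) \<le> x * (2 ^ k * x)" using that by (intro mult_right_mono) auto
      moreover have "(1/2) ^ k * (2 ^ k * x) = x"
      proof -
        have "(1/2) ^ k * 2 ^ k = (1 :: real)" by (simp flip: power_mult_distrib)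
        then show ?thesis by (simp only: mult.assoc[symmetric])
      qed
      moreover have "x * (2 ^ k * x) = 2 ^ k * x\<^sup>2" "0 \<le> (1/2 :: real) ^ k" by (simp_all add: power2_eq_square)
      ultimately show ?thesis by linarith
    qed (simp add: add_increasing2)
    have "(\<integral>\<^sup>+\<omega>. ennreal (d k \<omega>) \<partial>M) \<le> (\<integral>\<^sup>+\<omega>. ennreal ((1/2) ^ k) + ennreal (2 ^ k) * ennreal ((Y k \<omega> - Y (Suc k) \<omega>)\<^sup>2) \<partial>M)"
    proof (rule nn_integral_mono)
      fix \<omega>
      have "d k \<omega> \<le> (1/2) ^ k + 2 ^ k * (Y k \<omega> - Y (Suc k) \<omega>)\<^sup>2"
        using pt[of "d k \<omega>"] by (simp add: d_def power2_commute)
      then show "ennreal (d k \<omega>) \<le> ennreal ((1/2) ^ k) + ennreal (2 ^ k) * ennreal ((Y k \<omega> - Y (Suc k) \<omega>)\<^sup>2)"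
        by (simp add: ennreal_leI flip: ennreal_mult' ennreal_plus)
    qed
    also have "\<dots> = ennreal ((1/2) ^ k) + ennreal (2 ^ k) * (\<integral>\<^sup>+\<omega>. ennreal ((Y k \<omega> - Y (Suc k) \<omega>)\<^sup>2) \<partial>M)"
      by (simp add: nn_integral_add nn_integral_cmult emeasure_space_1)
    also have "\<dots> \<le> ennreal ((1/2) ^ k) + ennreal (2 ^ k) * ennreal (C * (1/4) ^ k)"
      by (intro add_left_mono mult_left_mono cau) auto
    also have "\<dots> = ennreal ((1/2) ^ k + 2 ^ k * (C * (1/4) ^ k))"
      using C by (simp flip: ennreal_mult' ennreal_plus)
    also have "(1/2) ^ k + 2 ^ k * (C * (1/4) ^ k) = (1 + C) * (1/2) ^ k"
    proof -
      have "2 ^ k * (1/4) ^ k = ((1/2) ^ k :: real)" by (simp flip: power_mult_distrib)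
      then show ?thesis by (simp add: algebra_simps)
    qed
    finally show ?thesis .
  qed
  have "(\<integral>\<^sup>+\<omega>. (\<Sum>k. ennreal (d k \<omega>)) \<partial>M) = (\<Sum>k. \<integral>\<^sup>+\<omega>. ennreal (d k \<omega>) \<partial>M)"
    by (rule nn_integral_suminf) measurable
  also have "\<dots> \<le> (\<Sum>k. ennreal ((1 + C) * (1/2) ^ k))" by (rule suminf_le[OF d_le summableI summableI])
  also have "\<dots> < \<infinity>"
  proof -
    have "summable (\<lambda>k. (1 + C) * (1/2) ^ k)" by (intro summable_mult summable_geometric) simp
    moreover have "0 \<le> (1 + C) * (1/2) ^ k" for k using C by (intro mult_nonneg_nonneg) auto
    ultimately have "(\<Sum>k. ennreal ((1 + C) * (1/2) ^ k)) \<noteq> top" by (rule ennreal_suminf_neq_top)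
    then show ?thesis by (simp only: infinity_ennreal_def less_top)
  qed
  finally have "(\<integral>\<^sup>+\<omega>. (\<Sum>k. ennreal (d k \<omega>)) \<partial>M) \<noteq> \<infinity>" by simp
  then have "AE \<omega> in M. (\<Sum>k. ennreal (d k \<omega>)) \<noteq> \<infinity>" by (intro nn_integral_PInf_AE) auto
  then have conv: "AE \<omega> in M. convergent (\<lambda>k. Y k \<omega>)"
  proof eventually_elim
    case (elim \<omega>)
    have "summable (\<lambda>k. d k \<omega>)"
      using elim by (intro summable_suminf_not_top) (auto simp: d_def)
    then have "summable (\<lambda>k. Y (Suc k) \<omega> - Y k \<omega>)" unfolding d_def by (rule summable_rabs_cancel)
    then have "convergent (\<lambda>n. (\<Sum>k<n. Y (Suc k) \<omega> - Y k \<omega>) + Y 0 \<omega>)"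
      unfolding summable_iff_convergent by (intro convergent_add convergent_const)
    then show ?case by (simp add: sum_lessThan_telescope[of "\<lambda>k. Y k \<omega>"])
  qed
  define X where "X \<omega> = lim (\<lambda>k. Y k \<omega>)" for \<omega>
  have X [measurable]: "X \<in> borel_measurable M" unfolding X_def by (rule borel_measurable_lim_metric) measurable
  \<comment> \<open>Fatou's lemma: letting l tend to infinity under the integral preserves the
    Cauchy bound.\<close>
  have bound: "(\<integral>\<^sup>+\<omega>. ennreal ((Y k \<omega> - X \<omega>)\<^sup>2) \<partial>M) \<le> ennreal (C * (1/4) ^ k)" for k
  proof -
    have "(\<integral>\<^sup>+\<omega>. ennreal ((Y k \<omega> - X \<omega>)\<^sup>2) \<partial>M) = (\<integral>\<^sup>+\<omega>. liminf (\<lambda>l. ennreal ((Y k \<omega> - Y l \<omega>)\<^sup>2)) \<partial>M)"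
    proof (rule nn_integral_cong_AE)
      show "AE \<omega> in M. ennreal ((Y k \<omega> - X \<omega>)\<^sup>2) = liminf (\<lambda>l. ennreal ((Y k \<omega> - Y l \<omega>)\<^sup>2))"
        using conv
      proof eventually_elim
        case (elim \<omega>)
        then have "(\<lambda>l. Y l \<omega>) \<longlonglongrightarrow> X \<omega>" by (simp add: X_def convergent_LIMSEQ_iff)
        then have "(\<lambda>l. ennreal ((Y k \<omega> - Y l \<omega>)\<^sup>2)) \<longlonglongrightarrow> ennreal ((Y k \<omega> - X \<omega>)\<^sup>2)"
          by (intro tendsto_ennrealI tendsto_intros)
        then show ?case by (rule lim_imp_Liminf[OF sequentially_bot, symmetric])
      qed
    qed
    also have "\<dots> \<le> liminf (\<lambda>l. \<integral>\<^sup>+\<omega>. ennreal ((Y k \<omega> - Y l \<omega>)\<^sup>2) \<partial>M)"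
      by (rule nn_integral_liminf) measurable
    also have "\<dots> \<le> limsup (\<lambda>l. \<integral>\<^sup>+\<omega>. ennreal ((Y k \<omega> - Y l \<omega>)\<^sup>2) \<partial>M)"
      by (rule Liminf_le_Limsup) simp
    also have "\<dots> \<le> ennreal (C * (1/4) ^ k)"
      by (rule Limsup_bounded) (use cau in \<open>auto simp: eventually_sequentially\<close>)
    finally show ?thesis .
  qed
  have "(\<lambda>k. (1/4 :: real) ^ k) \<longlonglongrightarrow> 0" by (rule LIMSEQ_power_zero) simp
  then have "(\<lambda>k. C * (1/4) ^ k) \<longlonglongrightarrow> C * 0" by (rule tendsto_mult_left)
  from tendsto_ennrealI[OF this] have lim0: "(\<lambda>k. ennreal (C * (1/4) ^ k)) \<longlonglongrightarrow> 0" by simp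
  have "(\<lambda>k. \<integral>\<^sup>+\<omega>. ennreal ((Y k \<omega> - X \<omega>)\<^sup>2) \<partial>M) \<longlonglongrightarrow> 0"
    using bound by (intro tendsto_sandwich[OF _ _ tendsto_const lim0] always_eventually) auto
  then show ?thesis using X by blast
qed

context tensor_setting
begin

lemma tens_power_scale: "tens (replicate n (c *\<^sub>R h)) = c ^ n *\<^sub>R tens (replicate n h)"
proof -
  let ?v = "tens (replicate n (c *\<^sub>R h)) - c ^ n *\<^sub>R tens (replicate n h)"
  have "inner ?v ?v = 0"
    by (simp add: inner_diff inner_tens_power power_mult_distrib)
  then show ?thesis by simp
qed

lemma span_tens_power_unit:
  "span (range (\<lambda>h. tens (replicate n h))) \<subseteq> span ((\<lambda>h. tens (replicate n h)) ` {h. norm h = 1})"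
proof (rule span_minimal)
  obtain u :: 'h where u: "norm u = 1" using unit_vector_exists by blast
  show "range (\<lambda>h. tens (replicate n h)) \<subseteq> span ((\<lambda>h. tens (replicate n h)) ` {h. norm h = 1})"
  proof clarify
    fix h :: 'h
    \<comment> \<open>For h = 0 any unit vector will do. This is also right for n = 0, where
      \<open>norm h ^ n\<close> is 1 and both tensors are \<open>tens []\<close>.\<close>
    define e where "e = (if h = 0 then u else h /\<^sub>R norm h)"
    have e: "norm e = 1" "h = norm h *\<^sub>R e" using u by (auto simp: e_def)
    have "tens (replicate n h) = norm h ^ n *\<^sub>R tens (replicate n e)"
      by (subst e(2), rule tens_power_scale)
    then show "tens (replicate n h) \<in> span ((\<lambda>h. tens (replicate n h)) ` {h. norm h = 1})"
      using e(1) by (simp only:) (intro span_scale span_base imageI, simp)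
  qed
qed (rule subspace_span)

lemma represents_integral:
  assumes gs: "length gs = n" "\<forall>g\<in>set gs. test_function g"
  shows "(LINT s|cube n. LINT t|cube n. f s * (\<Prod>i<n. (gs ! i) (t i)) * frac_kernel H n s t) =
    (LINT s|cube n. f s * (\<Prod>i<n. potential (gs ! i) (s i)))"
proof (rule Bochner_Integration.integral_cong[OF refl])
  fix s assume s: "s \<in> space (cube n)"
  have t: "test_function (gs ! i)" if "i < n" for i using gs that by auto
  have "\<forall>i. \<exists>B. i < n \<longrightarrow> (\<forall>x. \<bar>(gs ! i) x\<bar> \<le> B)" using t test_function_bounded by metis
  then obtain B where B: "\<And>i x. i < n \<Longrightarrow> \<bar>(gs ! i) x\<bar> \<le> B i" by metis
  have "(LINT t|cube n. f s * (\<Prod>i<n. (gs ! i) (t i)) * frac_kernel H n s t) = f s * kern n (\<lambda>t. \<Prod>i<n. (gs ! i) (t i)) s"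
    by (simp add: kern_def mult.assoc)
  also have "kern n (\<lambda>t. \<Prod>i<n. (gs ! i) (t i)) s = (\<Prod>i<n. potential (gs ! i) (s i))"
    using t B s by (intro kern_prod) (auto intro: test_function_measurable)
  finally show "(LINT t|cube n. f s * (\<Prod>i<n. (gs ! i) (t i)) * frac_kernel H n s t) = f s * (\<Prod>i<n. potential (gs ! i) (s i))" .
qed

lemma prod_potential_measurable:
  assumes "\<And>i. i < n \<Longrightarrow> test_function (g i)"
  shows "(\<lambda>s. \<Prod>i<n. potential (g i) (s i)) \<in> borel_measurable (cube n)"
  using assms by (intro borel_measurable_prod measurable_compose[OF borel_measurable_coord measurable_potential] test_function_measurable) auto

lemma prod_potential_bounded:
  assumes "\<And>i. i < n \<Longrightarrow> test_function (g i)"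
  obtains B where "\<And>s. s \<in> space (cube n) \<Longrightarrow> \<bar>\<Prod>i<n. potential (g i) (s i)\<bar> \<le> B"
proof -
  have "\<forall>i. \<exists>B. i < n \<longrightarrow> (\<forall>x. \<bar>g i x\<bar> \<le> B)" using assms test_function_bounded by metis
  then obtain B where B: "\<And>i x. i < n \<Longrightarrow> \<bar>g i x\<bar> \<le> B i" by metis
  have "\<bar>\<Prod>i<n. potential (g i) (s i)\<bar> \<le> (\<Prod>i<n. B i * \<Lambda>)" if "s \<in> space (cube n)" for s
    unfolding abs_prod
    using space_cubeD[OF that] assms B by (intro prod_mono conjI potential_bound test_function_measurable) auto
  then show ?thesis using that by blast
qed

lemma integrable_prod_potential:
  assumes "integrable (cube n) f" "\<And>i. i < n \<Longrightarrow> test_function (g i)"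
  shows "integrable (cube n) (\<lambda>s. f s * (\<Prod>i<n. potential (g i) (s i)))"
proof -
  obtain B where B: "\<And>s. s \<in> space (cube n) \<Longrightarrow> \<bar>\<Prod>i<n. potential (g i) (s i)\<bar> \<le> B"
    using prod_potential_bounded[of n g] assms(2) by blast
  show ?thesis by (rule integrable_bounded_mult[OF assms(1) prod_potential_measurable[OF assms(2)] B])
qed

lemma integral_test_power:
  assumes "test_function g" "test_function h"
  shows "(LINT s|cube n. (\<Prod>i<n. g (s i)) * (\<Prod>i<n. potential h (s i))) = inner (emb g) (emb h) ^ n"
    and "integrable (cube n) (\<lambda>s. (\<Prod>i<n. g (s i)) * (\<Prod>i<n. potential h (s i)))"
proof -
  have "(LINT s|cube n. (\<Prod>i<n. g (s i) * potential h (s i))) = (\<Prod>i<n. LINT x|unit_leb. g x * potential h x)"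
    unfolding cube_def by (rule unit_prod.product_integral_prod) (auto intro: integrable_test_potential assms)
  then show "(LINT s|cube n. (\<Prod>i<n. g (s i)) * (\<Prod>i<n. potential h (s i))) = inner (emb g) (emb h) ^ n"
    using assms by (simp add: prod.distrib inner_emb)
  have "integrable (cube n) (\<lambda>s. (\<Prod>i<n. g (s i) * potential h (s i)))"
    unfolding cube_def by (rule unit_prod.product_integrable_prod) (auto intro: integrable_test_potential assms)
  then show "integrable (cube n) (\<lambda>s. (\<Prod>i<n. g (s i)) * (\<Prod>i<n. potential h (s i)))"
    by (simp add: prod.distrib)
qed

text \<open>\<open>energy_quadratic_bound\<close> for G a combination of powers of test functions,
  whose energy is the squared norm of the same combination of tensor powers. The analytic inequality
  thus becomes one in the Hilbert space.\<close>

lemma energy_bound_test_combination: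
  fixes g :: "nat \<Rightarrow> real \<Rightarrow> real"
  assumes f: "integrable (cube n) f" "\<And>s. 0 \<le> f s" and C: "energy_form n f f \<le> ennreal C" "0 \<le> C"
    and g: "\<And>a. a < N \<Longrightarrow> test_function (g a)"
  shows "2 * (\<Sum>a<N. c a * (LINT s|cube n. f s * (\<Prod>i<n. potential (g a) (s i)))) \<le>
    C + (norm (\<Sum>a<N. c a *\<^sub>R tens (replicate n (emb (g a)))))\<^sup>2"
proof -
  have "\<forall>a. \<exists>B. a < N \<longrightarrow> (\<forall>x. \<bar>g a x\<bar> \<le> B)" using g test_function_bounded by metis
  then obtain B where B: "\<And>a x. a < N \<Longrightarrow> \<bar>g a x\<bar> \<le> B a" by metis
  define G where "G t = (\<Sum>a<N. c a * (\<Prod>i<n. g a (t i)))" for t :: "nat \<Rightarrow> real"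
  have pm: "(\<lambda>t. \<Prod>i<n. g a (t i)) \<in> borel_measurable (cube n)" if "a < N" for a
    using that g by (intro borel_measurable_prod measurable_compose[OF borel_measurable_coord test_function_measurable]) auto
  have Gm: "G \<in> borel_measurable (cube n)"
    unfolding G_def by (intro borel_measurable_sum borel_measurable_times pm) auto
  have pB: "\<bar>\<Prod>i<n. g a (t i)\<bar> \<le> B a ^ n" if "a < N" for a and t :: "nat \<Rightarrow> real"
  proof -
    have "\<bar>\<Prod>i<n. g a (t i)\<bar> \<le> (\<Prod>i<n. B a)" unfolding abs_prod using B that by (intro prod_mono) auto
    then show ?thesis by simp
  qed
  have GB: "\<bar>G t\<bar> \<le> (\<Sum>a<N. \<bar>c a\<bar> * B a ^ n)" for t
  proof -
    have "\<bar>G t\<bar> \<le> (\<Sum>a<N. \<bar>c a * (\<Prod>i<n. g a (t i))\<bar>)" unfolding G_def by (rule sum_abs)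
    also have "\<dots> \<le> (\<Sum>a<N. \<bar>c a\<bar> * B a ^ n)"
      using pB by (intro sum_mono) (auto simp: abs_mult intro!: mult_left_mono)
    finally show ?thesis .
  qed
  have kG: "kern n G s = (\<Sum>a<N. c a * (\<Prod>i<n. potential (g a) (s i)))" if s: "s \<in> space (cube n)" for s
  proof -
    have "kern n G s = (LINT t|cube n. (\<Sum>a<N. c a * ((\<Prod>i<n. g a (t i)) * frac_kernel H n s t)))"
      unfolding kern_def G_def by (simp add: sum_distrib_right mult.assoc)
    also have "\<dots> = (\<Sum>a<N. c a * kern n (\<lambda>t. \<Prod>i<n. g a (t i)) s)"
    proof (subst Bochner_Integration.integral_sum)
      fix a assume "a \<in> {..<N}"
      then show "integrable (cube n) (\<lambda>t. c a * ((\<Prod>i<n. g a (t i)) * frac_kernel H n s t))"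
        using integrable_kern[OF pm pB s] by (intro integrable_mult_right) auto
    qed (simp add: kern_def)
    also have "\<dots> = (\<Sum>a<N. c a * (\<Prod>i<n. potential (g a) (s i)))"
    proof (intro sum.cong refl arg_cong2[where f = times])
      fix a assume a: "a \<in> {..<N}"
      show "kern n (\<lambda>t. \<Prod>i<n. g a (t i)) s = (\<Prod>i<n. potential (g a) (s i))"
        using a B by (intro kern_prod[OF _ _ s, where B = "\<lambda>_. B a"] test_function_measurable g) auto
    qed
    finally show ?thesis .
  qed
  have "(LINT s|cube n. f s * kern n G s) = (LINT s|cube n. (\<Sum>a<N. c a * (f s * (\<Prod>i<n. potential (g a) (s i)))))"
    by (intro Bochner_Integration.integral_cong refl) (simp add: kG sum_distrib_left ac_simps)
  also have "\<dots> = (\<Sum>a<N. c a * (LINT s|cube n. f s * (\<Prod>i<n. potential (g a) (s i))))"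
    using g by (subst Bochner_Integration.integral_sum) (auto intro!: integrable_mult_right integrable_prod_potential f)
  finally have 1: "(LINT s|cube n. f s * kern n G s) = (\<Sum>a<N. c a * (LINT s|cube n. f s * (\<Prod>i<n. potential (g a) (s i))))" .
  have "(LINT s|cube n. G s * kern n G s) =
      (LINT s|cube n. (\<Sum>a<N. \<Sum>b<N. c a * c b * ((\<Prod>i<n. g a (s i)) * (\<Prod>i<n. potential (g b) (s i)))))"
    by (intro Bochner_Integration.integral_cong refl) (simp add: kG G_def sum_product ac_simps)
  also have "\<dots> = (\<Sum>a<N. \<Sum>b<N. c a * c b * inner (emb (g a)) (emb (g b)) ^ n)"
  proof -
    have int: "integrable (cube n) (\<lambda>s. c a * c b * ((\<Prod>i<n. g a (s i)) * (\<Prod>i<n. potential (g b) (s i))))" if "a < N" "b < N" for a b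
      using that by (intro integrable_mult_right integral_test_power g)
    have "(LINT s|cube n. (\<Sum>a<N. \<Sum>b<N. c a * c b * ((\<Prod>i<n. g a (s i)) * (\<Prod>i<n. potential (g b) (s i))))) =
        (\<Sum>a<N. LINT s|cube n. (\<Sum>b<N. c a * c b * ((\<Prod>i<n. g a (s i)) * (\<Prod>i<n. potential (g b) (s i)))))"
      by (intro Bochner_Integration.integral_sum Bochner_Integration.integrable_sum int) auto
    also have "\<dots> = (\<Sum>a<N. \<Sum>b<N. LINT s|cube n. c a * c b * ((\<Prod>i<n. g a (s i)) * (\<Prod>i<n. potential (g b) (s i))))"
      by (intro sum.cong refl Bochner_Integration.integral_sum int) auto
    also have "\<dots> = (\<Sum>a<N. \<Sum>b<N. c a * c b * inner (emb (g a)) (emb (g b)) ^ n)"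
      using g by (intro sum.cong refl) (simp add: integral_test_power)
    finally show ?thesis .
  qed
  also have "\<dots> = (norm (\<Sum>a<N. c a *\<^sub>R tens (replicate n (emb (g a)))))\<^sup>2"
    by (simp add: power2_norm_eq_inner inner_sum_left inner_sum_right inner_tens_power sum_distrib_left mult.assoc)
      (intro sum.cong refl, simp add: inner_commute)
  finally have 2: "(LINT s|cube n. G s * kern n G s) = (norm (\<Sum>a<N. c a *\<^sub>R tens (replicate n (emb (g a)))))\<^sup>2" .
  show ?thesis
    using energy_quadratic_bound[OF f C Gm GB] unfolding 1 2 .
qed

text \<open>Permuting the variables of integration moves the permutation from the potentials to f,
  which is symmetric.\<close>

lemma sum_permutes_potential:
  assumes f: "integrable (cube n) f" and sym: "\<And>p t. p permutes {..<n} \<Longrightarrow> f (t \<circ> p) = f t"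
    and g: "\<And>i. i < n \<Longrightarrow> test_function (g i)" and p: "p permutes {..<n}"
  shows "(LINT s|cube n. f s * (\<Prod>i<n. potential (g (p i)) (s i))) = (LINT s|cube n. f s * (\<Prod>i<n. potential (g i) (s i)))"
proof -
  have q: "inv p permutes {..<n}" using p by (rule permutes_inv)
  have "(\<Prod>i<n. potential (g (p i)) (s i)) = (\<Prod>i<n. potential (g i) ((s \<circ> inv p) i))" for s
  proof -
    have "(\<Prod>i<n. potential (g i) ((s \<circ> inv p) i)) = (\<Prod>i<n. potential (g (p i)) ((s \<circ> inv p) (p i)))"
      by (rule prod.permute[OF p, unfolded comp_def])
    then show ?thesis by (simp add: permutes_inverses[OF p])
  qed
  then have "(LINT s|cube n. f s * (\<Prod>i<n. potential (g (p i)) (s i))) =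
      (LINT s|cube n. f (s \<circ> inv p) * (\<Prod>i<n. potential (g i) ((s \<circ> inv p) i)))"
    by (simp only: sym[OF q])
  also have "\<dots> = (LINT s|cube n. f s * (\<Prod>i<n. potential (g i) (s i)))"
    by (rule integral_permute[OF q]) (use f prod_potential_measurable[OF g] in \<open>auto intro: borel_measurable_times\<close>)
  finally show ?thesis .
qed

text \<open>The functional is prescribed only on powers of single test functions. This keeps x in
  the closed span of powers, as \<open>exists_wiener_int\<close> requires, and the values on general
  tensors are then derived from the symmetry of f.\<close>

lemma exists_representer:
  assumes f: "integrable (cube n) f" "\<And>s. 0 \<le> f s" and C: "energy_form n f f \<le> ennreal C" "0 \<le> C"
    and sym: "\<And>p t. p permutes {..<n} \<Longrightarrow> f (t \<circ> p) = f t"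
  obtains x where "represents H emb tens n f x" "(norm x)\<^sup>2 \<le> C"
    "x \<in> closure (span (range (\<lambda>h. tens (replicate n h))))"
proof -
  let ?F = "\<lambda>g. (tens (replicate n (emb g)), LINT s|cube n. f s * (\<Prod>i<n. potential g (s i)))"
  define P where "P = span (?F ` Collect test_function)"
  have "- C \<le> (norm v)\<^sup>2 - 2 * b" if vbP: "(v, b) \<in> P" for v b
  proof -
    obtain N :: nat and c g where g: "\<forall>i<N. g i \<in> Collect test_function" and vb: "(v, b) = (\<Sum>i<N. c i *\<^sub>R ?F (g i))"
      using span_image_explicit[OF vbP[unfolded P_def]] by blast
    have "v = (\<Sum>i<N. c i *\<^sub>R tens (replicate n (emb (g i))))"
      using arg_cong[OF vb, of fst] by (simp add: fst_sum)
    moreover have "b = (\<Sum>i<N. c i * (LINT s|cube n. f s * (\<Prod>j<n. potential (g i) (s j))))"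
      using arg_cong[OF vb, of snd] by (simp add: snd_sum)
    ultimately show ?thesis using energy_bound_test_combination[OF f C, of N g c] g by simp
  qed
  moreover have "subspace P" unfolding P_def by (rule subspace_span)
  ultimately obtain x where x: "x \<in> closure (fst ` P)" "\<And>v b. (v, b) \<in> P \<Longrightarrow> inner x v = b" "(norm x)\<^sup>2 \<le> C"
    using riesz_on_subspace[of P C] by blast
  have fstP: "fst ` P \<subseteq> span (range (\<lambda>h. tens (replicate n h)))"
  proof -
    have "fst v \<in> span (range (\<lambda>h. tens (replicate n h)))" if vP: "v \<in> P" for v
    proof -
      obtain N :: nat and c g where g: "v = (\<Sum>i<N. c i *\<^sub>R ?F (g i))"
        using span_image_explicit[OF vP[unfolded P_def]] by blast
      show ?thesis unfolding g fst_sum by (intro span_sum) (simp add: span_scale span_base)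
    qed
    then show ?thesis by blast
  qed
  have x_closure: "x \<in> closure (span (range (\<lambda>h. tens (replicate n h))))"
    using x(1) closure_mono[OF fstP] by blast
  have tp: "x \<in> tensor_power tens n"
  proof -
    have "range (\<lambda>h. tens (replicate n h)) \<subseteq> tens ` {xs. length xs = n}" by auto
    from closure_mono[OF span_mono[OF this]] show ?thesis using x_closure by (auto simp: tensor_power_def)
  qed
  have diag: "inner x (tens (replicate n (emb g))) = (LINT s|cube n. f s * (\<Prod>i<n. potential g (s i)))" if "test_function g" for g
    using that by (intro x(2)) (auto simp: P_def intro!: span_base)
  have inn: "inner x (tens (map emb gs)) = (LINT s|cube n. f s * (\<Prod>i<n. potential (gs ! i) (s i)))"
    if len: "length gs = n" and tf: "\<forall>g\<in>set gs. test_function g" for gs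
  proof -
    let ?S = "Pow {..<n}"
    have t: "test_function (gs ! i)" if "i < n" for i using tf len that by auto
    define G where "G S = (\<lambda>y. \<Sum>j\<in>S. (gs ! j) y)" for S
    have fin: "finite S" if "S \<in> ?S" for S using that finite_subset by auto
    have tG: "test_function (G S)" if "S \<in> ?S" for S
      unfolding G_def using fin[OF that] that t by (intro test_function_sum) auto
    have embG: "emb (G S) = (\<Sum>j\<in>S. emb (gs ! j))" if "S \<in> ?S" for S
      unfolding G_def using fin[OF that] that t by (intro emb_sum) auto
    have potG: "potential (G S) y = (\<Sum>j\<in>S. potential (gs ! j) y)" if "S \<in> ?S" "y \<in> {0..1}" for S y
      unfolding G_def using fin[OF that(1)] that t by (intro potential_sum) auto
    let ?sg = "\<lambda>S. (-1) ^ card ({..<n} - S) :: real"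
    have cardp: "card {p. p permutes {..<n}} = fact n" by (intro card_permutations) auto
    \<comment> \<open>Ryser's formula writes the symmetrization of \<open>gs\<close> as a combination of powers of partial sums.\<close>
    let ?V = "fact n *\<^sub>R tens (map emb gs) - (\<Sum>S\<in>?S. ?sg S *\<^sub>R tens (replicate n (emb (G S))))"
    have "inner ?V (tens (replicate n w)) = 0" for w
    proof -
      have "inner (tens (replicate n w)) (\<Sum>S\<in>?S. ?sg S *\<^sub>R tens (replicate n (emb (G S)))) =
          (\<Sum>S\<in>?S. ?sg S * (\<Prod>i<n. \<Sum>j\<in>S. inner w (emb (gs ! j))))"
        by (simp add: inner_sum_right inner_tens_power embG)
      also have "\<dots> = (\<Sum>p | p permutes {..<n}. \<Prod>i<n. inner w (emb (gs ! (p i))))"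
        by (rule ryser_formula)
      also have "\<dots> = (\<Sum>p | p permutes {..<n}. \<Prod>i<n. inner w (emb (gs ! i)))"
      proof (intro sum.cong refl)
        fix p assume "p \<in> {p. p permutes {..<n}}"
        then show "(\<Prod>i<n. inner w (emb (gs ! (p i)))) = (\<Prod>i<n. inner w (emb (gs ! i)))"
          using prod.permute[of p "{..<n}" "\<lambda>i. inner w (emb (gs ! i))"] by (simp add: comp_def)
      qed
      also have "\<dots> = fact n * inner (tens (replicate n w)) (tens (map emb gs))"
        using len by (simp add: cardp inner_tens_power_left)
      finally have "inner (tens (replicate n w)) ?V = 0" by (simp add: inner_diff_right)
      then show ?thesis by (subst inner_commute)
    qed
    \<comment> \<open>\<open>?V\<close> is orthogonal to all powers, hence to the closed span in
      which x lies: x does not distinguish n! times the tensor from the Ryser combination of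
      powers.\<close>
    then have "span (range (\<lambda>h. tens (replicate n h))) \<subseteq> {w. inner ?V w = 0}"
      by (intro span_minimal subspace_hyperplane) auto
    then have "closure (span (range (\<lambda>h. tens (replicate n h)))) \<subseteq> {w. inner ?V w = 0}"
      by (intro closure_minimal closed_hyperplane)
    then have "inner ?V x = 0" using x_closure by blast
    then have "inner x ?V = 0" by (subst inner_commute)
    then have "fact n * inner x (tens (map emb gs)) = (\<Sum>S\<in>?S. ?sg S * inner x (tens (replicate n (emb (G S)))))"
      by (simp add: inner_diff_right inner_sum_right)
    also have "\<dots> = (\<Sum>S\<in>?S. ?sg S * (LINT s|cube n. f s * (\<Prod>i<n. potential (G S) (s i))))"
      by (intro sum.cong refl) (simp add: diag tG)
    also have "\<dots> = (LINT s|cube n. (\<Sum>S\<in>?S. ?sg S * (f s * (\<Prod>i<n. potential (G S) (s i)))))"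
      by (subst Bochner_Integration.integral_sum) (auto intro!: integrable_mult_right integrable_prod_potential f tG)
    \<comment> \<open>Ryser's formula a second time, now pointwise with potentials in place of inner
      products. It returns a sum over permutations whose n! integrals are all equal.\<close>
    also have "\<dots> = (LINT s|cube n. (\<Sum>p | p permutes {..<n}. f s * (\<Prod>i<n. potential (gs ! (p i)) (s i))))"
    proof (rule Bochner_Integration.integral_cong[OF refl])
      fix s assume s: "s \<in> space (cube n)"
      have "(\<Sum>S\<in>?S. ?sg S * (f s * (\<Prod>i<n. potential (G S) (s i)))) = f s * (\<Sum>S\<in>?S. ?sg S * (\<Prod>i<n. \<Sum>j\<in>S. potential (gs ! j) (s i)))"
        unfolding sum_distrib_left using space_cubeD[OF s] by (intro sum.cong refl) (simp add: potG)
      also have "\<dots> = f s * (\<Sum>p | p permutes {..<n}. \<Prod>i<n. potential (gs ! (p i)) (s i))"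
        by (simp only: ryser_formula)
      finally show "(\<Sum>S\<in>?S. ?sg S * (f s * (\<Prod>i<n. potential (G S) (s i)))) =
          (\<Sum>p | p permutes {..<n}. f s * (\<Prod>i<n. potential (gs ! (p i)) (s i)))"
        by (simp add: sum_distrib_left)
    qed
    also have "\<dots> = (\<Sum>p | p permutes {..<n}. LINT s|cube n. f s * (\<Prod>i<n. potential (gs ! (p i)) (s i)))"
    proof (rule Bochner_Integration.integral_sum)
      fix p assume p: "p \<in> {p. p permutes {..<n}}"
      show "integrable (cube n) (\<lambda>s. f s * (\<Prod>i<n. potential (gs ! (p i)) (s i)))"
        using p permutes_in_image[of p "{..<n}"] by (intro integrable_prod_potential f t) auto
    qed
    also have "\<dots> = (\<Sum>p | p permutes {..<n}. LINT s|cube n. f s * (\<Prod>i<n. potential (gs ! i) (s i)))"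
      using sum_permutes_potential[OF f(1) sym, of "\<lambda>i. gs ! i"] t by (intro sum.cong refl) auto
    also have "\<dots> = fact n * (LINT s|cube n. f s * (\<Prod>i<n. potential (gs ! i) (s i)))"
      by (simp add: cardp)
    finally show ?thesis by simp
  qed
  have fm [measurable]: "f \<in> borel_measurable (cube n)" using f(1) by auto
  have "represents H emb tens n f x"
    unfolding represents_def
  proof (intro conjI allI impI)
    show "integrable (cube n \<Otimes>\<^sub>M cube n) (\<lambda>(s, t). \<bar>f s\<bar> * \<bar>f t\<bar> * frac_kernel H n s t)"
    proof (rule integrableI_nonneg)
      have "(\<integral>\<^sup>+z. ennreal (case z of (s, t) \<Rightarrow> \<bar>f s\<bar> * \<bar>f t\<bar> * frac_kernel H n s t) \<partial>(cube n \<Otimes>\<^sub>M cube n)) = energy_form n f f"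
        unfolding energy_form_def
        by (subst cube.nn_integral_fst[symmetric]) (simp_all add: split_beta' f(2) ennreal_mult)
      then show "(\<integral>\<^sup>+z. ennreal (case z of (s, t) \<Rightarrow> \<bar>f s\<bar> * \<bar>f t\<bar> * frac_kernel H n s t) \<partial>(cube n \<Otimes>\<^sub>M cube n)) < \<infinity>"
        using C(1) by (simp add: le_less_trans)
    qed (auto simp: split_beta')
    show "inner x (tens (map emb gs)) = (LINT s|cube n. LINT t|cube n. f s * (\<Prod>i<n. (gs ! i) (t i)) * frac_kernel H n s t)"
      if "length gs = n" "\<forall>g\<in>set gs. test_function g" for gs
      using inn[OF that] represents_integral[OF that] by simp
  qed (use fm tp in auto)
  then show ?thesis using that x(3) x_closure by blast
qed

end

section \<open>Wiener and Stratonovich integrals\<close>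

locale wiener_setting = tensor_setting H emb tens
  for H :: real and emb :: "(real \<Rightarrow> real) \<Rightarrow> 'h::{real_inner,complete_space}"
    and tens :: "'h list \<Rightarrow> 'k::{real_inner,complete_space}" +
  fixes M :: "'p measure" and W :: "'h \<Rightarrow> 'p \<Rightarrow> real"
  assumes isonormal: "isonormal M W"
begin

sublocale prob_space M using isonormal by (simp add: isonormal_def)

lemma gaussian_pair_W:
  assumes "norm g = 1" "norm h = 1"
  shows "gaussian_pair M (W g) (W h) (inner g h)"
proof
  show "centered_gaussian M (\<lambda>\<omega>. a * W g \<omega> + b * W h \<omega>)" for a b
  proof -
    have "\<forall>(n::nat) c h. centered_gaussian M (\<lambda>\<omega>. \<Sum>i<n. c i * W (h i) \<omega>)"
      using isonormal by (simp add: isonormal_def)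
    from this[rule_format, of "\<lambda>i. if i = 0 then a else b" "\<lambda>i. if i = 0 then g else h" 2]
    show ?thesis by (simp add: numeral_2_eq_2)
  qed
  have E: "(LINT \<omega>|M. W f \<omega> * W f' \<omega>) = inner f f'" for f f' using isonormal by (simp add: isonormal_def)
  show "(LINT \<omega>|M. W g \<omega> * W h \<omega>) = inner g h" by (rule E)
  show "(LINT \<omega>|M. (W g \<omega>)\<^sup>2) = 1" "(LINT \<omega>|M. (W h \<omega>)\<^sup>2) = 1"
    using E[of g g] E[of h h] assms by (simp_all add: power2_eq_square dot_square_norm)
qed

text \<open>The Wiener integral of \<open>tsum\<close> with the same data, for unit vectors g
  i.\<close>

definition hsum :: "nat \<Rightarrow> nat \<Rightarrow> (nat \<Rightarrow> real) \<Rightarrow> (nat \<Rightarrow> 'h) \<Rightarrow> 'p \<Rightarrow> real" where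
  "hsum m N c g \<omega> = (\<Sum>i<N. c i * hermite m (W (g i) \<omega>))"

definition tsum :: "nat \<Rightarrow> nat \<Rightarrow> (nat \<Rightarrow> real) \<Rightarrow> (nat \<Rightarrow> 'h) \<Rightarrow> 'k" where
  "tsum m N c g = (\<Sum>i<N. c i *\<^sub>R tens (replicate m (g i)))"

lemma hermite_W_measurable: "norm g = 1 \<Longrightarrow> (\<lambda>\<omega>. hermite m (W g \<omega>)) \<in> borel_measurable M"
  using gaussian_pair.hermite_pair_integrable[OF gaussian_pair_W[of g g], of m 0]
  by (simp add: hermite_eq_poly[of 0] integrable_iff_bounded)

lemma hsum_measurable: "\<forall>i<N. norm (g i) = 1 \<Longrightarrow> hsum m N c g \<in> borel_measurable M"
  unfolding hsum_def by (intro borel_measurable_sum borel_measurable_times hermite_W_measurable) auto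

text \<open>By bilinearity this is \<open>hermite_orthogonal\<close>: the powers of inner products
  appearing there are the inner products of tensor powers.\<close>

lemma hsum_product:
  assumes g: "\<forall>i<N. norm (g i) = 1" and h: "\<forall>i<N'. norm (h i) = 1"
  shows "integrable M (\<lambda>\<omega>. hsum m N c g \<omega> * hsum n N' d h \<omega>)"
    and "(LINT \<omega>|M. hsum m N c g \<omega> * hsum n N' d h \<omega>) =
      (if m = n then fact m * inner (tsum m N c g) (tsum n N' d h) else 0)"
proof -
  have eq: "hsum m N c g \<omega> * hsum n N' d h \<omega> =
      (\<Sum>i<N. \<Sum>j<N'. c i * d j * (hermite m (W (g i) \<omega>) * hermite n (W (h j) \<omega>)))" for \<omega>
    unfolding hsum_def sum_product by (simp add: ac_simps)
  have int: "integrable M (\<lambda>\<omega>. c i * d j * (hermite m (W (g i) \<omega>) * hermite n (W (h j) \<omega>)))" if "i < N" "j < N'" for i j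
    using that g h by (intro integrable_mult_right gaussian_pair.hermite_pair_integrable[OF gaussian_pair_W]) auto
  show "integrable M (\<lambda>\<omega>. hsum m N c g \<omega> * hsum n N' d h \<omega>)"
    unfolding eq by (intro Bochner_Integration.integrable_sum int) auto
  have "(LINT \<omega>|M. hsum m N c g \<omega> * hsum n N' d h \<omega>) =
      (\<Sum>i<N. LINT \<omega>|M. (\<Sum>j<N'. c i * d j * (hermite m (W (g i) \<omega>) * hermite n (W (h j) \<omega>))))"
    unfolding eq by (intro Bochner_Integration.integral_sum Bochner_Integration.integrable_sum int) auto
  also have "\<dots> = (\<Sum>i<N. \<Sum>j<N'. LINT \<omega>|M. c i * d j * (hermite m (W (g i) \<omega>) * hermite n (W (h j) \<omega>)))"
    by (intro sum.cong refl Bochner_Integration.integral_sum int) auto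
  also have "\<dots> = (\<Sum>i<N. \<Sum>j<N'. c i * d j * (if m = n then fact m * inner (g i) (h j) ^ m else 0))"
    using g h by (intro sum.cong refl) (simp add: gaussian_pair.hermite_orthogonal[OF gaussian_pair_W])
  also have "\<dots> = (if m = n then fact m * inner (tsum m N c g) (tsum n N' d h) else 0)"
    by (auto simp: tsum_def inner_sum_left inner_sum_right inner_tens_power sum_distrib_left ac_simps inner_commute
        intro!: sum.swap[THEN trans] sum.cong)
  finally show "(LINT \<omega>|M. hsum m N c g \<omega> * hsum n N' d h \<omega>) =
      (if m = n then fact m * inner (tsum m N c g) (tsum n N' d h) else 0)" .
qed

text \<open>The distance in mean square depends only on the tensors, so approximating a tensor in
  norm yields a Cauchy sequence of random variables.\<close>

lemma hsum_diff_norm: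
  assumes g: "\<forall>i<N. norm (g i) = 1" and h: "\<forall>i<N'. norm (h i) = 1"
  shows "(\<integral>\<^sup>+\<omega>. ennreal ((hsum m N c g \<omega> - hsum m N' d h \<omega>)\<^sup>2) \<partial>M) =
    ennreal (fact m * (norm (tsum m N c g - tsum m N' d h))\<^sup>2)"
proof -
  let ?A = "hsum m N c g" and ?B = "hsum m N' d h"
  have eq: "(?A \<omega> - ?B \<omega>)\<^sup>2 = ?A \<omega> * ?A \<omega> - 2 * (?A \<omega> * ?B \<omega>) + ?B \<omega> * ?B \<omega>" for \<omega>
    by (simp add: power2_eq_square algebra_simps)
  note i = hsum_product(1)[OF g g, of m c m c] hsum_product(1)[OF g h, of m c m d] hsum_product(1)[OF h h, of m d m d]
  have int: "integrable M (\<lambda>\<omega>. (?A \<omega> - ?B \<omega>)\<^sup>2)"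
    unfolding eq by (intro Bochner_Integration.integrable_add Bochner_Integration.integrable_diff integrable_mult_right i)
  have "(LINT \<omega>|M. (?A \<omega> - ?B \<omega>)\<^sup>2) =
      (LINT \<omega>|M. ?A \<omega> * ?A \<omega>) - 2 * (LINT \<omega>|M. ?A \<omega> * ?B \<omega>) + (LINT \<omega>|M. ?B \<omega> * ?B \<omega>)"
    unfolding eq using i by simp
  also have "\<dots> = fact m * (norm (tsum m N c g - tsum m N' d h))\<^sup>2"
    by (simp add: hsum_product(2)[OF g g] hsum_product(2)[OF g h] hsum_product(2)[OF h h] power2_norm_eq_inner
        inner_diff inner_commute algebra_simps)
  finally show ?thesis using int by (simp add: nn_integral_eq_integral)
qed

lemma exists_wiener_int:
  assumes x: "x \<in> closure (span (range (\<lambda>h. tens (replicate n h))))"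
  shows "\<exists>X. is_wiener_int M W tens n x X"
proof -
  have "x \<in> closure (span ((\<lambda>h. tens (replicate n h)) ` {h. norm h = 1}))"
    using x closure_mono[OF span_tens_power_unit[of n]] by blast
  then have approx: "\<forall>\<epsilon>>0. \<exists>y\<in>span ((\<lambda>h. tens (replicate n h)) ` {h. norm h = 1}). dist y x < \<epsilon>"
    by (simp only: closure_approachable)
  \<comment> \<open>Approximation at rate 2^(-k) makes squared distances of order 4^(-k), the rate
    expected by \<open>L2_limit_exists\<close>.\<close>
  have "\<exists>N c g. (\<forall>i<N. norm (g i) = 1) \<and> dist (tsum n N c g) x < (1/2) ^ k" for k :: nat
  proof -
    obtain y where y: "y \<in> span ((\<lambda>h. tens (replicate n h)) ` {h. norm h = 1})" "dist y x < (1/2) ^ k"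
      using approx[rule_format, of "(1/2) ^ k"] by auto
    obtain N :: nat and c g where "\<forall>i<N. g i \<in> {h. norm h = 1}" "y = (\<Sum>i<N. c i *\<^sub>R tens (replicate n (g i)))"
      using span_image_explicit[OF y(1)] by blast
    then show ?thesis using y(2) by (intro exI[of _ N] exI[of _ c] exI[of _ g]) (simp add: tsum_def)
  qed
  then obtain N c g where *: "\<And>k :: nat. \<forall>i<N k. norm (g k i) = 1" "\<And>k. dist (tsum n (N k) (c k) (g k)) x < (1/2) ^ k"
    by metis
  define v where "v k = tsum n (N k) (c k) (g k)" for k
  have vx: "norm (v k - x) < (1/2) ^ k" for k using *(2)[of k] by (simp add: v_def dist_norm)
  define Y where "Y k = hsum n (N k) (c k) (g k)" for k
  have Ym: "Y k \<in> borel_measurable M" for k unfolding Y_def by (rule hsum_measurable[OF *(1)])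
  have cau: "(\<integral>\<^sup>+\<omega>. ennreal ((Y k \<omega> - Y l \<omega>)\<^sup>2) \<partial>M) \<le> ennreal (4 * fact n * (1/4) ^ k)" if "k \<le> l" for k l
  proof -
    have "norm (v k - v l) \<le> norm (v k - x) + norm (v l - x)"
      using norm_triangle_ineq4[of "v k - x" "v l - x"] by simp
    also have "\<dots> \<le> (1/2) ^ k + (1/2) ^ l" using vx[of k] vx[of l] by linarith
    also have "\<dots> \<le> 2 * (1/2) ^ k" using power_decreasing[OF that, of "1/2 :: real"] by simp
    finally have "(norm (v k - v l))\<^sup>2 \<le> (2 * (1/2) ^ k)\<^sup>2" by (intro power_mono) auto
    also have "\<dots> = 4 * (1/4) ^ k" by (simp add: power_mult_distrib power2_eq_square flip: power_mult_distrib)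
    finally have "fact n * (norm (v k - v l))\<^sup>2 \<le> 4 * fact n * (1/4) ^ k"
      using mult_left_mono[of "(norm (v k - v l))\<^sup>2" "4 * (1/4) ^ k" "fact n"] by simp
    then show ?thesis unfolding Y_def hsum_diff_norm[OF *(1) *(1)] v_def[symmetric] by (rule ennreal_leI)
  qed
  obtain X where X: "X \<in> borel_measurable M" "(\<lambda>k. \<integral>\<^sup>+\<omega>. ennreal ((Y k \<omega> - X \<omega>)\<^sup>2) \<partial>M) \<longlonglongrightarrow> 0"
    using L2_limit_exists[OF prob_space_axioms Ym _ cau] by auto
  have "v \<longlonglongrightarrow> x"
  proof -
    have "(\<lambda>k. norm (v k - x)) \<longlonglongrightarrow> 0"
    proof (rule tendsto_sandwich[OF _ _ tendsto_const])
      show "(\<lambda>k. (1/2 :: real) ^ k) \<longlonglongrightarrow> 0" by (rule LIMSEQ_power_zero) simp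
    qed (use vx in \<open>auto intro!: always_eventually less_imp_le\<close>)
    then show ?thesis using LIM_zero_iff tendsto_norm_zero_iff by blast
  qed
  then have "is_wiener_int M W tens n x X"
    unfolding is_wiener_int_def
    using X *(1) by (intro conjI exI[of _ N] exI[of _ c] exI[of _ g]) (simp_all add: Y_def hsum_def v_def[abs_def] tsum_def)
  then show ?thesis by blast
qed

text \<open>Different indices have different orders, so the cross terms of the approximating sums
  vanish; the estimate then passes to the limit. It holds for every version of the integrals, hence
  for the one picked by \<open>SOME\<close>.\<close>

lemma wiener_int_sum_bound:
  fixes X :: "nat \<Rightarrow> 'p \<Rightarrow> real"
  assumes J: "finite J" "inj_on ord J" and X: "\<And>j. j \<in> J \<Longrightarrow> is_wiener_int M W tens (ord j) (x j) (X j)"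
  shows "(\<integral>\<^sup>+\<omega>. ennreal ((\<Sum>j\<in>J. a j * X j \<omega>)\<^sup>2) \<partial>M) \<le> ennreal (\<Sum>j\<in>J. (a j)\<^sup>2 * (fact (ord j) * (norm (x j))\<^sup>2))"
proof -
  have Xm [measurable]: "X j \<in> borel_measurable M" if "j \<in> J" for j using X[OF that] by (simp add: is_wiener_int_def)
  define approx where "approx j N c g \<longleftrightarrow>
      (\<forall>k. \<forall>i<N k. norm (g k i) = 1) \<and> (\<lambda>k. tsum (ord j) (N k) (c k) (g k)) \<longlonglongrightarrow> x j \<and>
      (\<lambda>k. \<integral>\<^sup>+\<omega>. ennreal ((hsum (ord j) (N k) (c k) (g k) \<omega> - X j \<omega>)\<^sup>2) \<partial>M) \<longlonglongrightarrow> 0"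
    for j and N :: "nat \<Rightarrow> nat" and c :: "nat \<Rightarrow> nat \<Rightarrow> real" and g :: "nat \<Rightarrow> nat \<Rightarrow> 'h"
  have "\<exists>N c g. approx j N c g" if "j \<in> J" for j
    using X[OF that] unfolding is_wiener_int_def approx_def tsum_def hsum_def by (elim conjE)
  then obtain N c g where approx: "\<And>j. j \<in> J \<Longrightarrow> approx j (N j) (c j) (g j)" by metis
  have *: "\<forall>i<N j k. norm (g j k i) = 1"
      "(\<lambda>k. tsum (ord j) (N j k) (c j k) (g j k)) \<longlonglongrightarrow> x j"
      "(\<lambda>k. \<integral>\<^sup>+\<omega>. ennreal ((hsum (ord j) (N j k) (c j k) (g j k) \<omega> - X j \<omega>)\<^sup>2) \<partial>M) \<longlonglongrightarrow> 0"
    if "j \<in> J" for j k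
    using approx[OF that] unfolding approx_def by simp_all
  define Y where "Y j k = hsum (ord j) (N j k) (c j k) (g j k)" for j k
  define v where "v j k = tsum (ord j) (N j k) (c j k) (g j k)" for j k
  have Ym [measurable]: "Y j k \<in> borel_measurable M" if "j \<in> J" for j k
    unfolding Y_def by (rule hsum_measurable[OF *(1)[OF that]])
  define Z where "Z k \<omega> = (\<Sum>j\<in>J. a j * Y j k \<omega>)" for k \<omega>
  define U where "U \<omega> = (\<Sum>j\<in>J. a j * X j \<omega>)" for \<omega>
  have [measurable]: "Z k \<in> borel_measurable M" "U \<in> borel_measurable M" for k
    unfolding Z_def U_def by measurable
  define q where "q k = (\<Sum>j\<in>J. (a j)\<^sup>2 * (fact (ord j) * (norm (v j k))\<^sup>2))" for k
  define Q where "Q = (\<Sum>j\<in>J. (a j)\<^sup>2 * (fact (ord j) * (norm (x j))\<^sup>2))"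
  have Q0: "0 \<le> Q" "0 \<le> q k" for k unfolding Q_def q_def by (auto intro!: sum_nonneg)
  have qQ: "q \<longlonglongrightarrow> Q" unfolding q_def Q_def v_def by (intro tendsto_intros *(2))
  have Z2: "(\<integral>\<^sup>+\<omega>. ennreal ((Z k \<omega>)\<^sup>2) \<partial>M) = ennreal (q k)" for k
  proof -
    have eq: "(Z k \<omega>)\<^sup>2 = (\<Sum>i\<in>J. \<Sum>j\<in>J. a i * a j * (Y i k \<omega> * Y j k \<omega>))" for \<omega>
      unfolding Z_def power2_eq_square sum_product by (simp add: ac_simps)
    have int: "integrable M (\<lambda>\<omega>. a i * a j * (Y i k \<omega> * Y j k \<omega>))" if "i \<in> J" "j \<in> J" for i j
      unfolding Y_def by (intro integrable_mult_right hsum_product(1) *(1) that)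
    have "(LINT \<omega>|M. (Z k \<omega>)\<^sup>2) = (\<Sum>i\<in>J. LINT \<omega>|M. (\<Sum>j\<in>J. a i * a j * (Y i k \<omega> * Y j k \<omega>)))"
      unfolding eq by (intro Bochner_Integration.integral_sum Bochner_Integration.integrable_sum int)
    also have "\<dots> = (\<Sum>i\<in>J. \<Sum>j\<in>J. LINT \<omega>|M. a i * a j * (Y i k \<omega> * Y j k \<omega>))"
      by (intro sum.cong refl Bochner_Integration.integral_sum int)
    also have "\<dots> = (\<Sum>i\<in>J. \<Sum>j\<in>J. if j = i then (a i)\<^sup>2 * (fact (ord i) * (norm (v i k))\<^sup>2) else 0)"
    proof (intro sum.cong refl)
      fix i j assume ij: "i \<in> J" "j \<in> J"
      then have "ord i = ord j \<longleftrightarrow> i = j" using J(2) by (auto dest: inj_onD)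
      then show "(LINT \<omega>|M. a i * a j * (Y i k \<omega> * Y j k \<omega>)) =
          (if j = i then (a i)\<^sup>2 * (fact (ord i) * (norm (v i k))\<^sup>2) else 0)"
        unfolding Y_def v_def using hsum_product(2)[OF *(1)[OF ij(1)] *(1)[OF ij(2)]]
        by (auto simp: dot_square_norm power2_eq_square)
    qed
    also have "\<dots> = q k" using J(1) by (simp add: q_def)
    finally have "(LINT \<omega>|M. (Z k \<omega>)\<^sup>2) = q k" .
    moreover have "integrable M (\<lambda>\<omega>. (Z k \<omega>)\<^sup>2)"
      unfolding eq by (intro Bochner_Integration.integrable_sum int)
    ultimately show ?thesis by (simp add: nn_integral_eq_integral)
  qed
  \<comment> \<open>The Cauchy-Schwarz inequality for a sum of \<open>card J\<close> terms bounds
    the error of the total by the errors of its parts.\<close>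
  define r where "r k = (\<Sum>j\<in>J. ennreal (real (card J) * (a j)\<^sup>2) * (\<integral>\<^sup>+\<omega>. ennreal ((Y j k \<omega> - X j \<omega>)\<^sup>2) \<partial>M))" for k
  have "r \<longlonglongrightarrow> (\<Sum>j\<in>J. ennreal (real (card J) * (a j)\<^sup>2) * 0)"
    unfolding r_def Y_def by (intro tendsto_sum ennreal_tendsto_cmult *(3)) auto
  then have r0: "r \<longlonglongrightarrow> 0" by simp
  have ZU: "(\<integral>\<^sup>+\<omega>. ennreal ((U \<omega> - Z k \<omega>)\<^sup>2) \<partial>M) \<le> r k" for k
  proof -
    have pt: "(U \<omega> - Z k \<omega>)\<^sup>2 \<le> (\<Sum>j\<in>J. real (card J) * (a j)\<^sup>2 * (Y j k \<omega> - X j \<omega>)\<^sup>2)" for \<omega>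
    proof -
      have "(U \<omega> - Z k \<omega>)\<^sup>2 = (\<Sum>j\<in>J. a j * (X j \<omega> - Y j k \<omega>))\<^sup>2"
        by (simp add: U_def Z_def sum_subtractf right_diff_distrib)
      also have "\<dots> \<le> (\<Sum>j\<in>J. (a j * (X j \<omega> - Y j k \<omega>))\<^sup>2) * real (card J)"
        by (rule sum_squared_le_sum_of_squares)
      finally show ?thesis by (simp add: sum_distrib_left sum_distrib_right power_mult_distrib power2_commute ac_simps)
    qed
    have "(\<integral>\<^sup>+\<omega>. ennreal ((U \<omega> - Z k \<omega>)\<^sup>2) \<partial>M) \<le>
        (\<integral>\<^sup>+\<omega>. (\<Sum>j\<in>J. ennreal (real (card J) * (a j)\<^sup>2) * ennreal ((Y j k \<omega> - X j \<omega>)\<^sup>2)) \<partial>M)"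
    proof (rule nn_integral_mono)
      fix \<omega>
      have "ennreal ((U \<omega> - Z k \<omega>)\<^sup>2) \<le> ennreal (\<Sum>j\<in>J. real (card J) * (a j)\<^sup>2 * (Y j k \<omega> - X j \<omega>)\<^sup>2)"
        by (rule ennreal_leI[OF pt])
      also have "\<dots> = (\<Sum>j\<in>J. ennreal (real (card J) * (a j)\<^sup>2) * ennreal ((Y j k \<omega> - X j \<omega>)\<^sup>2))"
        by (subst sum_ennreal[symmetric]) (simp_all add: ennreal_mult'')
      finally show "ennreal ((U \<omega> - Z k \<omega>)\<^sup>2) \<le> \<dots>" .
    qed
    also have "\<dots> = (\<Sum>j\<in>J. \<integral>\<^sup>+\<omega>. ennreal (real (card J) * (a j)\<^sup>2) * ennreal ((Y j k \<omega> - X j \<omega>)\<^sup>2) \<partial>M)"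
      by (rule nn_integral_sum) measurable
    also have "\<dots> = r k"
      unfolding r_def by (intro sum.cong refl nn_integral_cmult) measurable
    finally show ?thesis .
  qed
  let ?I = "\<integral>\<^sup>+\<omega>. ennreal ((U \<omega>)\<^sup>2) \<partial>M"
  \<comment> \<open>A weighted form of (y + (x - y))^2: the error term may carry the large factor 1
    + 1/\<epsilon> because it tends to 0 for fixed \<epsilon>. Afterwards \<epsilon> = 1 / Suc k
    tends to 0.\<close>
  have eps: "?I \<le> ennreal ((1 + \<epsilon>) * Q)" if "\<epsilon> > 0" for \<epsilon> :: real
  proof -
    have bound: "?I \<le> ennreal ((1 + \<epsilon>) * q k) + ennreal (1 + 1 / \<epsilon>) * r k" for k
    proof -
      have pt: "x\<^sup>2 \<le> (1 + \<epsilon>) * y\<^sup>2 + (1 + 1 / \<epsilon>) * (x - y)\<^sup>2" for x y :: real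
      proof -
        have "0 \<le> (\<epsilon> * y - (x - y))\<^sup>2 / \<epsilon>" using that by simp
        also have "\<dots> = \<epsilon> * y\<^sup>2 - 2 * y * (x - y) + (x - y)\<^sup>2 / \<epsilon>"
          using that by (simp add: power2_eq_square field_simps)
        finally have "0 \<le> \<epsilon> * y\<^sup>2 - 2 * y * (x - y) + (x - y)\<^sup>2 / \<epsilon>" .
        moreover have "x\<^sup>2 = y\<^sup>2 + 2 * y * (x - y) + (x - y)\<^sup>2" by (simp add: power2_eq_square algebra_simps)
        moreover have "(1 + \<epsilon>) * y\<^sup>2 = y\<^sup>2 + \<epsilon> * y\<^sup>2" "(1 + 1 / \<epsilon>) * (x - y)\<^sup>2 = (x - y)\<^sup>2 + (x - y)\<^sup>2 / \<epsilon>"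
          by (simp_all add: distrib_right)
        ultimately show ?thesis by linarith
      qed
      have "?I \<le> (\<integral>\<^sup>+\<omega>. ennreal (1 + \<epsilon>) * ennreal ((Z k \<omega>)\<^sup>2) + ennreal (1 + 1 / \<epsilon>) * ennreal ((U \<omega> - Z k \<omega>)\<^sup>2) \<partial>M)"
        using that pt by (intro nn_integral_mono) (simp add: ennreal_leI flip: ennreal_mult' ennreal_plus)
      also have "\<dots> = ennreal (1 + \<epsilon>) * ennreal (q k) + ennreal (1 + 1 / \<epsilon>) * (\<integral>\<^sup>+\<omega>. ennreal ((U \<omega> - Z k \<omega>)\<^sup>2) \<partial>M)"
        by (simp add: nn_integral_add nn_integral_cmult Z2)
      also have "\<dots> \<le> ennreal ((1 + \<epsilon>) * q k) + ennreal (1 + 1 / \<epsilon>) * r k"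
        using that Q0(2)[of k] ZU[of k] by (intro add_mono mult_left_mono) (simp_all add: ennreal_mult')
      finally show ?thesis .
    qed
    have "(\<lambda>k. ennreal ((1 + \<epsilon>) * q k) + ennreal (1 + 1 / \<epsilon>) * r k) \<longlonglongrightarrow> ennreal ((1 + \<epsilon>) * Q) + ennreal (1 + 1 / \<epsilon>) * 0"
      by (intro tendsto_add tendsto_ennrealI tendsto_mult_left qQ ennreal_tendsto_cmult r0) auto
    then have "?I \<le> ennreal ((1 + \<epsilon>) * Q) + ennreal (1 + 1 / \<epsilon>) * 0"
      by (rule LIMSEQ_le_const) (use bound in auto)
    then show ?thesis by simp
  qed
  have "(\<lambda>k. ennreal ((1 + 1 / real (Suc k)) * Q)) \<longlonglongrightarrow> ennreal ((1 + 0) * Q)"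
    using LIMSEQ_inverse_real_of_nat
    by (intro tendsto_ennrealI tendsto_mult tendsto_add tendsto_const) (simp add: inverse_eq_divide)
  then have "?I \<le> ennreal ((1 + 0) * Q)"
    by (rule LIMSEQ_le_const) (use eps in auto)
  then show ?thesis by (simp add: U_def Q_def)
qed

end

section \<open>The Stratonovich integral of psi\<close>

lemma stratonovich_coefficient_sum:
  "(\<Sum>j\<le>m div 2. (fact m / (fact j * fact (m - 2 * j) * 2 ^ j))\<^sup>2 * fact (m - 2 * j)) \<le> (2 ^ m * fact (m + 1) :: real)"
proof -
  have summand: "(fact m / (fact j * fact (m - 2 * j) * 2 ^ j))\<^sup>2 * fact (m - 2 * j) \<le> (fact m * real (m choose (2 * j)) :: real)"
    if j: "j \<in> {..m div 2}" for j
  proof -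
    have le: "2 * j \<le> m" using j by auto
    have c1: "real (m choose (2 * j)) = fact m / (fact (2 * j) * fact (m - 2 * j))" by (rule binomial_fact[OF le])
    have c2: "real (2 * j choose j) = fact (2 * j) / (fact j * fact j)"
      using binomial_fact[of j "2 * j"] by simp
    have "(2 * j) choose j \<le> 2 ^ (2 * j)" by (rule binomial_le_pow2)
    then have c4: "real (2 * j choose j) \<le> 2 ^ j * 2 ^ j"
      by (metis mult_2 of_nat_le_iff of_nat_numeral of_nat_power power_add)
    \<comment> \<open>Inserting (2 j)! above and below separates the binomial coefficient of m over
      2 j from the central one, and the latter is at most 4^j.\<close>
    have "(fact m / (fact j * fact (m - 2 * j) * 2 ^ j))\<^sup>2 * fact (m - 2 * j) =
        fact m * (fact m / (fact (2 * j) * fact (m - 2 * j))) * ((fact (2 * j) / (fact j * fact j)) / (2 ^ j * 2 ^ j :: real))"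
      by (simp add: power2_eq_square)
    also have "\<dots> = fact m * real (m choose (2 * j)) * (real (2 * j choose j) / (2 ^ j * 2 ^ j))"
      unfolding c1 c2 ..
    also have "\<dots> \<le> fact m * real (m choose (2 * j)) * 1"
      using c4 by (intro mult_left_mono) auto
    finally show ?thesis by simp
  qed
  have "(\<Sum>j\<le>m div 2. (fact m / (fact j * fact (m - 2 * j) * 2 ^ j))\<^sup>2 * fact (m - 2 * j)) \<le> (\<Sum>j\<le>m div 2. fact m * real (m choose (2 * j)))"
    by (intro sum_mono summand)
  also have "\<dots> = fact m * real (\<Sum>j\<le>m div 2. m choose (2 * j))" by (simp add: sum_distrib_left)
  also have "(\<Sum>j\<le>m div 2. m choose (2 * j)) = (\<Sum>i\<in>(\<lambda>j. 2 * j) ` {..m div 2}. m choose i)"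
    by (subst sum.reindex) (auto simp: inj_on_def)
  also have "\<dots> \<le> (\<Sum>i\<le>m. m choose i)" by (intro sum_mono2) auto
  also have "\<dots> = 2 ^ m" by (rule choose_row_sum)
  finally have "(\<Sum>j\<le>m div 2. (fact m / (fact j * fact (m - 2 * j) * 2 ^ j))\<^sup>2 * fact (m - 2 * j)) \<le> (fact m * 2 ^ m :: real)"
    by simp
  \<comment> \<open>m! is enlarged to (m + 1)! to match the stated constant.\<close>
  also have "\<dots> \<le> 2 ^ m * fact (m + 1)" by (simp add: fact_mono mult.commute del: fact_Suc)
  finally show ?thesis .
qed

locale stratonovich_setting = wiener_setting H emb tens M W + renewal H D e
  for H D e :: real and emb :: "(real \<Rightarrow> real) \<Rightarrow> 'h::{real_inner,complete_space}"
    and tens :: "'h list \<Rightarrow> 'k::{real_inner,complete_space}" and M :: "'p measure" and W :: "'h \<Rightarrow> 'p \<Rightarrow> real"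
begin

lemma exists_trace_representer:
  assumes "j \<le> m div 2"
  obtains x where "represents H emb tens (m - 2 * j) (frac_trace H j (psi_kernel m k)) x"
    "(norm x)\<^sup>2 \<le> full_trace H m (psi_kernel (2 * m) (2 * k))" "\<exists>X. is_wiener_int M W tens (m - 2 * j) x X"
proof -
  define n where "n = m - 2 * j"
  have m: "2 * j + n = m" using assms by (simp add: n_def)
  have f: "frac_trace H j (psi_kernel m k) = trace_psi j n k" by (simp add: trace_psi_def m)
  have B: "energy_form n (trace_psi j n k) (trace_psi j n k) \<le> ennreal (full_trace H m (psi_kernel (2 * m) (2 * k)))"
    using energy_form_trace_psi_le[of n j k] unfolding m .
  obtain x where x: "represents H emb tens n (trace_psi j n k) x" "(norm x)\<^sup>2 \<le> full_trace H m (psi_kernel (2 * m) (2 * k))"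
      "x \<in> closure (span (range (\<lambda>h. tens (replicate n h))))"
    using exists_representer[OF integrable_trace_psi trace_psi_nonneg B full_trace_nonneg trace_psi_permute] by blast
  then show ?thesis using that exists_wiener_int[OF x(3)] by (simp add: f n_def[symmetric])
qed

lemma stratonovich_defined_psi_kernel: "stratonovich_defined H emb tens M W m (psi_kernel m k)"
  unfolding stratonovich_defined_def
proof (intro conjI allI impI)
  show "symmetric_fun m (psi_kernel m k)" by (simp add: symmetric_fun_def psi_kernel_permute)
  fix j assume j: "j \<le> m div 2"
  then have m: "2 * j + (m - 2 * j) = m" by simp
  show "AE t in cube (m - 2 * j). integrable (cube (2 * j)) (trace_integrand H j (psi_kernel m k) t)"
    using integrable_trace_AE[where n = "m - 2 * j" and j = j and k = k] unfolding m .
  show "\<exists>x X. represents H emb tens (m - 2 * j) (frac_trace H j (psi_kernel m k)) x \<and> is_wiener_int M W tens (m - 2 * j) x X"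
    using exists_trace_representer[OF j] by blast
qed

theorem stratonovich_psi_kernel_bound:
  "(LINT \<omega>|M. (stratonovich H emb tens M W m (psi_kernel m k) \<omega>)\<^sup>2) \<le>
    2 ^ m * fact (m + 1) * full_trace H m (psi_kernel (2 * m) (2 * k))"
proof -
  let ?T = "full_trace H m (psi_kernel (2 * m) (2 * k))"
  define a :: "nat \<Rightarrow> real" where "a j = fact m / (fact j * fact (m - 2 * j) * 2 ^ j)" for j
  define x where "x j = tensor_of H emb tens (m - 2 * j) (frac_trace H j (psi_kernel m k))" for j
  define X where "X j = wiener_int M W tens (m - 2 * j) (x j)" for j
  have x: "(norm (x j))\<^sup>2 \<le> ?T \<and> is_wiener_int M W tens (m - 2 * j) (x j) (X j)" if j: "j \<le> m div 2" for j
  proof -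
    obtain y where y: "represents H emb tens (m - 2 * j) (frac_trace H j (psi_kernel m k)) y"
        "(norm y)\<^sup>2 \<le> ?T" "\<exists>X. is_wiener_int M W tens (m - 2 * j) y X"
      using exists_trace_representer[OF j] by blast
    \<comment> \<open>Here the choice operators disappear: \<open>THE\<close> in
      \<open>tensor_of\<close> by uniqueness of the representer, and in the next line
      \<open>SOME\<close> in \<open>wiener_int\<close> by existence.\<close>
    have "x j = y" unfolding x_def tensor_of_def using y(1) represents_unique by blast
    then show ?thesis using y(2) someI_ex[OF y(3)] by (simp add: X_def wiener_int_def)
  qed
  have "(\<integral>\<^sup>+\<omega>. ennreal ((\<Sum>j\<in>{..m div 2}. a j * X j \<omega>)\<^sup>2) \<partial>M) \<le>
      ennreal (\<Sum>j\<in>{..m div 2}. (a j)\<^sup>2 * (fact (m - 2 * j) * (norm (x j))\<^sup>2))"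
    \<comment> \<open>The orders m - 2 j are pairwise different for j up to m div 2, where the
      subtraction is not truncated.\<close>
    by (rule wiener_int_sum_bound) (use x in \<open>auto simp: inj_on_def\<close>)
  also have "\<dots> \<le> ennreal (2 ^ m * fact (m + 1) * ?T)"
  proof (rule ennreal_leI)
    have "(\<Sum>j\<le>m div 2. (a j)\<^sup>2 * (fact (m - 2 * j) * (norm (x j))\<^sup>2)) \<le> (\<Sum>j\<le>m div 2. (a j)\<^sup>2 * fact (m - 2 * j) * ?T)"
      using x by (intro sum_mono) (auto simp: mult.assoc intro!: mult_left_mono)
    also have "\<dots> = (\<Sum>j\<le>m div 2. (a j)\<^sup>2 * fact (m - 2 * j)) * ?T" by (simp add: sum_distrib_right)
    also have "\<dots> \<le> 2 ^ m * fact (m + 1) * ?T"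
      unfolding a_def by (intro mult_right_mono stratonovich_coefficient_sum full_trace_nonneg)
    finally show "(\<Sum>j\<le>m div 2. (a j)\<^sup>2 * (fact (m - 2 * j) * (norm (x j))\<^sup>2)) \<le> 2 ^ m * fact (m + 1) * ?T" .
  qed
  finally have bound: "(\<integral>\<^sup>+\<omega>. ennreal ((\<Sum>j\<le>m div 2. a j * X j \<omega>)\<^sup>2) \<partial>M) \<le> ennreal (2 ^ m * fact (m + 1) * ?T)" .
  have [measurable]: "X j \<in> borel_measurable M" if "j \<le> m div 2" for j
    using x[OF that] by (simp add: is_wiener_int_def)
  have meas: "(\<lambda>\<omega>. (\<Sum>j\<le>m div 2. a j * X j \<omega>)\<^sup>2) \<in> borel_measurable M" by measurable
  have "stratonovich H emb tens M W m (psi_kernel m k) = (\<lambda>\<omega>. \<Sum>j\<le>m div 2. a j * X j \<omega>)"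
    by (simp add: stratonovich_def stratonovich_defined_psi_kernel a_def X_def x_def)
  then have "(LINT \<omega>|M. (stratonovich H emb tens M W m (psi_kernel m k) \<omega>)\<^sup>2) = enn2real (\<integral>\<^sup>+\<omega>. ennreal ((\<Sum>j\<le>m div 2. a j * X j \<omega>)\<^sup>2) \<partial>M)"
    using meas by (simp add: integral_eq_nn_integral)
  also have "\<dots> \<le> enn2real (ennreal (2 ^ m * fact (m + 1) * ?T))"
    using bound by (rule enn2real_mono) simp
  also have "\<dots> = 2 ^ m * fact (m + 1) * ?T" using full_trace_nonneg[of m k] by simp
  finally show ?thesis .
qed

end

theorem lemma4p4:
  fixes H \<alpha> :: real
    and L :: "real \<Rightarrow> real"
    and N :: "'q measure" and \<tau> :: "'q \<Rightarrow> nat"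
    and emb :: "(real \<Rightarrow> real) \<Rightarrow> 'h::{real_inner,complete_space}"
    and tens :: "'h list \<Rightarrow> 'k::{real_inner,complete_space}"
    and M :: "'p measure" and W :: "'h \<Rightarrow> 'p \<Rightarrow> real"
    and m k :: nat
  assumes "1 / 2 < H" "H < 1" "\<alpha> > 0" "\<alpha> + 2 * H > 2"
    and "slowly_varying L"
    and "prob_space N"
    and "\<tau> \<in> measurable N (count_space UNIV)"
    and "\<forall>\<omega>\<in>space N. \<tau> \<omega> \<ge> 1"
    and "\<forall>n\<ge>1. measure N {\<omega> \<in> space N. \<tau> \<omega> = n} = L (real n) / real n powr (1 + \<alpha>)"
    and "is_completion H emb"
    and "is_tensor tens"
    and "isonormal M W"
  shows "(LINT \<omega>|M. (stratonovich H emb tens M W m (phi H \<alpha> N \<tau> m) \<omega>)\<^sup>2)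
           \<le> 2 ^ m * fact (m + 1) * full_trace H m (phi H \<alpha> N \<tau> (2 * m))
    \<and> (LINT \<omega>|M. (stratonovich H emb tens M W m (psi H \<alpha> N \<tau> m k) \<omega>)\<^sup>2)
           \<le> 2 ^ m * fact (m + 1) * full_trace H m (psi H \<alpha> N \<tau> (2 * m) (2 * k))"
proof -
  obtain D e where De: "D \<ge> 0" "e \<le> 0" "e + 2 * H > 1"
    and phi: "\<And>k. phi H \<alpha> N \<tau> k = renewal_density D e k"
    using phi_eq_renewal_density[OF assms(1-4), of N \<tau>] by blast
  interpret stratonovich_setting H D e emb tens M W
    by unfold_locales (use De assms in auto)
  have psi: "psi H \<alpha> N \<tau> m k = psi_kernel m k" for m k
    by (simp add: fun_eq_iff psi_def psi_kernel_def phi)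
  \<comment> \<open>\<open>cube 0\<close> is a single point of mass 1, so integrating over it is
    evaluation, and \<open>join m t\<close> with it agrees with t on the first m
    coordinates.\<close>
  have phi0: "phi H \<alpha> N \<tau> m = psi_kernel m 0" for m
  proof
    fix t
    have "psi_kernel m 0 t = \<rho> m (join m t (\<lambda>_. undefined))"
    proof -
      have "cube 0 = count_space {\<lambda>_. undefined}" by (simp add: cube_def PiM_empty)
      then show ?thesis by (simp add: psi_kernel_def lebesgue_integral_count_space_finite)
    qed
    also have "\<dots> = \<rho> m t" by (rule renewal_density_cong) (simp add: join_def)
    finally show "phi H \<alpha> N \<tau> m t = psi_kernel m 0 t" by (simp add: phi)
  qed
  show ?thesis
    using stratonovich_psi_kernel_bound[of m 0] stratonovich_psi_kernel_bound[of m k] by (simp add: phi0 psi)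
qed

end
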